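(* The function $$\Xi^{(3)}=\frac18\left(G_0^{(3)}-G_1^{(3)}+2G_2^{(3)}-8G_3^{(3)}\right)$$ is a holomorphic modular form of weight $8$ with respect to $\Gamma_3(1,2)$ and satisfies the factorization constraint $$\Xi^{(3)}|_{\mathcal H_1\times\mathcal H_2}=\Xi^{(1)}\cdot\Xi^{(2)}.$$
   Context: $\mathcal H_g$ is the Siegel upper half-space of symmetric complex $g\times g$ matrices with positive-definite imaginary part. The group $\mathrm{Sp}(2g,\mathbb Z)$ acts on $\mathcal H_g$ by $\gamma\circ\tau=(A\tau+B)(C\tau+D)^{-1}$ for $\gamma=\begin{pmatrix}A&B\\C&D\end{pmatrix}$. Let $\Gamma_g(1,2)\subset\mathrm{Sp}(2g,\mathbb Z)$ be the subgroup of those $\gamma$ for which the diagonals of $A\,{}^tB$ and $C\,{}^tD$ are $\equiv 0 \bmod 2$. A modular form of weight $w$ with respect to $\Gamma\subset\mathrm{Sp}(2g,\mathbb Z)$, for $g\ge2$, is a holomorphic function $f:\mathcal H_g\to\mathbb C$ with $f(\gamma\circ\tau)=\det(C\tau+D)^w f(\tau)$ for all $\gamma\in\Gamma$, $\tau\in\mathcal H_g$. Let $\mathbb Z_2=\mathbb Z/2\mathbb Z=\{0,1\}$. A characteristic is $v=\begin{bmatrix}\varepsilon\\\delta\end{bmatrix}\in\mathbb Z_2^{2g}$ with $\varepsilon,\delta\in\mathbb Z_2^g$. Lifting entries to $\{0,1\}\subset\mathbb Z$, the theta constant with characteristic $v$ is $$\theta[v](\tau)=\sum_{n\in\mathbb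 Z^g}\exp\Big(\pi i\big((n+\tfrac{\varepsilon}{2})^t\tau(n+\tfrac{\varepsilon}{2})+(n+\tfrac{\varepsilon}{2})^t\delta\big)\Big).$$ For $M\subset\mathbb Z_2^{2g}$ put $P_M(\tau)=\prod_{v\in M}\theta[v](\tau)$. For $0\le i\le 4$ put $$G_i^{(g)}(\tau)=\sum_{V\subset\mathbb Z_2^{2g},\ \dim V=i}P_V(\tau)^{2^{4-i}},$$ the sum being over all $i$-dimensional $\mathbb Z_2$-vector subspaces. Lower genus forms: $\Xi^{(1)}=\theta\begin{bmatrix}0\\0\end{bmatrix}^8\theta\begin{bmatrix}0\\1\end{bmatrix}^4\theta\begin{bmatrix}1\\0\end{bmatrix}^4=\frac12\big(G_0^{(1)}-G_1^{(1)}\big)$ and $\Xi^{(2)}=\frac14\big(G_0^{(2)}-G_1^{(2)}+2G_2^{(2)}\big)$. $\mathcal H_1\times\mathcal H_2$ is embedded in $\mathcal H_3$ as the block-diagonal matrices $\mathrm{diag}(\tau_1,\tau_2)$, and $f\cdot h$ denotes $(\tau_1,\tau_2)\mapsto f(\tau_1)h(\tau_2)$. *)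

theory Defs
  imports "HOL-Analysis.Analysis" "HOL-Library.Z2"
begin

section \<open>The Siegel upper half-space and the symplectic group\<close>

text \<open>The genus \<open>g\<close> is the cardinality of the index type \<open>'n\<close>. Objects of size \<open>2g\<close> are indexed
  by \<open>'n + 'n\<close>, with \<open>Inl\<close> for the first and \<open>Inr\<close> for the second block of \<open>g\<close> indices.\<close>

definition siegel :: "(complex^'n^'n) set" where
  "siegel = {\<tau>. transpose \<tau> = \<tau> \<and> (\<forall>x::real^'n. x \<noteq> 0 \<longrightarrow> 0 < x \<bullet> (map_matrix Im \<tau> *v x))}"

definition blockA :: "'a^('n + 'n)^('n + 'n) \<Rightarrow> 'a^'n^'n" where
  "blockA M = (\<chi> i j. M $ Inl i $ Inl j)"

definition blockB :: "'a^('n + 'n)^('n + 'n) \<Rightarrow> 'a^'n^'n" where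
  "blockB M = (\<chi> i j. M $ Inl i $ Inr j)"

definition blockC :: "'a^('n + 'n)^('n + 'n) \<Rightarrow> 'a^'n^'n" where
  "blockC M = (\<chi> i j. M $ Inr i $ Inl j)"

definition blockD :: "'a^('n + 'n)^('n + 'n) \<Rightarrow> 'a^'n^'n" where
  "blockD M = (\<chi> i j. M $ Inr i $ Inr j)"

text \<open>The standard symplectic form, with blocks \<open>0, 1, -1, 0\<close>.\<close>

definition symplectic_form :: "int^('n::finite + 'n)^('n + 'n)" where
  "symplectic_form = (\<chi> k l. case (k, l) of
      (Inl i, Inr j) \<Rightarrow> of_bool (i = j)
    | (Inr i, Inl j) \<Rightarrow> - of_bool (i = j)
    | _ \<Rightarrow> 0)"

definition Sp :: "(int^('n::finite + 'n)^('n + 'n)) set" where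
  "Sp = {\<gamma>. transpose \<gamma> ** symplectic_form ** \<gamma> = symplectic_form}"

definition Gamma12 :: "(int^('n::finite + 'n)^('n + 'n)) set" where
  "Gamma12 = {\<gamma> \<in> Sp.
      (\<forall>i. even ((blockA \<gamma> ** transpose (blockB \<gamma>)) $ i $ i)) \<and>
      (\<forall>i. even ((blockC \<gamma> ** transpose (blockD \<gamma>)) $ i $ i))}"

abbreviation complex_mat :: "int^'n^'m \<Rightarrow> complex^'n^'m" where
  "complex_mat \<equiv> map_matrix of_int"

definition automorphy :: "int^('n + 'n)^('n + 'n) \<Rightarrow> complex^'n^'n \<Rightarrow> complex^'n^'n" where
  "automorphy \<gamma> \<tau> = complex_mat (blockC \<gamma>) ** \<tau> + complex_mat (blockD \<gamma>)"

definition siegel_act :: "int^('n + 'n)^('n + 'n) \<Rightarrow> complex^'n^'n \<Rightarrow> complex^'n^'n" where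
  "siegel_act \<gamma> \<tau> =
    (complex_mat (blockA \<gamma>) ** \<tau> + complex_mat (blockB \<gamma>)) ** matrix_inv (automorphy \<gamma> \<tau>)"

section \<open>Modular forms\<close>

text \<open>\<open>siegel\<close> is open in the space of symmetric matrices, not in the space of all matrices, so
  the derivative is taken within \<open>siegel\<close>. Only its values on symmetric matrices are then
  determined; a complex-linear map on symmetric matrices extends to a complex-linear map on all
  matrices, so asking for complex linearity everywhere is no restriction.\<close>

definition holomorphic_on_siegel :: "(complex^'n^'n \<Rightarrow> complex) \<Rightarrow> bool" where
  "holomorphic_on_siegel f \<longleftrightarrow> (\<forall>\<tau>\<in>siegel. \<exists>f'.
      (f has_derivative f') (at \<tau> within siegel) \<and>
      (\<forall>c X. f' (map_matrix ((*) c) X) = c * f' X))"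

text \<open>For genus at least 2 no condition at the cusps is needed. Only the values of \<open>f\<close> on
  \<open>siegel\<close> matter.\<close>

definition modular_form ::
  "int \<Rightarrow> (int^('n + 'n)^('n + 'n)) set \<Rightarrow> (complex^'n^'n \<Rightarrow> complex) \<Rightarrow> bool" where
  "modular_form w \<Gamma> f \<longleftrightarrow> holomorphic_on_siegel f \<and>
    (\<forall>\<gamma>\<in>\<Gamma>. \<forall>\<tau>\<in>siegel. f (siegel_act \<gamma> \<tau>) = det (automorphy \<gamma> \<tau>) powi w * f \<tau>)"

section \<open>Theta constants\<close>

text \<open>Ensures that all sets of characteristics are finite, so that the finite sums and products
  over them below have their intended meaning.\<close>

instance bit :: finite
proof
  have "(UNIV :: bit set) = {0, 1}"
    by auto
  then show "finite (UNIV :: bit set)"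
    by (metis finite.emptyI finite.insertI)
qed

text \<open>\<open>of_bit\<close> lifts the entries of a characteristic to \<open>{0, 1}\<close>.\<close>

definition characteristic :: "bit^'n \<Rightarrow> bit^'n \<Rightarrow> bit^('n + 'n)" where
  "characteristic \<epsilon> \<delta> = (\<chi> k. case k of Inl i \<Rightarrow> \<epsilon> $ i | Inr i \<Rightarrow> \<delta> $ i)"

definition theta :: "bit^('n + 'n) \<Rightarrow> complex^'n^'n \<Rightarrow> complex" where
  "theta v \<tau> = (\<Sum>\<^sub>\<infinity>n::int^'n.
      let x = (\<lambda>i. of_int (n $ i) + of_bit (v $ Inl i) / 2) in
      exp (of_real pi * \<i> *
        ((\<Sum>i\<in>UNIV. \<Sum>j\<in>UNIV. x i * \<tau> $ i $ j * x j)
          + (\<Sum>i\<in>UNIV. x i * of_bit (v $ Inr i)))))"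

definition theta_prod :: "(bit^('n + 'n)) set \<Rightarrow> complex^'n^'n \<Rightarrow> complex" where
  "theta_prod M \<tau> = (\<Prod>v\<in>M. theta v \<tau>)"

definition G :: "nat \<Rightarrow> complex^'n^'n \<Rightarrow> complex" where
  "G i \<tau> = (\<Sum>V | vec.subspace V \<and> vec.dim V = i. theta_prod V \<tau> ^ 2 ^ (4 - i))"

section \<open>The forms in genus 1, 2 and 3\<close>

definition Xi1 :: "complex^1^1 \<Rightarrow> complex" where
  "Xi1 \<tau> = theta (characteristic 0 0) \<tau> ^ 8 * theta (characteristic 0 1) \<tau> ^ 4
    * theta (characteristic 1 0) \<tau> ^ 4"

definition Xi2 :: "complex^2^2 \<Rightarrow> complex" where
  "Xi2 \<tau> = 1/4 * (G 0 \<tau> - G 1 \<tau> + 2 * G 2 \<tau>)"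

definition Xi3 :: "complex^3^3 \<Rightarrow> complex" where
  "Xi3 \<tau> = 1/8 * (G 0 \<tau> - G 1 \<tau> + 2 * G 2 \<tau> - 8 * G 3 \<tau>)"

definition diag12 :: "complex^1^1 \<Rightarrow> complex^2^2 \<Rightarrow> complex^3^3" where
  "diag12 \<tau>\<^sub>1 \<tau>\<^sub>2 = vector [
     vector [\<tau>\<^sub>1 $ 1 $ 1, 0, 0],
     vector [0, \<tau>\<^sub>2 $ 1 $ 1, \<tau>\<^sub>2 $ 1 $ 2],
     vector [0, \<tau>\<^sub>2 $ 2 $ 1, \<tau>\<^sub>2 $ 2 $ 2]]"

end

theory Submission
  imports Defs "HOL-Probability.Characteristic_Functions" "HOL-Complex_Analysis.Conformal_Mappings"
begin

text \<open>For \<open>\<gamma> \<in> Sp(2g, \<int>)\<close> the squares \<open>\<theta>[v]\<^sup>2\<close> are permuted, up to the factor \<open>det (C\<tau> + D)\<close> and fourth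
  roots of unity, by the affine action of \<open>\<gamma>\<close> on characteristics. In the product over the eight
  points of an affine cube \<open>a + \<langle>b, c, d\<rangle>\<close> the roots of unity cancel. It suffices to check this on
  generators: translations, unimodular changes of basis, and inversions in a single coordinate, for
  which the one-dimensional inversion formula is enough. That formula follows for imaginary modulus
  by comparing Fourier coefficients and in general by analytic continuation. For subspaces of
  dimension at most 3, \<open>P\<^sub>V\<close> to the power \<open>2\<^bsup>4-i\<^esup>\<close> is the product of the \<open>\<theta>[v]\<^sup>2\<close> over a possibly
  degenerate cube. The elements of \<open>\<Gamma>(1,2)\<close> fix the zero characteristic, hence permute
  the subspaces of each dimension.

  On \<open>\<H>\<^sub>1 \<times> \<H>\<^sub>2\<close> the theta constants factor. The subspaces \<open>V\<close> are sorted by their projection to the first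
  factor: if it contains the odd characteristic the product vanishes, and otherwise \<open>V\<close> is given by
  its fibres over 0 and at most one nonzero even characteristic. Every 3-dimensional subspace in genus 2
  contains an odd characteristic. This expresses each \<open>G\<^sub>i\<close> through the sums in
  genus 1 and 2; Jacobi's quartic identity combines them into the product.\<close>

section \<open>The one-dimensional theta function\<close>

text \<open>The generators used are those of the full symplectic group; a translation by a symmetric
  matrix with odd diagonal, for instance, lies outside \<open>Gamma12\<close>. Hence a translation
  part \<open>t\<close> is carried along products, together with a relation
  (\<open>quad_shift\<close>) that determines \<open>t\<close> from the matrix alone. For
  \<open>Gamma12\<close> it is evaluated at unit vectors, whatever the factorization into
  generators. Eight squares are the right number. Under a generator the phase of a squared theta
  constant is a power of the imaginary unit whose exponent is quadratic in the 0/1 entries of the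
  characteristic. Over a three-dimensional cube a single entry sums to a multiple of 4, and a
  product of two entries sums to an even number and occurs with an even coefficient. The common
  factor equals the automorphy determinant only up to a fourth root of unity, which the eighth power
  removes; this gives weight 8. The coefficients of \<open>Xi3\<close> make the terms supported over
  a nonzero even characteristic of genus 1 a negative multiple of the same combination of genus 2
  sums that appears over 0.\<close>

lemma norm_exp_minus_one_minus_le: "norm (exp z - 1 - z) \<le> norm z ^ 2 * exp (norm z)" for z :: complex
proof -
  have "norm (exp z - (\<Sum>k\<le>1. z ^ k / fact k)) \<le> exp \<bar>Re z\<bar> * norm z ^ Suc 1 / fact 1"
    by (rule Taylor_exp)
  also have "\<dots> \<le> exp (norm z) * norm z ^ 2"
    by (simp add: abs_Re_le_cmod mult_right_mono power2_eq_square)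
  finally show ?thesis
    by (simp add: algebra_simps)
qed

lemma square_le_exp: "x ^ 2 \<le> 8 / r ^ 2 * exp (r / 2 * x)" if "r > 0" "x \<ge> 0" for x r :: real
proof -
  have "(r / 2 * x) ^ 2 / 2 \<le> exp (r / 2 * x)"
  proof -
    have "0 \<le> r / 2 * x" using that by simp
    from exp_lower_Taylor_quadratic[OF this] this show ?thesis by linarith
  qed
  hence "(r / 2 * x) ^ 2 \<le> 2 * exp (r / 2 * x)" using that by simp
  hence "r ^ 2 * x ^ 2 \<le> 8 * exp (r / 2 * x)" by (simp add: power_mult_distrib power_divide)
  thus ?thesis using that by (simp add: field_simps)
qed

text \<open>A single dominating series, with every term enlarged by \<open>exp (r * a n)\<close>,
  controls the derivative terms (\<open>b1\<close>), the values (\<open>b2\<close>) and the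
  second-order remainders (\<open>b3\<close>). The remainder summed over \<open>A\<close> is then a
  constant times \<open>norm H ^ 2\<close>, which is differentiability.\<close>

lemma has_derivative_infsum_exp:
  fixes w :: "'a \<Rightarrow> 'b::real_normed_vector \<Rightarrow> complex"
  assumes lin: "\<And>n. linear (w n)" and bd: "\<And>n H. norm (w n H) \<le> a n * norm H"
    and a: "\<And>n. a n \<ge> 0" and r: "r > 0"
    and summ: "(\<lambda>n. norm (c n) * exp (r * a n)) summable_on A"
  shows "((\<lambda>H. \<Sum>\<^sub>\<infinity>n\<in>A. c n * exp (w n H)) has_derivative (\<lambda>H. \<Sum>\<^sub>\<infinity>n\<in>A. c n * w n H)) (at 0)"
proof -
  define K where "K = (\<Sum>\<^sub>\<infinity>n\<in>A. norm (c n) * exp (r * a n))"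
  have K0: "K \<ge> 0" unfolding K_def by (intro infsum_nonneg) auto
  have smult: "(\<lambda>n. C * (norm (c n) * exp (r * a n))) summable_on A" for C
    using summ by (rule summable_on_cmult_right)
  have dom: "f summable_on A" "norm (infsum f A) \<le> C * K"
    if "\<And>n. n \<in> A \<Longrightarrow> norm (f n) \<le> C * (norm (c n) * exp (r * a n))" for f :: "'a \<Rightarrow> complex" and C
  proof -
    have 1: "(\<lambda>n. norm (f n)) summable_on A"
      by (rule summable_on_comparison_test[OF smult[of C]]) (use that in auto)
    show "f summable_on A" using 1 by (rule abs_summable_summable)
    have "norm (infsum f A) \<le> infsum (\<lambda>n. norm (f n)) A"
      using 1 by (rule norm_infsum_bound)
    also have "\<dots> \<le> infsum (\<lambda>n. C * (norm (c n) * exp (r * a n))) A"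
      by (rule infsum_mono[OF 1 smult]) (use that in auto)
    also have "\<dots> = C * K" unfolding K_def by (rule infsum_cmult_right')
    finally show "norm (infsum f A) \<le> C * K" .
  qed
  have b1: "norm (c n * w n H) \<le> (norm H / r) * (norm (c n) * exp (r * a n))" for n H
  proof -
    have "r * a n \<le> exp (r * a n)"
      using exp_ge_add_one_self[of "r * a n"] by linarith
    hence "a n \<le> exp (r * a n) / r" using r by (simp add: field_simps)
    hence "a n * norm H \<le> exp (r * a n) / r * norm H" by (rule mult_right_mono) auto
    with bd[of n H] have "norm (w n H) \<le> exp (r * a n) / r * norm H" by linarith
    hence "norm (c n) * norm (w n H) \<le> norm (c n) * (exp (r * a n) / r * norm H)"
      by (rule mult_left_mono) auto
    thus ?thesis by (simp add: norm_mult mult_ac)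
  qed
  have b2: "norm (c n * exp (w n H)) \<le> 1 * (norm (c n) * exp (r * a n))" if "norm H \<le> r" for n H
  proof -
    have "Re (w n H) \<le> norm (w n H)" by (rule complex_Re_le_cmod)
    also have "\<dots> \<le> a n * norm H" by (rule bd)
    also have "\<dots> \<le> a n * r" using that a by (rule mult_left_mono)
    finally show ?thesis by (simp add: norm_mult mult_left_mono mult.commute)
  qed
  have b3: "norm (c n * (exp (w n H) - 1 - w n H)) \<le> (norm H ^ 2 * (8 / r ^ 2)) * (norm (c n) * exp (r * a n))"
    if "norm H \<le> r / 2" for n H
  proof -
    have "norm (exp (w n H) - 1 - w n H) \<le> norm (w n H) ^ 2 * exp (norm (w n H))"
      by (rule norm_exp_minus_one_minus_le)
    also have "\<dots> \<le> (a n * norm H) ^ 2 * exp (a n * norm H)"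
      using bd[of n H] by (intro mult_mono power_mono) auto
    \<comment> \<open>The weight \<open>exp (r * a n)\<close> is split in halves: one absorbs the
      square by \<open>square_le_exp\<close>, the other absorbs \<open>exp (a n * norm H)\<close>.
      This is why \<open>norm H\<close> is limited to \<open>r / 2\<close>.\<close>
    also have "\<dots> \<le> (8 / r ^ 2 * exp (r / 2 * a n) * norm H ^ 2) * exp (r / 2 * a n)"
    proof (intro mult_mono)
      show "(a n * norm H)\<^sup>2 \<le> 8 / r\<^sup>2 * exp (r / 2 * a n) * (norm H)\<^sup>2"
        unfolding power_mult_distrib using square_le_exp[OF r a] by (rule mult_right_mono) auto
      show "exp (a n * norm H) \<le> exp (r / 2 * a n)"
        using mult_left_mono[OF that a[of n]] by (simp add: mult.commute)
    qed auto
    also have "\<dots> = norm H ^ 2 * (8 / r ^ 2) * exp (r * a n)"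
    proof -
      have "exp (r / 2 * a n) * exp (r / 2 * a n) = exp (r * a n)"
        unfolding mult_exp_exp by simp
      thus ?thesis by (simp add: mult_ac)
    qed
    finally have "norm (c n) * norm (exp (w n H) - 1 - w n H) \<le> norm (c n) * (norm H ^ 2 * (8 / r ^ 2) * exp (r * a n))"
      by (rule mult_left_mono) auto
    thus ?thesis by (simp add: norm_mult mult_ac)
  qed
  define f where "f H = (\<Sum>\<^sub>\<infinity>n\<in>A. c n * exp (w n H))" for H
  define D where "D H = (\<Sum>\<^sub>\<infinity>n\<in>A. c n * w n H)" for H
  have sD: "(\<lambda>n. c n * w n H) summable_on A" for H by (rule dom(1)[OF b1])
  have sf: "(\<lambda>n. c n * exp (w n H)) summable_on A" if "norm H \<le> r" for H
    by (rule dom(1)[OF b2[OF that]])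
  have "bounded_linear D"
  proof (rule bounded_linear_intro)
    fix x y :: 'b and s :: real
    show "D (x + y) = D x + D y"
      unfolding D_def linear_add[OF lin] distrib_left by (rule infsum_add[OF sD sD])
    have "D (s *\<^sub>R x) = (\<Sum>\<^sub>\<infinity>n\<in>A. of_real s * (c n * w n x))"
      unfolding D_def linear_scale[OF lin] by (simp add: scaleR_conv_of_real mult_ac)
    also have "\<dots> = of_real s * D x" unfolding D_def by (rule infsum_cmult_right')
    finally show "D (s *\<^sub>R x) = s *\<^sub>R D x" by (simp add: scaleR_conv_of_real)
    show "norm (D x) \<le> norm x * (K / r)"
      using dom(2)[OF b1, of x] unfolding D_def by simp
  qed
  moreover have "((\<lambda>H. norm (f (0 + H) - f 0 - D H) / norm H) \<longlongrightarrow> 0) (at 0)"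
  proof (rule Lim_null_comparison)
    have "norm (norm (f (0 + H) - f 0 - D H) / norm H) \<le> norm H * ((8 / r ^ 2) * K)"
      if H: "norm H \<le> r / 2" "H \<noteq> 0" for H
    proof -
      have Hr: "norm H \<le> r" using H r by simp
      have "f (0 + H) - f 0 - D H = (\<Sum>\<^sub>\<infinity>n\<in>A. c n * exp (w n H)) - (\<Sum>\<^sub>\<infinity>n\<in>A. c n) - (\<Sum>\<^sub>\<infinity>n\<in>A. c n * w n H)"
        by (simp add: f_def D_def linear_0[OF lin])
      also have "\<dots> = (\<Sum>\<^sub>\<infinity>n\<in>A. c n * (exp (w n H) - 1 - w n H))"
      proof -
        have s0: "c summable_on A" using sf[of 0] r by (simp add: linear_0[OF lin])
        have s3: "(\<lambda>n. c n * (exp (w n H) - 1 - w n H)) summable_on A"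
          by (rule dom(1)[OF b3[OF H(1)]])
        have "(\<Sum>\<^sub>\<infinity>n\<in>A. c n * exp (w n H)) = (\<Sum>\<^sub>\<infinity>n\<in>A. (c n * (exp (w n H) - 1 - w n H) + c n) + c n * w n H)"
          by (simp add: algebra_simps)
        also have "\<dots> = (\<Sum>\<^sub>\<infinity>n\<in>A. c n * (exp (w n H) - 1 - w n H)) + (\<Sum>\<^sub>\<infinity>n\<in>A. c n) + (\<Sum>\<^sub>\<infinity>n\<in>A. c n * w n H)"
          by (subst infsum_add[OF summable_on_add[OF s3 s0] sD], subst infsum_add[OF s3 s0]) simp
        finally show ?thesis by simp
      qed
      also have "norm \<dots> \<le> (norm H ^ 2 * (8 / r ^ 2)) * K"
        by (rule dom(2)[OF b3[OF H(1)]])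
      finally show ?thesis using H by (simp add: field_simps power2_eq_square)
    qed
    moreover have "\<forall>\<^sub>F H in at (0::'b). norm H \<le> r / 2 \<and> H \<noteq> 0"
      unfolding eventually_at using r by (intro exI[of _ "r / 2"]) auto
    ultimately show "\<forall>\<^sub>F H in at 0. norm (norm (f (0 + H) - f 0 - D H) / norm H) \<le> norm H * ((8 / r ^ 2) * K)"
      by (auto elim: eventually_mono)
    show "((\<lambda>H::'b. norm H * ((8 / r ^ 2) * K)) \<longlongrightarrow> 0) (at 0)"
      by (rule tendsto_eq_intros tendsto_norm_zero refl)+ auto
  qed
  ultimately have "(f has_derivative D) (at 0)" unfolding has_derivative_at by simp
  thus ?thesis unfolding f_def D_def .
qed

section \<open>Summability of exponential and Gaussian series\<close>

lemma summable_on_exp_neg_abs_int: "(\<lambda>m::int. exp (- \<bar>real_of_int m\<bar>)) summable_on UNIV"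
proof -
  have nat: "(\<lambda>n::nat. exp (- real n)) summable_on UNIV"
  proof (rule norm_summable_imp_summable_on)
    have "summable (\<lambda>n. exp (-1::real) ^ n)" by (rule summable_geometric) simp
    thus "summable (\<lambda>n. norm (exp (- real n)))" by (simp flip: exp_of_nat_mult)
  qed
  have "(\<lambda>m::int. exp (- \<bar>real_of_int m\<bar>)) summable_on range int"
    by (subst summable_on_reindex) (use nat in \<open>auto simp: o_def\<close>)
  moreover have "(\<lambda>m::int. exp (- \<bar>real_of_int m\<bar>)) summable_on range (\<lambda>n. - int n)"
    by (subst summable_on_reindex) (use nat in \<open>auto simp: o_def inj_on_def\<close>)
  ultimately have "(\<lambda>m::int. exp (- \<bar>real_of_int m\<bar>)) summable_on (range int \<union> range (\<lambda>n. - int n))"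
    by (rule summable_on_union)
  also have "range int \<union> range (\<lambda>n. - int n) = UNIV"
    by (auto simp: image_iff) (metis int_cases2)
  finally show ?thesis .
qed

text \<open>Summability is read off from the product formula: an \<open>infsum\<close> that does not
  exist is 0 by default, whereas here its value is a product of positive sums.\<close>

lemma summable_on_exp_neg_abs_vec:
  "(\<lambda>n::int^'n. exp (- (\<Sum>i\<in>UNIV. \<bar>real_of_int (n $ i)\<bar>))) summable_on UNIV"
proof -
  let ?e = "\<lambda>m::int. exp (- \<bar>real_of_int m\<bar>)"
  have pos: "infsum ?e UNIV > 0"
  proof -
    have "0 < infsum ?e {0}" by simp
    also have "\<dots> \<le> infsum ?e UNIV"
      by (rule infsum_mono_neutral) (use summable_on_exp_neg_abs_int in auto)
    finally show ?thesis .
  qed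
  have "infsum (\<lambda>g. \<Prod>i\<in>(UNIV::'n set). ?e (g i)) (PiE UNIV (\<lambda>_. UNIV)) = (\<Prod>i\<in>(UNIV::'n set). infsum ?e UNIV)"
    by (rule infsum_prod_PiE_abs) (use summable_on_exp_neg_abs_int in auto)
  hence "infsum (\<lambda>g. \<Prod>i\<in>(UNIV::'n set). ?e (g i)) (PiE UNIV (\<lambda>_. UNIV)) \<noteq> 0" using pos by simp
  hence s: "(\<lambda>g. \<Prod>i\<in>(UNIV::'n set). ?e (g i)) summable_on (PiE UNIV (\<lambda>_. UNIV))"
    using infsum_not_exists by blast
  have "(\<lambda>n::int^'n. \<Prod>i\<in>UNIV. ?e (n $ i)) summable_on UNIV \<longleftrightarrow>
        (\<lambda>g. \<Prod>i\<in>(UNIV::'n set). ?e (g i)) summable_on (PiE UNIV (\<lambda>_. UNIV))"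
    by (rule summable_on_reindex_bij_witness[of _ vec_lambda vec_nth]) auto
  with s show ?thesis by (simp add: exp_sum sum_negf flip: sum_negf)
qed

text \<open>Completing the square. The constant is the exponential of the maximum of
  \<open>(k + 1) * \<bar>x\<bar> - e * x ^ 2\<close>; the extra 1 leaves the decaying
  factor.\<close>

lemma exp_quadratic_le: 
  assumes "e > 0" shows "exp (- e * x ^ 2 + k * \<bar>x\<bar>) \<le> exp ((k + 1) ^ 2 / (4 * e)) * exp (- \<bar>x::real\<bar>)"
proof -
  have "0 \<le> (2 * e * \<bar>x\<bar> - (k + 1)) ^ 2" by simp
  also have "\<dots> = 4 * e * (e * x ^ 2 - (k + 1) * \<bar>x\<bar>) + (k + 1) ^ 2"
    by (simp add: power2_eq_square algebra_simps abs_mult_self_eq)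
  finally have "4 * e * ((k + 1) * \<bar>x\<bar> - e * x ^ 2) \<le> (k + 1) ^ 2" by (simp add: algebra_simps)
  hence "(k + 1) * \<bar>x\<bar> - e * x ^ 2 \<le> (k + 1) ^ 2 / (4 * e)"
    using assms by (simp add: field_simps)
  thus ?thesis by (simp add: algebra_simps flip: exp_add)
qed

section \<open>Uniqueness of Fourier coefficients of continuous periodic functions\<close>

lemma integral_trig_poly_eq_0:
  fixes f :: "real \<Rightarrow> real"
  assumes cont: "continuous_on UNIV f"
    and coeff: "\<And>n c. integral {0..1} (\<lambda>x. f x * cos (2 * pi * of_int n * x + c)) = 0"
  shows "integral {0..1} (\<lambda>x. f x * ((1 + cos (2 * pi * (x - x0))) / 2) ^ k * cos (2 * pi * of_int n * x + c)) = 0"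
proof (induction k arbitrary: n c)
  case 0
  show ?case using coeff by simp
next
  case (Suc k)
  define g where "g = (\<lambda>x. f x * ((1 + cos (2 * pi * (x - x0))) / 2) ^ k)"
  have ig: "(\<lambda>x. g x * cos (2 * pi * of_int n * x + c)) integrable_on {0..1}" for n c
    unfolding g_def
    by (intro integrable_continuous_interval continuous_intros continuous_on_subset[OF cont]) auto
  have IH: "integral {0..1} (\<lambda>x. g x * cos (2 * pi * of_int n * x + c)) = 0" for n c
    unfolding g_def by (rule Suc)
  \<comment> \<open>The product formula for cosines turns one more kernel factor into a combination
    of the frequencies \<open>n - 1\<close>, \<open>n\<close> and \<open>n + 1\<close>, with phases
    shifted by \<open>2 * pi * x0\<close>. Hence the induction has to run over all phases
    \<open>c\<close>.\<close>
  have "f x * ((1 + cos (2 * pi * (x - x0))) / 2) ^ Suc k * cos (2 * pi * of_int n * x + c) =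
      1/2 * (g x * cos (2 * pi * of_int n * x + c)) +
      (1/4 * (g x * cos (2 * pi * of_int (n + 1) * x + (c - 2 * pi * x0)))
       + 1/4 * (g x * cos (2 * pi * of_int (n - 1) * x + (c + 2 * pi * x0))))" for x
  proof -
    define A where "A = 2 * pi * of_int n * x + c"
    define B where "B = 2 * pi * (x - x0)"
    have AB: "2 * pi * of_int (n + 1) * x + (c - 2 * pi * x0) = A + B"
      "2 * pi * of_int (n - 1) * x + (c + 2 * pi * x0) = A - B"
      by (simp_all add: A_def B_def algebra_simps)
    have "g x * ((1 + cos B) / 2) * cos A = 1/2 * (g x * cos A) + (1/4 * (g x * cos (A + B)) + 1/4 * (g x * cos (A - B)))"
      by (simp add: cos_add cos_diff field_simps)
    moreover have "f x * ((1 + cos B) / 2) ^ Suc k * cos A = g x * ((1 + cos B) / 2) * cos A"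
      by (simp only: g_def B_def power_Suc mult_ac)
    ultimately show ?thesis unfolding AB unfolding A_def B_def by (rule trans[rotated])
  qed
  note eq = this
  have H: "((\<lambda>x. g x * cos (2 * pi * of_int n * x + c)) has_integral 0) {0..1}" for n c
    using integrable_integral[OF ig] unfolding IH .
  show ?case unfolding eq
    using has_integral_add[OF has_integral_mult_right[OF H, of "1/2"] has_integral_add[OF has_integral_mult_right[OF H, of "1/4"] has_integral_mult_right[OF H, of "1/4"]]]
    unfolding mult_zero_right add_0_right by (rule integral_unique)
qed

lemma half_one_plus_cos: "0 \<le> (1 + cos u) / 2" "(1 + cos u) / 2 \<le> 1" for u :: real
proof -
  have "0 \<le> 1 + cos u" using cos_ge_minus_one[of u] by linarith
  thus "0 \<le> (1 + cos u) / 2" by (rule divide_nonneg_pos) simp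
  have "1 + cos u \<le> 2" using cos_le_one[of u] by linarith
  thus "(1 + cos u) / 2 \<le> 1" by simp
qed

text \<open>A peaking-kernel argument. The powers of \<open>T\<close> concentrate at
  \<open>x0\<close>: \<open>T\<close> is at most \<open>q\<close> wherever \<open>f\<close> is below
  \<open>e\<close>, and at least \<open>q' > q\<close> on a short interval where \<open>f\<close> is
  at least \<open>e\<close>. The integral of \<open>f * T ^ k\<close> vanishes but is bounded below
  by \<open>e * q' ^ k * l - M * q ^ k\<close>, which is positive for large \<open>k\<close>. The
  one-sided conclusion is applied to both signs.\<close>

lemma continuous_periodic_fourier_unique_real:
  fixes f :: "real \<Rightarrow> real"
  assumes cont: "continuous_on UNIV f" and per: "\<And>x. f (x + 1) = f x"
    and coeff: "\<And>n c. integral {0..1} (\<lambda>x. f x * cos (2 * pi * of_int n * x + c)) = 0"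
    and x0: "0 \<le> x0" "x0 < 1"
  shows "f x0 \<le> 0"
proof (rule ccontr)
  assume "\<not> f x0 \<le> 0"
  hence pos: "f x0 > 0" by simp
  define T where "T = (\<lambda>x. (1 + cos (2 * pi * (x - x0))) / 2)"
  define e where "e = f x0 / 2"
  have e: "e > 0" using pos by (simp add: e_def)
  have perz: "f (x + of_int m) = f x" for x and m :: int
  proof (induction m rule: int_induct[of _ 0])
    case (step1 i) thus ?case using per[of "x + of_int i"] by (simp add: algebra_simps)
  next
    case (step2 i) thus ?case using per[of "x + of_int (i - 1)"] by (simp add: algebra_simps)
  qed auto
  have "isCont f x0" using cont by (simp add: continuous_on_eq_continuous_at)
  then obtain d0 where d0: "d0 > 0" "\<And>x. \<bar>x - x0\<bar> < d0 \<Longrightarrow> \<bar>f x - f x0\<bar> < e"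
    using e unfolding continuous_at_eps_delta dist_real_def by meson
  \<comment> \<open>Any bound below 1/4 in place of 1/5 keeps \<open>cos (2 * pi * d)\<close>
    positive and thus \<open>q\<close> positive.\<close>
  define d where "d = min (d0 / 2) (1/5)"
  have d: "d > 0" "d < 1/4" using d0 by (auto simp: d_def)
  have near: "f x \<ge> e" if "\<bar>x - x0\<bar> \<le> d" for x
  proof -
    have "\<bar>f x - f x0\<bar> < e" using that d0 by (intro d0) (auto simp: d_def)
    thus ?thesis by (simp add: e_def abs_if split: if_splits)
  qed
  define q where "q = (1 + cos (2 * pi * d)) / 2"
  define q' where "q' = (1 + cos (pi * d)) / 2"
  have "cos (2 * pi * d) > 0" using d pi_gt_zero by (intro cos_gt_zero) (auto simp: field_simps)
  hence q: "q > 0" by (simp add: q_def)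
  have "pi * d \<le> pi" using d by simp
  have "cos (2 * pi * d) < cos (pi * d)"
    using d pi_gt_zero by (intro cos_monotone_0_pi) auto
  hence qq': "q < q'" by (simp add: q_def q'_def)
  have far: "T x \<le> q" if "f x < e" for x
  proof -
    \<comment> \<open>Periodicity replaces \<open>x - x0\<close> by its representative
      \<open>u\<close> in [-1/2, 1/2], on which the kernel decreases with
      \<open>\<bar>u\<bar>\<close>.\<close>
    define m where "m = round (x - x0)"
    define u where "u = x - x0 - of_int m"
    have u: "\<bar>u\<bar> \<le> 1/2" using of_int_round_abs_le[of "x - x0"] unfolding u_def m_def by (simp add: abs_minus_commute)
    have "d < \<bar>u\<bar>"
    proof (rule ccontr)
      assume "\<not> d < \<bar>u\<bar>"
      hence "f (x0 + u) \<ge> e" by (intro near) auto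
      moreover have "f (x0 + u) = f x" using perz[of x "-m"] by (simp add: u_def algebra_simps)
      ultimately show False using that by simp
    qed
    have "cos (2 * pi * (x - x0)) = cos (2 * pi * u + 2 * pi * of_int m)"
      by (simp add: u_def algebra_simps)
    also have "\<dots> = cos (2 * pi * u)" by (simp add: cos_add)
    also have "\<dots> = cos \<bar>2 * pi * u\<bar>" by simp
    also have "\<dots> = cos (2 * pi * \<bar>u\<bar>)" by (simp add: abs_mult)
    also have "\<dots> \<le> cos (2 * pi * d)"
      using d u \<open>d < \<bar>u\<bar>\<close> pi_gt_zero by (intro cos_monotone_0_pi_le) (auto simp: field_simps)
    finally show ?thesis by (simp add: T_def q_def)
  qed
  have T0: "T x \<ge> 0" and T1: "T x \<le> 1" for x
    unfolding T_def by (rule half_one_plus_cos)+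
  \<comment> \<open>The interval extends only to the right of \<open>x0\<close>, so that it stays
    inside [0, 1] even for \<open>x0 = 0\<close>. Its length at most \<open>d / 2\<close> gives the
    larger kernel bound \<open>q'\<close>.\<close>
  define l where "l = min (d / 2) (1 - x0)"
  have l: "l > 0" "x0 + l \<le> 1" "l \<le> d / 2" using d x0 by (auto simp: l_def min_def)
  have nearT: "T x \<ge> q'" if "x \<in> {x0..x0+l}" for x
  proof -
    have "cos (2 * pi * (x - x0)) \<ge> cos (pi * d)"
    proof (rule cos_monotone_0_pi_le)
      have "2 * (x - x0) \<le> d" using that l by auto
      hence "pi * (2 * (x - x0)) \<le> pi * d" by (intro mult_left_mono) auto
      thus "2 * pi * (x - x0) \<le> pi * d" by (simp add: mult_ac)
    qed (use that d in auto)
    thus ?thesis by (simp add: T_def q'_def)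
  qed
  have "compact (f ` {0..1})"
    by (intro compact_continuous_image continuous_on_subset[OF cont]) auto
  then obtain M where M: "M > 0" "\<And>x. x \<in> {0..1} \<Longrightarrow> \<bar>f x\<bar> \<le> M"
    using compact_imp_bounded[of "f ` {0..1}"] unfolding bounded_pos by auto
  have key: "(q' / q) ^ k \<le> M / (e * l)" for k
  proof -
    define g where "g = (\<lambda>x. if x \<in> {x0..x0+l} then e * q' ^ k else 0)"
    have ig: "(g has_integral (e * q' ^ k * l)) {0..1}"
    proof -
      have "((\<lambda>x. e * q' ^ k) has_integral (e * q' ^ k * l)) {x0..x0+l}"
        using has_integral_const_real[of "e * q' ^ k" x0 "x0 + l"] l by (simp add: mult.commute)
      thus ?thesis unfolding g_def using has_integral_restrict[of "{x0..x0+l}" "{0..1}" "\<lambda>x. e * q' ^ k"] l x0 by simp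
    qed
    have iM: "((\<lambda>x. M * q ^ k) has_integral M * q ^ k) {0..1::real}"
      using has_integral_const_real[of "M * q ^ k" 0 1] by simp
    have int: "((\<lambda>x. f x * T x ^ k) has_integral 0) {0..1}"
    proof -
      have "integral {0..1} (\<lambda>x. f x * T x ^ k) = 0"
        using integral_trig_poly_eq_0[OF cont coeff, of x0 k 0 0] by (simp add: T_def)
      moreover have "(\<lambda>x. f x * T x ^ k) integrable_on {0..1}"
        unfolding T_def by (intro integrable_continuous_interval continuous_intros continuous_on_subset[OF cont]) auto
      ultimately show ?thesis by (metis integrable_integral)
    qed
    have "e * q' ^ k * l - M * q ^ k \<le> 0"
    proof (rule has_integral_le[OF has_integral_diff[OF ig iM] int])
      fix x :: real assume x: "x \<in> {0..1}"
      show "g x - M * q ^ k \<le> f x * T x ^ k"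
      proof (cases "f x < e")
        case True
        have "x \<notin> {x0..x0+l}" using near[of x] True l d by fastforce
        hence "g x = 0" unfolding g_def by (rule if_not_P)
        moreover have "- M * q ^ k \<le> f x * T x ^ k"
        proof -
          have "- (f x * T x ^ k) \<le> \<bar>f x\<bar> * T x ^ k" using T0[of x]
            by (metis abs_ge_minus_self minus_mult_left mult_right_mono zero_le_power)
          also have "\<dots> \<le> M * q ^ k" using M(2)[OF x] far[OF True] T0[of x] M(1)
            by (intro mult_mono power_mono) auto
          finally show ?thesis by simp
        qed
        ultimately show ?thesis by simp
      next
        case False
        have "g x \<le> f x * T x ^ k"
        proof (cases "x \<in> {x0..x0+l}")
          case True
          have "e * q' ^ k \<le> f x * T x ^ k"
            using False nearT[OF True] e q qq' by (intro mult_mono power_mono) auto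
          thus ?thesis unfolding g_def if_P[OF True] .
        next
          case F: False
          have "0 \<le> f x * T x ^ k" using False e T0[of x] by (intro mult_nonneg_nonneg) auto
          thus ?thesis unfolding g_def if_not_P[OF F] .
        qed
        moreover have "M * q ^ k \<ge> 0" using M q by simp
        ultimately show ?thesis by linarith
      qed
    qed
    thus ?thesis using e l q by (simp add: field_simps power_divide)
  qed
  have "q' / q > 1" using q qq' by simp
  then obtain k where "M / (e * l) < (q' / q) ^ k" using real_arch_pow by blast
  with key[of k] show False by simp
qed

text \<open>The coefficients at \<open>n\<close> and \<open>- n\<close> combine to the integral
  against every phase-shifted cosine. The real case then applies to the real and imaginary parts and
  their negatives.\<close>

lemma continuous_periodic_fourier_unique:
  fixes f :: "real \<Rightarrow> complex"
  assumes cont: "continuous_on UNIV f" and per: "\<And>x. f (x + 1) = f x"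
    and coeff: "\<And>n::int. integral {0..1} (\<lambda>x. f x * exp (2 * pi * \<i> * of_int n * x)) = 0"
  shows "f x = 0"
proof -
  have cosI: "integral {0..1} (\<lambda>x. f x * of_real (cos (2 * pi * of_int n * x + c))) = 0" for n c
  proof -
    have "f x * of_real (cos (2 * pi * of_int n * x + c)) =
       exp (\<i> * c) / 2 * (f x * exp (2 * pi * \<i> * of_int n * x))
       + exp (- (\<i> * c)) / 2 * (f x * exp (2 * pi * \<i> * of_int (-n) * x))" for x :: real
    proof -
      have "complex_of_real (cos (2 * pi * of_int n * x + c)) = cos (of_real (2 * pi * of_int n * x + c))"
        by (rule cos_of_real[symmetric])
      also have "\<dots> = (exp (\<i> * of_real (2 * pi * of_int n * x + c)) + exp (- \<i> * of_real (2 * pi * of_int n * x + c))) / 2"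
        by (rule cos_exp_eq[THEN trans]) simp
      also have "exp (\<i> * of_real (2 * pi * of_int n * x + c)) = exp (\<i> * c) * exp (2 * pi * \<i> * of_int n * x)"
        unfolding mult_exp_exp by (rule arg_cong[where f = exp]) (simp add: algebra_simps)
      also have "exp (- \<i> * of_real (2 * pi * of_int n * x + c)) = exp (- (\<i> * c)) * exp (2 * pi * \<i> * of_int (-n) * x)"
        unfolding mult_exp_exp by (rule arg_cong[where f = exp]) (simp add: algebra_simps)
      finally show ?thesis by (simp only: ring_distribs add_divide_distrib times_divide_eq_left times_divide_eq_right mult_ac)
    qed
    note eq = this
    have "(\<lambda>x. f x * exp (2 * pi * \<i> * of_int n * x)) integrable_on {0..1}" for n
      by (intro integrable_continuous_interval continuous_intros continuous_on_subset[OF cont]) auto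
    hence H: "((\<lambda>x. f x * exp (2 * pi * \<i> * of_int n * x)) has_integral 0) {0..1}" for n
      using coeff[of n] by (metis integrable_integral)
    show ?thesis unfolding eq
      using has_integral_add[OF has_integral_mult_right[OF H] has_integral_mult_right[OF H]]
      unfolding mult_zero_right add_0_right by (rule integral_unique)
  qed
  have cint: "(\<lambda>x. f x * of_real (cos (2 * pi * of_int n * x + c))) integrable_on {0..1}" for n c
    by (intro integrable_continuous_interval continuous_intros continuous_on_subset[OF cont]) auto
  have "integral {0..1} (\<lambda>x. Re (f x) * cos (2 * pi * of_int n * x + c)) = 0" for n c
    using integral_linear[OF cint bounded_linear_Re, of n c] cosI[of n c] by (simp add: o_def)
  moreover have "integral {0..1} (\<lambda>x. Im (f x) * cos (2 * pi * of_int n * x + c)) = 0" for n c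
    using integral_linear[OF cint bounded_linear_Im, of n c] cosI[of n c] by (simp add: o_def)
  ultimately have *: "Re (f y) \<le> 0 \<and> - Re (f y) \<le> 0 \<and> Im (f y) \<le> 0 \<and> - Im (f y) \<le> 0"
    if "0 \<le> y" "y < 1" for y
    using that per cont
    by (intro conjI continuous_periodic_fourier_unique_real[of "\<lambda>x. Re (f x)"] continuous_periodic_fourier_unique_real[of "\<lambda>x. Im (f x)"]
         continuous_periodic_fourier_unique_real[of "\<lambda>x. - Re (f x)"] continuous_periodic_fourier_unique_real[of "\<lambda>x. - Im (f x)"] continuous_intros) auto
  have perz: "f (x + of_int m) = f x" for x and m :: int
  proof (induction m rule: int_induct[of _ 0])
    case (step1 i) thus ?case using per[of "x + of_int i"] by (simp add: algebra_simps)
  next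
    case (step2 i) thus ?case using per[of "x + of_int (i - 1)"] by (simp add: algebra_simps)
  qed auto
  have "f (frac x) = 0" using *[of "frac x"] frac_lt_1[of x] by (simp add: complex_eq_iff)
  thus ?thesis using perz[of "frac x" "\<lfloor>x\<rfloor>"] by (simp add: frac_def)
qed

section \<open>Interchange of sum and integral, and the Gaussian integral\<close>

lemma
  fixes f :: "'a \<Rightarrow> real \<Rightarrow> complex"
  assumes cont: "\<And>m. m \<in> A \<Longrightarrow> continuous_on {a..b} (f m)"
    and bd: "\<And>m x. m \<in> A \<Longrightarrow> x \<in> {a..b} \<Longrightarrow> norm (f m x) \<le> M m" and M: "M summable_on A"
  shows has_sum_integral_infsum:
      "((\<lambda>m. integral {a..b} (f m)) has_sum integral {a..b} (\<lambda>x. \<Sum>\<^sub>\<infinity>m\<in>A. f m x)) A"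
    and continuous_on_infsum: "continuous_on {a..b} (\<lambda>x. \<Sum>\<^sub>\<infinity>m\<in>A. f m x)"
proof -
  have u: "uniform_limit {a..b} (\<lambda>X x. \<Sum>m\<in>X. f m x) (\<lambda>x. \<Sum>\<^sub>\<infinity>m\<in>A. f m x) (finite_subsets_at_top A)"
    using bd M by (rule Weierstrass_m_test_general)
  have sub: "\<forall>\<^sub>F X in finite_subsets_at_top A. finite X \<and> X \<subseteq> A"
    by (rule eventually_finite_subsets_at_top_weakI) auto
  show "continuous_on {a..b} (\<lambda>x. \<Sum>\<^sub>\<infinity>m\<in>A. f m x)"
    by (rule uniform_limit_theorem[OF _ u]) (use sub cont in \<open>auto elim!: eventually_mono intro!: continuous_on_sum\<close>)
  \<comment> \<open>Intersecting with \<open>A\<close> makes the partial sums continuous for every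
    \<open>X\<close> and not just eventually along the filter, the form in which
    \<open>uniform_limit_integral\<close> is applied.\<close>
  have c: "continuous_on {a..b} (\<lambda>x. \<Sum>m\<in>X \<inter> A. f m x)" for X
    by (intro continuous_on_sum cont) auto
  have u': "uniform_limit {a..b} (\<lambda>X x. \<Sum>m\<in>X \<inter> A. f m x) (\<lambda>x. \<Sum>\<^sub>\<infinity>m\<in>A. f m x) (finite_subsets_at_top A)"
    by (rule uniform_limit_cong[THEN iffD1, OF _ _ u])
       (use sub in \<open>auto elim!: eventually_mono simp: Int_absorb2\<close>)
  obtain I J where IJ: "\<And>X. ((\<lambda>x. \<Sum>m\<in>X \<inter> A. f m x) has_integral I X) {a..b}"
      "((\<lambda>x. \<Sum>\<^sub>\<infinity>m\<in>A. f m x) has_integral J) {a..b}" "(I \<longlongrightarrow> J) (finite_subsets_at_top A)"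
    using uniform_limit_integral[OF u' c] by auto
  have "\<forall>\<^sub>F X in finite_subsets_at_top A. I X = (\<Sum>m\<in>X. integral {a..b} (f m))"
    using sub
  proof eventually_elim
    case (elim X)
    hence "I X = integral {a..b} (\<lambda>x. \<Sum>m\<in>X. f m x)" using IJ(1)[of X] by (simp add: Int_absorb2 integral_unique)
    also have "\<dots> = (\<Sum>m\<in>X. integral {a..b} (f m))"
      using elim cont by (intro integral_sum integrable_continuous_interval) auto
    finally show ?case .
  qed
  hence "((\<lambda>X. \<Sum>m\<in>X. integral {a..b} (f m)) \<longlongrightarrow> J) (finite_subsets_at_top A)"
    using IJ(3) tendsto_cong by blast
  thus "((\<lambda>m. integral {a..b} (f m)) has_sum integral {a..b} (\<lambda>x. \<Sum>\<^sub>\<infinity>m\<in>A. f m x)) A"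
    using IJ(2) by (simp add: has_sum_def integral_unique)
qed

text \<open>The substitution \<open>u = s * x\<close> with \<open>s ^ 2 = 2 * pi / y\<close> turns
  the integral into the characteristic function of the standard normal distribution at
  \<open>2 * pi * \<xi> / s\<close>.\<close>

lemma gaussian_fourier_transform:
  assumes y: "y > 0"
  shows "((\<lambda>x. exp (- of_real (pi * x ^ 2 / y)) * exp (\<i> * of_real (2 * pi * \<xi> * x)))
     has_integral of_real (sqrt y * exp (- (pi * y * \<xi> ^ 2)))) UNIV"
proof -
  define s where "s = sqrt (2 * pi / y)"
  have s: "s > 0" "s ^ 2 = 2 * pi / y" using y by (auto simp: s_def)
  define t where "t = 2 * pi * \<xi> / s"
  define F where "F = (\<lambda>u. std_normal_density u *\<^sub>R iexp (t * u))"
  have i1: "integrable lborel F"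
    unfolding F_def
    by (rule Bochner_Integration.integrable_bound[where f = std_normal_density])
       (auto intro!: integrable_normal_density)
  have "char std_normal_distribution t = (LINT u|lborel. F u)"
    unfolding char_def F_def by (subst integral_density) auto
  hence I: "(LINT u|lborel. F u) = of_real (exp (- (t ^ 2) / 2))"
    by (simp add: char_std_normal_distribution)
  have i0: "has_bochner_integral lborel F (of_real (exp (- (t ^ 2) / 2)))"
    unfolding has_bochner_integral_iff using i1 I by (rule conjI)
  have "has_bochner_integral lborel (\<lambda>x. F (0 + s * x)) (of_real (exp (- (t ^ 2) / 2)) /\<^sub>R \<bar>s\<bar>)"
    using lborel_has_bochner_integral_real_affine_iff[of s F "of_real (exp (- (t ^ 2) / 2))" 0] s(1) i0 by blast
  hence i2: "has_bochner_integral lborel (\<lambda>x. F (s * x)) ((1 / s) *\<^sub>R of_real (exp (- (t ^ 2) / 2)))"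
    using s(1) by (simp only: add_0_left abs_of_pos inverse_eq_divide)
  hence "((\<lambda>x. F (s * x)) has_integral ((1 / s) *\<^sub>R of_real (exp (- (t ^ 2) / 2)))) UNIV"
    using has_integral_integral_lborel[of "\<lambda>x. F (s * x)"] unfolding has_bochner_integral_iff by metis
  from has_integral_mult_right[OF this, of "of_real (sqrt (2 * pi))"]
  have h: "((\<lambda>x. of_real (sqrt (2 * pi)) * F (s * x)) has_integral (of_real (sqrt (2 * pi)) * ((1 / s) *\<^sub>R of_real (exp (- (t ^ 2) / 2))))) UNIV" .
  have e1: "of_real (sqrt (2 * pi)) * F (s * x) = exp (- of_real (pi * x ^ 2 / y)) * exp (\<i> * of_real (2 * pi * \<xi> * x))" for x
  proof -
    have "(s * x) ^ 2 / 2 = pi * x ^ 2 / y" using s y by (simp add: power_mult_distrib)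
    hence "- ((s * x) ^ 2) / 2 = - (pi * x ^ 2 / y)" by simp
    moreover have "t * (s * x) = 2 * pi * \<xi> * x" using s by (simp add: t_def)
    ultimately have "F (s * x) = ((1 / sqrt (2 * pi)) * exp (- (pi * x ^ 2 / y))) *\<^sub>R exp (\<i> * of_real (2 * pi * \<xi> * x))"
      unfolding F_def std_normal_density_def by (simp only:)
    hence "of_real (sqrt (2 * pi)) * F (s * x) = of_real (exp (- (pi * x ^ 2 / y))) * exp (\<i> * of_real (2 * pi * \<xi> * x))"
      by (simp add: scaleR_conv_of_real)
    thus ?thesis unfolding exp_of_real[symmetric] of_real_minus .
  qed
  have e2: "of_real (sqrt (2 * pi)) * ((1 / s) *\<^sub>R of_real (exp (- (t ^ 2) / 2))) = (of_real (sqrt y * exp (- (pi * y * \<xi> ^ 2))) :: complex)"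
  proof -
    have "sqrt (2 * pi) * (1 / s) = sqrt y" using y by (simp add: s_def real_sqrt_divide)
    moreover have "t ^ 2 / 2 = pi * y * \<xi> ^ 2" using s y by (simp add: t_def power_divide power_mult_distrib) (simp add: field_simps power2_eq_square)
    ultimately have "sqrt (2 * pi) * ((1 / s) * exp (- (t ^ 2) / 2)) = sqrt y * exp (- (pi * y * \<xi> ^ 2))"
      by (simp only: mult.assoc[symmetric] minus_divide_left[symmetric])
    thus ?thesis by (simp only: scaleR_conv_of_real of_real_mult[symmetric])
  qed
  show ?thesis using h unfolding e1 e2 .
qed

lemma has_derivative_infsum_exp_at:
  fixes w :: "'a \<Rightarrow> 'b::real_normed_vector \<Rightarrow> complex"
  assumes f: "\<And>y. f y = (\<Sum>\<^sub>\<infinity>n\<in>A. c n * exp (w n (y - x)))"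
    and "\<And>n. linear (w n)" "\<And>n H. norm (w n H) \<le> a n * norm H"
    "\<And>n. a n \<ge> 0" "r > 0" "(\<lambda>n. norm (c n) * exp (r * a n)) summable_on A"
  shows "(f has_derivative (\<lambda>H. \<Sum>\<^sub>\<infinity>n\<in>A. c n * w n H)) (at x)"
proof -
  have "((\<lambda>H. \<Sum>\<^sub>\<infinity>n\<in>A. c n * exp (w n H)) has_derivative (\<lambda>H. \<Sum>\<^sub>\<infinity>n\<in>A. c n * w n H)) (at (x - x))"
    using has_derivative_infsum_exp[OF assms(2-6)] by simp
  moreover have "((\<lambda>y. y - x) has_derivative (\<lambda>h. h)) (at x)"
    by (auto intro!: derivative_eq_intros)
  ultimately have "((\<lambda>y. \<Sum>\<^sub>\<infinity>n\<in>A. c n * exp (w n (y - x))) has_derivative (\<lambda>H. \<Sum>\<^sub>\<infinity>n\<in>A. c n * w n H)) (at x)"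
    using has_derivative_compose[of "\<lambda>y. y - x" "\<lambda>h. h" x UNIV] by blast
  thus ?thesis unfolding f[abs_def] .
qed

lemma summable_on_gaussian_int:
  fixes e k :: real
  assumes "e > 0" shows "(\<lambda>m::int. exp (- e * of_int m ^ 2 + k * \<bar>of_int m\<bar>)) summable_on (UNIV :: int set)"
proof (rule summable_on_comparison_test)
  show "(\<lambda>m::int. exp ((k + 1) ^ 2 / (4 * e)) * exp (- \<bar>of_int m\<bar>)) summable_on UNIV"
    by (rule summable_on_cmult_right[OF summable_on_exp_neg_abs_int])
qed (use exp_quadratic_le[OF assms] in auto)

section \<open>Jacobi's theta function in two variables and its inversion formula\<close>

definition jtheta :: "complex \<Rightarrow> complex \<Rightarrow> complex" where
  "jtheta z t = (\<Sum>\<^sub>\<infinity>m::int. exp (pi * \<i> * (t * of_int m ^ 2 + 2 * of_int m * z)))"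

lemma norm_jtheta_term:
  "norm (exp (pi * \<i> * (t * of_int m ^ 2 + 2 * of_int m * z))) = exp (- (pi * Im t) * of_int m ^ 2 - 2 * pi * of_int m * Im z)"
proof -
  have "complex_of_int m ^ 2 = of_real (of_int (m ^ 2))" by simp
  hence "Im (t * of_int m ^ 2) = Im t * of_int m ^ 2" by (simp del: of_real_of_int_eq)
  thus ?thesis by (simp add: algebra_simps)
qed

lemma jtheta_term_le:
  "norm (exp (pi * \<i> * (t * of_int m ^ 2 + 2 * of_int m * z))) \<le> exp (- (pi * Im t) * of_int m ^ 2 + 2 * pi * \<bar>Im z\<bar> * \<bar>of_int m\<bar>)"
proof -
  have "- (of_int m * Im z) \<le> \<bar>of_int m\<bar> * \<bar>Im z\<bar>" by (metis abs_ge_minus_self abs_mult)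
  hence "pi * (- (of_int m * Im z)) \<le> pi * (\<bar>of_int m\<bar> * \<bar>Im z\<bar>)" by (rule mult_left_mono) simp
  thus ?thesis unfolding norm_jtheta_term by (simp add: mult_ac)
qed

text \<open>Around a given \<open>z\<close> each exponent is linear in the increment, with
  coefficient of size \<open>2 * pi * \<bar>m\<bar>\<close>, and the Gaussian decay in
  \<open>m\<close> outweighs this. The real derivative found this way is multiplication by a complex
  number.\<close>

lemma jtheta_holomorphic_z [holomorphic_intros]:
  assumes t: "Im t > 0" and f: "f holomorphic_on S"
  shows "(\<lambda>z. jtheta (f z) t) holomorphic_on S"
proof -
  have "(\<lambda>z. jtheta z t) holomorphic_on UNIV"
    unfolding holomorphic_on_open[OF open_UNIV]
  proof
    fix z
    define c where "c = (\<lambda>m::int. exp (pi * \<i> * (t * of_int m ^ 2 + 2 * of_int m * z)))"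
    define w where "w = (\<lambda>(m::int) H. 2 * pi * \<i> * of_int m * H)"
    have *: "((\<lambda>z. jtheta z t) has_derivative (\<lambda>H. \<Sum>\<^sub>\<infinity>m. c m * w m H)) (at z)"
    proof (rule has_derivative_infsum_exp_at)
      show "jtheta y t = (\<Sum>\<^sub>\<infinity>m. c m * exp (w m (y - z)))" for y
        unfolding jtheta_def c_def w_def mult_exp_exp by (simp add: algebra_simps)
      show "linear (w m)" for m
        unfolding w_def by (intro linearI) (simp_all add: algebra_simps scaleR_conv_of_real)
      show "norm (w m H) \<le> (2 * pi * \<bar>of_int m\<bar>) * norm H" for m H
        by (simp add: w_def norm_mult)
      show "(\<lambda>m. norm (c m) * exp (1 * (2 * pi * \<bar>of_int m\<bar>))) summable_on UNIV"
      proof (rule summable_on_comparison_test)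
        show "(\<lambda>m::int. exp (- (pi * Im t) * of_int m ^ 2 + (2 * pi * \<bar>Im z\<bar> + 2 * pi) * \<bar>of_int m\<bar>)) summable_on UNIV"
          using t by (intro summable_on_gaussian_int) simp
        show "norm (c m) * exp (1 * (2 * pi * \<bar>of_int m\<bar>)) \<le> exp (- (pi * Im t) * of_int m ^ 2 + (2 * pi * \<bar>Im z\<bar> + 2 * pi) * \<bar>of_int m\<bar>)" for m
          using mult_right_mono[OF jtheta_term_le[of t m z], of "exp (1 * (2 * pi * \<bar>of_int m\<bar>))"]
          unfolding c_def mult_exp_exp by (simp add: algebra_simps)
      qed auto
    qed auto
    have "(\<lambda>H. \<Sum>\<^sub>\<infinity>m. c m * w m H) = (\<lambda>H. (\<Sum>\<^sub>\<infinity>m. c m * w m 1) * H)"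
      by (simp add: w_def infsum_cmult_left' flip: mult.assoc)
    with * show "\<exists>f'. ((\<lambda>z. jtheta z t) has_field_derivative f') (at z)"
      unfolding has_field_derivative_def by (metis (no_types, lifting))
  qed
  from holomorphic_on_compose_gen[OF f this] show ?thesis by (simp add: o_def)
qed

text \<open>The argument may move linearly with the modulus, because
  \<open>jtheta (z / t) (- 1 / t)\<close> has modulus \<open>s = - 1 / t\<close> and argument
  \<open>- z * s\<close>. The radius \<open>Im t / 2\<close> leaves half of the Gaussian
  decay.\<close>

lemma jtheta_holomorphic_t: "(\<lambda>t. jtheta (t * u + v) t) holomorphic_on {t. Im t > 0}"
  unfolding holomorphic_on_open[OF open_halfspace_Im_gt]
proof
  fix t :: complex assume "t \<in> {t. Im t > 0}"
  hence t: "Im t > 0" by simp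
  define z where "z = t * u + v"
  define c where "c = (\<lambda>m::int. exp (pi * \<i> * (t * of_int m ^ 2 + 2 * of_int m * z)))"
  define w where "w = (\<lambda>(m::int) H. pi * \<i> * (of_int m ^ 2 + 2 * of_int m * u) * H)"
  have *: "((\<lambda>t. jtheta (t * u + v) t) has_derivative (\<lambda>H. \<Sum>\<^sub>\<infinity>m. c m * w m H)) (at t)"
  proof (rule has_derivative_infsum_exp_at)
    show "jtheta (y * u + v) y = (\<Sum>\<^sub>\<infinity>m. c m * exp (w m (y - t)))" for y
      unfolding jtheta_def c_def w_def z_def mult_exp_exp by (simp add: algebra_simps)
    show "linear (w m)" for m
      unfolding w_def by (intro linearI) (simp_all add: algebra_simps scaleR_conv_of_real)
    show "norm (w m H) \<le> (pi * (of_int m ^ 2 + 2 * norm u * \<bar>of_int m\<bar>)) * norm H" for m H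
    proof -
      have "norm (of_int m ^ 2 + 2 * of_int m * u) \<le> of_int m ^ 2 + 2 * norm u * \<bar>of_int m\<bar>"
        by (rule order.trans[OF norm_triangle_ineq]) (simp add: norm_mult norm_power)
      thus ?thesis unfolding w_def norm_mult by (simp add: mult_right_mono)
    qed
    show "(\<lambda>m. norm (c m) * exp (Im t / 2 * (pi * (of_int m ^ 2 + 2 * norm u * \<bar>of_int m\<bar>)))) summable_on UNIV"
    proof (rule summable_on_comparison_test)
      show "(\<lambda>m::int. exp (- (pi * Im t / 2) * of_int m ^ 2 + (2 * pi * \<bar>Im z\<bar> + Im t * pi * norm u) * \<bar>of_int m\<bar>)) summable_on UNIV"
        using t by (intro summable_on_gaussian_int) simp
      show "norm (c m) * exp (Im t / 2 * (pi * (of_int m ^ 2 + 2 * norm u * \<bar>of_int m\<bar>))) \<le> exp (- (pi * Im t / 2) * of_int m ^ 2 + (2 * pi * \<bar>Im z\<bar> + Im t * pi * norm u) * \<bar>of_int m\<bar>)" for m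
        using mult_right_mono[OF jtheta_term_le[of t m z], of "exp (Im t / 2 * (pi * (of_int m ^ 2 + 2 * norm u * \<bar>of_int m\<bar>)))"]
        unfolding c_def mult_exp_exp by (simp add: algebra_simps)
    qed auto
    show "Im t / 2 > 0" using t by simp
  qed auto
  have "(\<lambda>H. \<Sum>\<^sub>\<infinity>m. c m * w m H) = (\<lambda>H. (\<Sum>\<^sub>\<infinity>m. c m * w m 1) * H)"
    by (simp add: w_def infsum_cmult_left' flip: mult.assoc)
  with * show "\<exists>f'. ((\<lambda>t. jtheta (t * u + v) t) has_field_derivative f') (at t)"
    unfolding has_field_derivative_def by (metis (no_types, lifting))
qed

lemma integral_exp_2pi_int:
  "((\<lambda>x. exp (2 * pi * \<i> * of_int k * of_real x)) has_integral (if k = 0 then 1 else 0)) {0..1}"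
proof (cases "k = 0")
  case True
  thus ?thesis using has_integral_const_real[of "1::complex" 0 1] by simp
next
  case False
  define a where "a = 2 * pi * \<i> * of_int k"
  have a: "a \<noteq> 0" using False by (simp add: a_def)
  have "((\<lambda>x. exp (a * of_real x)) has_integral (exp (a * of_real 1) / a - exp (a * of_real 0) / a)) {0..1}"
  proof (rule fundamental_theorem_of_calculus)
    fix x :: real
    have "((\<lambda>x. exp (a * x) / a) has_field_derivative exp (a * of_real x)) (at (of_real x))"
      using a by (auto intro!: derivative_eq_intros)
    from has_vector_derivative_real_field[OF this, of UNIV]
    show "((\<lambda>x. exp (a * of_real x) / a) has_vector_derivative exp (a * of_real x)) (at x within {0..1})"
      by (metis has_vector_derivative_at_within)
  qed simp
  moreover have "exp a = 1"
    unfolding a_def exp_eq_1 by (auto intro!: exI[of _ k])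
  ultimately show ?thesis using False by (simp add: a_def)
qed

text \<open>Unfolding: the translates of the unit interval tile the line, so the sum over
  \<open>- N, ..., N\<close> is the integral over \<open>[- N, N + 1]\<close>. As \<open>N\<close>
  grows it tends both to the unordered sum \<open>S\<close> and to the integral
  \<open>I\<close>.\<close>

lemma has_sum_integral_translates:
  fixes F :: "real \<Rightarrow> complex"
  assumes cont: "continuous_on UNIV F" and I: "(F has_integral I) UNIV"
    and S: "((\<lambda>m::int. integral {0..1} (\<lambda>x. F (x - of_int m))) has_sum S) UNIV"
  shows "S = I"
proof -
  define a where "a = (\<lambda>m::int. integral {0..1} (\<lambda>x. F (x - of_int m)))"
  have int: "F integrable_on {u..v}" for u v
    by (intro integrable_continuous_interval continuous_on_subset[OF cont]) auto
  have a: "a m = integral {- of_int m..1 - of_int m} F" for m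
    using integral_shift_real_ivl[of "- of_int m" "- of_int m" "1 - of_int m" F] by (simp add: a_def)
  have part: "(\<Sum>m\<in>{- int N..int N}. a m) = integral {- real N..1 + real N} F" for N
  proof (induction N)
    case 0
    show ?case by (simp add: a)
  next
    case (Suc N)
    have "{- int (Suc N)..int (Suc N)} = insert (- int (Suc N)) (insert (int (Suc N)) {- int N..int N})"
      by auto
    hence "(\<Sum>m\<in>{- int (Suc N)..int (Suc N)}. a m) = a (- int (Suc N)) + (a (int (Suc N)) + (\<Sum>m\<in>{- int N..int N}. a m))"
      by simp
    also have "\<dots> = integral {1 + real N..2 + real N} F + (integral {- 1 - real N..- real N} F + integral {- real N..1 + real N} F)"
      unfolding Suc by (simp add: a add_ac)
    also have "integral {- 1 - real N..- real N} F + integral {- real N..1 + real N} F = integral {- 1 - real N..1 + real N} F"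
      by (rule Henstock_Kurzweil_Integration.integral_combine[OF _ _ int]) auto
    also have "integral {1 + real N..2 + real N} F + integral {- 1 - real N..1 + real N} F = integral {- 1 - real N..2 + real N} F"
      by (subst add.commute, rule Henstock_Kurzweil_Integration.integral_combine[OF _ _ int]) auto
    finally show ?case by (simp add: add_ac)
  qed
  have "filterlim (\<lambda>N. {- int N..int N}) (finite_subsets_at_top UNIV) sequentially"
    unfolding filterlim_finite_subsets_at_top
  proof safe
    fix X :: "int set" assume X: "finite X"
    define K where "K = nat (Max (insert 0 (abs ` X)))"
    have K: "\<bar>x\<bar> \<le> int K" if "x \<in> X" for x
      unfolding K_def using that X by (simp add: Max_ge_iff)
    have "X \<subseteq> {- int N..int N}" if "N \<ge> K" for N
      using K that by (force simp: abs_le_iff)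
    thus "\<forall>\<^sub>F N in sequentially. finite {- int N..int N} \<and> X \<subseteq> {- int N..int N} \<and> {- int N..int N} \<subseteq> UNIV"
      by (intro eventually_sequentiallyI[of K]) auto
  qed
  from filterlim_compose[OF S[unfolded has_sum_def] this]
  have lim1: "(\<lambda>N. integral {- real N..1 + real N} F) \<longlonglongrightarrow> S"
    unfolding part[symmetric] a_def .
  have lim2: "(\<lambda>N. integral {- real N..1 + real N} F) \<longlonglongrightarrow> I"
  proof (rule LIMSEQ_I)
    fix e :: real assume "e > 0"
    then obtain B where B: "B > 0" "\<And>u v. ball 0 B \<subseteq> cbox u v \<Longrightarrow> norm (integral (cbox u v) F - I) < e"
      using I unfolding has_integral_alt'[of F I UNIV] by auto
    have "norm (integral {- real N..1 + real N} F - I) < e" if "N \<ge> nat \<lceil>B\<rceil>" for N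
    proof -
      have "B \<le> real N" using that by linarith
      hence "ball 0 B \<subseteq> cbox (- real N) (1 + real N)" by (auto simp: dist_real_def)
      thus ?thesis using B(2) by simp
    qed
    thus "\<exists>n0. \<forall>n\<ge>n0. norm (integral {- real n..1 + real n} F - I) < e" by blast
  qed
  show ?thesis using LIMSEQ_unique[OF lim1 lim2] .
qed

lemma jtheta_add_1: "jtheta (z + 1) t = jtheta z t"
proof -
  have "exp (pi * \<i> * (t * of_int m ^ 2 + 2 * of_int m * (z + 1))) = exp (pi * \<i> * (t * of_int m ^ 2 + 2 * of_int m * z))" for m :: int
  proof -
    have "exp (pi * \<i> * (t * of_int m ^ 2 + 2 * of_int m * (z + 1))) =
       exp (pi * \<i> * (t * of_int m ^ 2 + 2 * of_int m * z)) * exp (2 * pi * \<i> * of_int m)"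
      unfolding mult_exp_exp by (simp add: algebra_simps)
    moreover have "exp (2 * pi * \<i> * of_int m) = 1"
      unfolding exp_eq_1 by (auto intro!: exI[of _ m])
    ultimately show ?thesis by simp
  qed
  thus ?thesis unfolding jtheta_def by simp
qed

text \<open>Completing the square in the exponent. The inverted theta function times its exponential
  factor is thereby the periodization of a Gaussian.\<close>

lemma jtheta_inverse_eq:
  "exp (- (pi * \<i> * z ^ 2 / t)) * jtheta (z / t) (- 1 / t) = (\<Sum>\<^sub>\<infinity>m::int. exp (- (pi * \<i> * (z - of_int m) ^ 2 / t)))"
  unfolding jtheta_def infsum_cmult_right'[symmetric] mult_exp_exp
  by (intro infsum_cong arg_cong[where f = exp])
     (simp add: power2_diff add_divide_distrib diff_divide_distrib algebra_simps)

lemma norm_exp_minus_of_real: "norm (exp (- complex_of_real a)) = exp (- a)"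
  by simp

text \<open>This is Poisson summation. The exponential of frequency \<open>n\<close> is invariant
  under integer translations, so the \<open>n\<close>-th coefficient of the periodized Gaussian
  \<open>h\<close> unfolds to its Fourier transform at \<open>n\<close>. The coefficients of the
  series \<open>Q\<close> come directly from orthogonality, and the two differ by the factor
  \<open>sqrt y\<close>.\<close>

lemma jtheta_inversion_real:
  fixes y x :: real
  assumes y: "y > 0"
  defines "t \<equiv> \<i> * of_real y"
  shows "exp (- (pi * \<i> * of_real x ^ 2 / t)) * jtheta (of_real x / t) (- 1 / t) = of_real (sqrt y) * jtheta (of_real x) t"
proof -
  have t: "t \<noteq> 0" "Im t > 0" "Im (- 1 / t) > 0"
    using y by (auto simp: t_def Im_divide power2_eq_square)
  define h where "h = (\<lambda>x::real. exp (- (pi * \<i> * of_real x ^ 2 / t)) * jtheta (of_real x / t) (- 1 / t))"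
  define Q where "Q = (\<lambda>x::real. jtheta (of_real x) t)"
  have gauss: "exp (- (pi * \<i> * (of_real x - of_int m) ^ 2 / t)) = exp (- of_real (pi * (x - of_int m) ^ 2 / y))" for x and m :: int
    using y by (simp add: t_def field_simps)
  have h: "h x = (\<Sum>\<^sub>\<infinity>m::int. exp (- of_real (pi * (x - of_int m) ^ 2 / y)))" for x
    unfolding h_def jtheta_inverse_eq gauss ..
  have hcont: "continuous_on UNIV h"
  proof -
    have "(\<lambda>z. exp (- (pi * \<i> * z ^ 2 / t)) * jtheta (z / t) (- 1 / t)) holomorphic_on UNIV"
      using t by (intro holomorphic_intros) auto
    from continuous_on_compose2[OF holomorphic_on_imp_continuous_on[OF this], of UNIV of_real]
    show ?thesis unfolding h_def by (auto intro: continuous_intros)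
  qed
  have Qcont: "continuous_on UNIV Q"
  proof -
    have "(\<lambda>z. jtheta z t) holomorphic_on UNIV"
      using t by (intro holomorphic_intros) auto
    from continuous_on_compose2[OF holomorphic_on_imp_continuous_on[OF this], of UNIV of_real]
    show ?thesis unfolding Q_def by (auto intro: continuous_intros)
  qed
  have hper: "h (x + 1) = h x" for x
    unfolding h by (rule infsum_reindex_bij_witness[of _ "\<lambda>m. m + 1" "\<lambda>m. m - 1"]) (auto simp: algebra_simps)
  have Qper: "Q (x + 1) = Q x" for x
    unfolding Q_def using jtheta_add_1[of "of_real x"] by simp
  have hcoeff: "((\<lambda>x. h x * exp (2 * pi * \<i> * of_int n * x)) has_integral of_real (sqrt y * exp (- (pi * y * of_int n ^ 2)))) {0..1}" for n :: int
  proof -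
    define F where "F = (\<lambda>x. exp (- of_real (pi * x ^ 2 / y)) * exp (\<i> * of_real (2 * pi * of_int n * x)) :: complex)"
    have Fcont: "continuous_on UNIV F"
      unfolding F_def using y by (intro continuous_intros) auto
    have Fshift: "F (x - of_int m) = exp (- of_real (pi * (x - of_int m) ^ 2 / y)) * exp (2 * pi * \<i> * of_int n * x)" for x and m :: int
    proof -
      have "exp (\<i> * of_real (2 * pi * of_int n * (x - of_int m))) = exp (2 * pi * \<i> * of_int n * x) * exp (2 * pi * \<i> * of_int (- (n * m)))"
        unfolding mult_exp_exp by (rule arg_cong[where f = exp]) (simp add: algebra_simps)
      moreover have "exp (2 * pi * \<i> * of_int (- (n * m))) = 1"
        unfolding exp_eq_1 by (auto intro!: exI[of _ "- (n * m)"])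
      ultimately show ?thesis unfolding F_def by (simp only: mult_1_right)
    qed
    have FI: "(F has_integral of_real (sqrt y * exp (- (pi * y * of_int n ^ 2)))) UNIV"
      unfolding F_def by (rule gaussian_fourier_transform[OF y])
    have "((\<lambda>m::int. integral {0..1} (\<lambda>x. F (x - of_int m))) has_sum integral {0..1} (\<lambda>x. \<Sum>\<^sub>\<infinity>m::int. F (x - of_int m))) UNIV"
    proof (rule has_sum_integral_infsum)
      show "continuous_on {0..1} (\<lambda>x. F (x - of_int m))" for m :: int
        by (intro continuous_on_compose2[OF Fcont] continuous_intros) auto
      show "(\<lambda>m::int. exp (- (pi / y) * of_int m ^ 2 + (2 * pi / y) * \<bar>of_int m\<bar>)) summable_on UNIV"
        using y by (intro summable_on_gaussian_int) simp
      fix m :: int and x :: real assume x: "x \<in> {0..1}"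
      have n1: "norm (F (x - of_int m)) = exp (- (pi * (x - of_int m) ^ 2 / y))"
        unfolding F_def norm_mult norm_exp_i_times norm_exp_minus_of_real by (rule mult_1_right)
      have "of_int m ^ 2 - 2 * \<bar>of_int m\<bar> \<le> (x - of_int m) ^ 2"
      proof -
        have "x * of_int m \<le> 1 * \<bar>of_int m\<bar>"
          using x by (rule_tac order.trans[OF abs_ge_self]) (auto simp: abs_mult intro!: mult_left_le_one_le)
        moreover have "0 \<le> x ^ 2" by simp
        ultimately show ?thesis unfolding power2_diff by linarith
      qed
      hence "(pi / y) * (of_int m ^ 2 - 2 * \<bar>of_int m\<bar>) \<le> (pi / y) * (x - of_int m) ^ 2"
        using y by (intro mult_left_mono) auto
      hence "exp (- (pi * (x - of_int m) ^ 2 / y)) \<le> exp (- (pi / y) * of_int m ^ 2 + (2 * pi / y) * \<bar>of_int m\<bar>)"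
        by (simp add: algebra_simps)
      thus "norm (F (x - of_int m)) \<le> exp (- (pi / y) * of_int m ^ 2 + (2 * pi / y) * \<bar>of_int m\<bar>)" unfolding n1 .
    qed
    from has_sum_integral_translates[OF Fcont FI this]
    have "integral {0..1} (\<lambda>x. \<Sum>\<^sub>\<infinity>m::int. F (x - of_int m)) = of_real (sqrt y * exp (- (pi * y * of_int n ^ 2)))" .
    moreover have "(\<Sum>\<^sub>\<infinity>m::int. F (x - of_int m)) = h x * exp (2 * pi * \<i> * of_int n * x)" for x
      unfolding Fshift h by (rule infsum_cmult_left')
    moreover have "(\<lambda>x. h x * exp (2 * pi * \<i> * of_int n * x)) integrable_on {0..1}"
      by (intro integrable_continuous_interval continuous_intros continuous_on_subset[OF hcont]) auto
    ultimately show ?thesis by (metis (no_types, lifting) integrable_integral ext)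
  qed
  have Qcoeff: "((\<lambda>x. Q x * exp (2 * pi * \<i> * of_int n * x)) has_integral of_real (exp (- (pi * y * of_int n ^ 2)))) {0..1}" for n :: int
  proof -
    define c where "c = (\<lambda>m::int. of_real (exp (- (pi * y * of_int m ^ 2))) :: complex)"
    define f where "f = (\<lambda>(m::int) (x::real). c m * exp (2 * pi * \<i> * of_int (m + n) * x))"
    have csum: "(\<lambda>m. norm (c m)) summable_on UNIV"
      using summable_on_gaussian_int[of "pi * y" 0] y by (simp add: c_def)
    have s1: "((\<lambda>m. integral {0..1} (f m)) has_sum integral {0..1} (\<lambda>x. \<Sum>\<^sub>\<infinity>m. f m x)) UNIV"
    proof (rule has_sum_integral_infsum[OF _ _ csum])
      show "continuous_on {0..1} (f m)" for m unfolding f_def by (intro continuous_intros)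
      show "norm (f m x) \<le> norm (c m)" for m x
      proof -
        have "norm (exp (2 * pi * \<i> * of_int (m + n) * x)) = 1"
          using norm_exp_i_times[of "2 * pi * of_int (m + n) * x"] by (simp add: mult_ac)
        thus ?thesis by (simp only: f_def norm_mult mult_1_right order.refl)
      qed
    qed
    have s2: "integral {0..1} (f m) = (if m = - n then c m else 0)" for m
    proof -
      have "(f m has_integral c m * (if m + n = 0 then 1 else 0)) {0..1}"
        unfolding f_def by (rule has_integral_mult_right[OF integral_exp_2pi_int])
      thus ?thesis by (auto simp: integral_unique)
    qed
    have s3: "((\<lambda>m. if m = - n then c m else 0) has_sum c (- n)) UNIV"
    proof -
      have "((\<lambda>m. if m = - n then c m else 0) has_sum (\<Sum>m\<in>{-n}. if m = - n then c m else 0)) {-n}"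
        by (rule has_sum_finite) simp
      also have "?this \<longleftrightarrow> ((\<lambda>m. if m = - n then c m else 0) has_sum (\<Sum>m\<in>{-n}. if m = - n then c m else 0)) UNIV"
        by (rule has_sum_cong_neutral) auto
      finally show ?thesis by simp
    qed
    have s4: "integral {0..1} (\<lambda>x. \<Sum>\<^sub>\<infinity>m. f m x) = c (- n)"
      by (rule has_sum_unique[OF s1[unfolded s2] s3])
    have s5: "(\<Sum>\<^sub>\<infinity>m. f m x) = Q x * exp (2 * pi * \<i> * of_int n * x)" for x
    proof -
      have "f m x = exp (pi * \<i> * (t * of_int m ^ 2 + 2 * of_int m * of_real x)) * exp (2 * pi * \<i> * of_int n * x)" for m
      proof -
        have "c m = exp (pi * \<i> * (t * of_int m ^ 2))"
          unfolding c_def t_def exp_of_real[symmetric] by (rule arg_cong[where f = exp]) (simp add: algebra_simps)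
        thus ?thesis unfolding f_def by (simp only: mult_exp_exp, intro arg_cong[where f = exp]) (simp add: algebra_simps)
      qed
      thus ?thesis unfolding Q_def jtheta_def by (simp only: infsum_cmult_left')
    qed
    have "(\<lambda>x. Q x * exp (2 * pi * \<i> * of_int n * x)) integrable_on {0..1}"
      by (intro integrable_continuous_interval continuous_intros continuous_on_subset[OF Qcont]) auto
    from integrable_integral[OF this] have "((\<lambda>x. Q x * exp (2 * pi * \<i> * of_int n * x)) has_integral c (- n)) {0..1}"
      unfolding s5[symmetric] s4 .
    thus ?thesis by (simp add: c_def)
  qed
  have "h x - of_real (sqrt y) * Q x = 0"
  proof (rule continuous_periodic_fourier_unique)
    show "continuous_on UNIV (\<lambda>x. h x - of_real (sqrt y) * Q x)"
      by (intro continuous_intros hcont Qcont)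
    show "h (x + 1) - of_real (sqrt y) * Q (x + 1) = h x - of_real (sqrt y) * Q x" for x
      by (simp add: hper Qper)
    fix n :: int
    have "((\<lambda>x. (h x - of_real (sqrt y) * Q x) * exp (2 * pi * \<i> * of_int n * x)) has_integral 0) {0..1}"
      using has_integral_diff[OF hcoeff[of n] has_integral_mult_right[OF Qcoeff[of n], of "of_real (sqrt y)"]]
      by (simp add: algebra_simps)
    thus "integral {0..1} (\<lambda>x. (h x - of_real (sqrt y) * Q x) * exp (2 * pi * \<i> * of_int n * x)) = 0"
      by (rule integral_unique)
  qed
  thus ?thesis by (simp add: h_def Q_def)
qed

text \<open>The identity theorem is used twice: for imaginary \<open>t\<close> from real
  \<open>z\<close> to all \<open>z\<close>, then for fixed \<open>z\<close> from the imaginary axis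
  to the half-plane. The number \<open>- \<i> * t\<close> has positive real part, so
  \<open>csqrt\<close> is holomorphic there, and on the imaginary axis it is the positive
  root.\<close>

theorem jtheta_inversion:
  assumes t: "Im t > 0"
  shows "exp (- (pi * \<i> * z ^ 2 / t)) * jtheta (z / t) (- 1 / t) = csqrt (- \<i> * t) * jtheta z t"
proof -
  have imag: "exp (- (pi * \<i> * z ^ 2 / t)) * jtheta (z / t) (- 1 / t) - csqrt (- \<i> * t) * jtheta z t = 0"
    if y: "y > 0" and t: "t = \<i> * of_real y" for y z t
  proof (rule analytic_continuation[of "\<lambda>z. exp (- (pi * \<i> * z ^ 2 / t)) * jtheta (z / t) (- 1 / t) - csqrt (- \<i> * t) * jtheta z t" UNIV \<real> 0])
    have t': "t \<noteq> 0" "Im t > 0" "Im (- 1 / t) > 0"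
      using y t by (auto simp: Im_divide power2_eq_square)
    show "(\<lambda>z. exp (- (pi * \<i> * z ^ 2 / t)) * jtheta (z / t) (- 1 / t) - csqrt (- \<i> * t) * jtheta z t) holomorphic_on UNIV"
      using t' by (intro holomorphic_intros) auto
    show "(0::complex) islimpt \<real>"
      unfolding islimpt_approachable
    proof safe
      fix e :: real assume "e > 0"
      thus "\<exists>x'\<in>\<real>. x' \<noteq> (0::complex) \<and> dist x' 0 < e"
        by (intro bexI[of _ "of_real (e / 2)"]) auto
    qed
    fix x :: complex assume "x \<in> \<real>"
    then obtain r where r: "x = of_real r" by (auto elim: Reals_cases)
    have "- \<i> * t = of_real y" using t by simp
    hence c: "csqrt (- \<i> * t) = of_real (sqrt y)" using y csqrt_of_real_nonneg[of "of_real y"] by simp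
    show "exp (- (pi * \<i> * x ^ 2 / t)) * jtheta (x / t) (- 1 / t) - csqrt (- \<i> * t) * jtheta x t = 0"
      unfolding c r using jtheta_inversion_real[OF y, of r, folded t] by (simp only: right_minus_eq)
  qed auto
  define S where "S = {t. Im t > 0}"
  have "exp (- (pi * \<i> * z ^ 2 / t)) * jtheta (z / t) (- 1 / t) - csqrt (- \<i> * t) * jtheta z t = 0"
  proof (rule analytic_continuation[of "\<lambda>t. exp (- (pi * \<i> * z ^ 2 / t)) * jtheta (z / t) (- 1 / t) - csqrt (- \<i> * t) * jtheta z t" S "(\<lambda>y. \<i> * of_real y) ` {0<..}" \<i>])
    show "(\<lambda>t. exp (- (pi * \<i> * z ^ 2 / t)) * jtheta (z / t) (- 1 / t) - csqrt (- \<i> * t) * jtheta z t) holomorphic_on S"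
    proof -
      have "(\<lambda>t. jtheta (t * 0 + z) t) holomorphic_on S"
        unfolding S_def by (rule jtheta_holomorphic_t)
      moreover have "(\<lambda>t. - 1 / t) holomorphic_on S" "(\<lambda>t. - 1 / t) ` S \<subseteq> S"
        by (auto simp: S_def Im_divide intro!: holomorphic_intros divide_pos_pos sum_power2_gt_zero_iff[THEN iffD2])
      hence "(\<lambda>t. jtheta ((- 1 / t) * (- z) + 0) (- 1 / t)) holomorphic_on S"
        using holomorphic_on_compose_gen[OF _ jtheta_holomorphic_t[of "- z" 0], of "\<lambda>t. - 1 / t" S]
        by (simp add: o_def S_def)
      moreover have "- \<i> * t \<notin> \<real>\<^sub>\<le>\<^sub>0" "t \<noteq> 0" if "t \<in> S" for t
        using that by (auto simp: S_def complex_nonpos_Reals_iff)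
      ultimately show ?thesis by (intro holomorphic_intros) auto
    qed
    show "\<i> islimpt (\<lambda>y. \<i> * of_real y) ` {0<..}"
      unfolding islimpt_approachable
    proof safe
      fix e :: real assume e: "e > 0"
      have "\<i> * of_real (1 + e / 2) \<noteq> \<i>" "dist (\<i> * of_real (1 + e / 2)) \<i> < e"
        using e by (auto simp: dist_norm algebra_simps norm_mult norm_divide)
      thus "\<exists>x'\<in>(\<lambda>y. \<i> * of_real y) ` {0<..}. x' \<noteq> \<i> \<and> dist x' \<i> < e"
        using e by (intro bexI[of _ "\<i> * of_real (1 + e / 2)"] conjI imageI) auto
    qed
    show "open S" unfolding S_def by (rule open_halfspace_Im_gt)
    show "connected S" unfolding S_def by (intro convex_connected convex_halfspace_Im_gt)
  qed (use t imag in \<open>auto simp: S_def\<close>)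
  thus ?thesis by simp
qed

section \<open>Generators of the symplectic group\<close>

lemma sum_UNIV_sum: "(\<Sum>k\<in>(UNIV::('a::finite + 'b::finite) set). f k) = (\<Sum>i\<in>UNIV. f (Inl i)) + (\<Sum>i\<in>UNIV. f (Inr i))"
  unfolding UNIV_sum by (subst sum.union_disjoint) (auto simp: sum.reindex)

section \<open>Block matrices and the symplectic relations\<close>

definition mat4 :: "'a^'n^'n \<Rightarrow> 'a^'n^'n \<Rightarrow> 'a^'n^'n \<Rightarrow> 'a^'n^'n \<Rightarrow> 'a^('n + 'n)^('n + 'n)" where
  "mat4 A B C D = (\<chi> k l. case k of
      Inl i \<Rightarrow> (case l of Inl j \<Rightarrow> A $ i $ j | Inr j \<Rightarrow> B $ i $ j)
    | Inr i \<Rightarrow> (case l of Inl j \<Rightarrow> C $ i $ j | Inr j \<Rightarrow> D $ i $ j))"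

lemma mat4_nth [simp]:
  "mat4 A B C D $ Inl i $ Inl j = A $ i $ j" "mat4 A B C D $ Inl i $ Inr j = B $ i $ j"
  "mat4 A B C D $ Inr i $ Inl j = C $ i $ j" "mat4 A B C D $ Inr i $ Inr j = D $ i $ j"
  by (simp_all add: mat4_def)

lemma block_mat4 [simp]:
  "blockA (mat4 A B C D) = A" "blockB (mat4 A B C D) = B"
  "blockC (mat4 A B C D) = C" "blockD (mat4 A B C D) = D"
  by (simp_all add: blockA_def blockB_def blockC_def blockD_def vec_eq_iff)

lemma all_sum: "(\<forall>k::'a + 'b. P k) \<longleftrightarrow> (\<forall>i. P (Inl i)) \<and> (\<forall>i. P (Inr i))"
  by (metis sum.exhaust)

lemma mat4_blocks: "mat4 (blockA M) (blockB M) (blockC M) (blockD M) = M"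
  unfolding vec_eq_iff all_sum by (simp add: blockA_def blockB_def blockC_def blockD_def)

lemma mat4_mult:
  "mat4 A B C D ** mat4 A' B' C' D' =
     mat4 (A ** A' + B ** C') (A ** B' + B ** D') (C ** A' + D ** C') (C ** B' + D ** D')"
  unfolding vec_eq_iff all_sum by (simp add: matrix_matrix_mult_def sum_UNIV_sum)

lemma mat4_transpose: "transpose (mat4 A B C D) = mat4 (transpose A) (transpose C) (transpose B) (transpose D)"
  unfolding vec_eq_iff all_sum by (simp add: transpose_def)

lemma mat4_1: "mat 1 = mat4 (mat 1) 0 0 (mat 1)"
  unfolding vec_eq_iff all_sum by (simp add: mat_def)

lemma symplectic_form_mat4: "symplectic_form = mat4 0 (mat 1) (- mat 1) 0"
  unfolding vec_eq_iff all_sum by (simp add: symplectic_form_def mat_def)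

lemma transpose_zero [simp]: "transpose 0 = 0"
  by (simp add: transpose_def vec_eq_iff)

lemma matrix_minus_left: "- A ** B = - (A ** B)" for A :: "'a::ring_1^'n^'m"
  by (simp add: matrix_matrix_mult_def vec_eq_iff sum_negf)

lemma matrix_minus_right: "A ** - B = - (A ** B)" for A :: "'a::ring_1^'n^'m"
  by (simp add: matrix_matrix_mult_def vec_eq_iff sum_negf)

lemma matrix_diff_left: "(A - B) ** C = A ** C - B ** C" for A :: "'a::ring_1^'n^'m"
  by (simp add: matrix_matrix_mult_def vec_eq_iff left_diff_distrib sum_subtractf)

lemma matrix_diff_right: "A ** (B - C) = A ** B - A ** C" for A :: "'a::ring_1^'n^'m"
  by (simp add: matrix_matrix_mult_def vec_eq_iff right_diff_distrib sum_subtractf)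

text \<open>Over the reals a one-sided inverse of a square matrix is two-sided, and the integers
  embed.\<close>

lemma int_matrix_left_right_inverse:
  fixes A B :: "int^'n^'n"
  assumes "A ** B = mat 1" shows "B ** A = mat 1"
proof -
  let ?r = "\<lambda>M::int^'n^'n. (\<chi> i j. real_of_int (M $ i $ j))"
  have mult: "?r (M ** N) = ?r M ** ?r N" for M N
    by (simp add: matrix_matrix_mult_def vec_eq_iff)
  have one: "?r (mat 1) = mat 1" by (simp add: mat_def vec_eq_iff)
  have "?r A ** ?r B = mat 1" using assms mult[of A B] one by simp
  hence "?r B ** ?r A = mat 1" by (simp add: matrix_left_right_inverse)
  hence "?r (B ** A) = ?r (mat 1)" using mult[of B A] one by simp
  thus ?thesis by (simp add: vec_eq_iff)
qed

lemma symplectic_form_square: "symplectic_form ** - symplectic_form = mat 1" "- symplectic_form ** symplectic_form = mat 1"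
  unfolding symplectic_form_mat4 matrix_minus_left matrix_minus_right mat4_mult
  unfolding vec_eq_iff all_sum by (simp_all add: matrix_minus_left matrix_minus_right) (simp_all add: mat_def)

text \<open>The defining relation exhibits \<open>- J ** transpose M ** J\<close>, with
  \<open>J\<close> the symplectic form, as a left inverse of \<open>M\<close>. That it is also a
  right inverse is the relation between the rows of \<open>M\<close>, on which the row reduction
  rests.\<close>

lemma Sp_transpose:
  assumes "M \<in> Sp" shows "M ** symplectic_form ** transpose M = symplectic_form"
proof -
  let ?J = "symplectic_form"
  have "transpose M ** ?J ** M = ?J" using assms by (simp add: Sp_def)
  hence "(- ?J) ** (transpose M ** ?J ** M) = mat 1" by (simp add: symplectic_form_square)
  hence "(- ?J ** transpose M ** ?J) ** M = mat 1" by (simp add: matrix_mul_assoc)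
  hence "M ** (- ?J ** transpose M ** ?J) = mat 1" by (rule int_matrix_left_right_inverse)
  hence "M ** (- ?J ** transpose M ** ?J) ** - ?J = - ?J" by simp
  hence "M ** - ?J ** transpose M ** (?J ** - ?J) = - ?J" by (simp only: matrix_mul_assoc)
  thus ?thesis unfolding symplectic_form_square by (simp add: matrix_minus_left matrix_minus_right)
qed

lemma Sp_mult:
  assumes "M \<in> Sp" "N \<in> Sp" shows "M ** N \<in> Sp"
proof -
  have "transpose (M ** N) ** symplectic_form ** (M ** N) = transpose N ** (transpose M ** symplectic_form ** M) ** N"
    by (simp only: matrix_transpose_mul matrix_mul_assoc)
  thus ?thesis using assms by (simp add: Sp_def)
qed

text \<open>Two entries of the row relation, written out. The first forces further entries to vanish
  once some rows are reduced; the second makes a lower row primitive, so that Euclid's algorithm on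
  it ends with 1 or -1.\<close>

lemma Sp_row_Inr:
  assumes "M \<in> Sp"
  shows "(\<Sum>i\<in>UNIV. M $ Inr k $ Inl i * M $ Inr l $ Inr i) - (\<Sum>i\<in>UNIV. M $ Inr k $ Inr i * M $ Inr l $ Inl i) = 0"
    and "(\<Sum>i\<in>UNIV. M $ Inr k $ Inl i * M $ Inl k $ Inr i) - (\<Sum>i\<in>UNIV. M $ Inr k $ Inr i * M $ Inl k $ Inl i) = - 1"
proof -
  have *: "(M ** symplectic_form ** transpose M) $ p $ q =
      (\<Sum>i\<in>UNIV. M $ p $ Inl i * M $ q $ Inr i) - (\<Sum>i\<in>UNIV. M $ p $ Inr i * M $ q $ Inl i)" for p q
    by (simp add: matrix_matrix_mult_def transpose_def sum_UNIV_sum symplectic_form_def of_bool_def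
        if_distrib[of "\<lambda>x. a * x" for a] sum_negf cong: if_cong)
  show "(\<Sum>i\<in>UNIV. M $ Inr k $ Inl i * M $ Inr l $ Inr i) - (\<Sum>i\<in>UNIV. M $ Inr k $ Inr i * M $ Inr l $ Inl i) = 0"
    using *[of "Inr k" "Inr l"] unfolding Sp_transpose[OF assms] by (simp add: symplectic_form_def)
  show "(\<Sum>i\<in>UNIV. M $ Inr k $ Inl i * M $ Inl k $ Inr i) - (\<Sum>i\<in>UNIV. M $ Inr k $ Inr i * M $ Inl k $ Inl i) = - 1"
    using *[of "Inr k" "Inl k"] unfolding Sp_transpose[OF assms] by (simp add: symplectic_form_def)
qed

section \<open>The generators and their inverses\<close>

definition partial_inversion :: "'n \<Rightarrow> int^('n::finite + 'n)^('n + 'n)" where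
  "partial_inversion k =
     (let E = (\<chi> i j. of_bool (i = k \<and> j = k)) in mat4 (mat 1 - E) (- E) E (mat 1 - E))"

text \<open>The matrix \<open>partial_inversion k\<close> is the genus 1 matrix of \<tau> to
  -1/\<tau>, placed in coordinate \<open>k\<close>. In \<open>unimodular\<close> the inverse
  \<open>A'\<close> is carried as a witness. Closure under inverses is derived in
  \<open>spgen_inverse\<close>.\<close>

inductive_set spgen :: "(int^('n::finite + 'n)^('n + 'n)) set" where
  translation: "transpose S = S \<Longrightarrow> mat4 (mat 1) S 0 (mat 1) \<in> spgen"
| unimodular: "A ** A' = mat 1 \<Longrightarrow> mat4 A 0 0 (transpose A') \<in> spgen"
| inversion: "partial_inversion k \<in> spgen"
| mult: "M \<in> spgen \<Longrightarrow> N \<in> spgen \<Longrightarrow> M ** N \<in> spgen"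

lemma matrix_mult_partial_inversion:
  "(M ** partial_inversion k) $ p $ Inl j = (if j = k then M $ p $ Inr k else M $ p $ Inl j)"
  "(M ** partial_inversion k) $ p $ Inr j = (if j = k then - M $ p $ Inl k else M $ p $ Inr j)"
  by (auto simp: partial_inversion_def Let_def matrix_matrix_mult_def sum_UNIV_sum mat_def of_bool_def
      if_distrib[of "\<lambda>x. a * x" for a] right_diff_distrib sum_subtractf sum_negf cong: if_cong conj_cong)

lemma partial_inversion_square_square:
  "(partial_inversion k ** partial_inversion k) ** (partial_inversion k ** partial_inversion k) = mat 1"
proof -
  let ?J = "partial_inversion k"
  have "mat 1 ** ?J ** ?J ** ?J ** ?J = mat 1"
    unfolding vec_eq_iff all_sum by (auto simp: matrix_mult_partial_inversion mat_def simp del: matrix_mul_lid)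
  thus ?thesis by (simp add: matrix_mul_assoc)
qed

lemma spgen_inverse: "M \<in> spgen \<Longrightarrow> \<exists>N\<in>spgen. M ** N = mat 1 \<and> N ** M = mat 1"
proof (induction rule: spgen.induct)
  case (translation S)
  have "transpose (- S) = - S" using translation by (simp add: transpose_def vec_eq_iff)
  hence "mat4 (mat 1) (- S) 0 (mat 1) \<in> spgen" by (rule spgen.translation)
  moreover have "mat4 (mat 1) S 0 (mat 1) ** mat4 (mat 1) (- S) 0 (mat 1) = mat 1"
    unfolding mat4_mult mat4_1 by simp
  ultimately show ?case using int_matrix_left_right_inverse by blast
next
  case (unimodular A A')
  hence AA: "A' ** A = mat 1" by (rule int_matrix_left_right_inverse)
  hence "mat4 A' 0 0 (transpose A) \<in> spgen" by (rule spgen.unimodular)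
  moreover have "mat4 A 0 0 (transpose A') ** mat4 A' 0 0 (transpose A) = mat 1"
    unfolding mat4_mult mat4_1 using unimodular AA by (simp flip: matrix_transpose_mul)
  ultimately show ?case using int_matrix_left_right_inverse by blast
next
  case (inversion k)
  let ?J = "partial_inversion k :: int^('a + 'a)^('a + 'a)"
  have "?J ** (?J ** ?J ** ?J) = mat 1"
    using partial_inversion_square_square[of k] by (simp add: matrix_mul_assoc)
  moreover have "?J ** ?J ** ?J \<in> spgen" by (intro spgen.mult spgen.inversion)
  ultimately show ?case using int_matrix_left_right_inverse by blast
next
  case (mult M N)
  then obtain M' N' where *: "M' \<in> spgen" "M ** M' = mat 1" "N' \<in> spgen" "N ** N' = mat 1" by blast
  have "M ** N ** (N' ** M') = M ** (N ** N') ** M'" by (simp only: matrix_mul_assoc)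
  hence "M ** N ** (N' ** M') = mat 1" using * by simp
  moreover have "N' ** M' \<in> spgen" using * by (intro spgen.mult)
  ultimately show ?case using int_matrix_left_right_inverse by blast
qed

lemma spgen_subset_Sp: "M \<in> spgen \<Longrightarrow> M \<in> Sp"
proof (induction rule: spgen.induct)
  case (translation S)
  thus ?case
    unfolding Sp_def symplectic_form_mat4 mat4_transpose mem_Collect_eq mat4_mult
    by (simp add: matrix_minus_left matrix_minus_right)
next
  case (unimodular A A')
  hence "A' ** A = mat 1" by (rule int_matrix_left_right_inverse)
  thus ?case using unimodular
    unfolding Sp_def symplectic_form_mat4 mat4_transpose mem_Collect_eq mat4_mult
    by (simp add: matrix_minus_left matrix_minus_right flip: matrix_transpose_mul)
next
  case (inversion k)
  define E :: "int^'a^'a" where "E = (\<chi> i j. of_bool (i = k \<and> j = k))"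
  have E: "transpose E = E" "E ** E = E"
    by (auto simp: E_def transpose_def vec_eq_iff matrix_matrix_mult_def of_bool_def 
        if_distrib[of "\<lambda>x. a * x" for a] cong: if_cong conj_cong)
  have T: "transpose (mat 1 - E) = mat 1 - E" "transpose (- E) = - E"
    using E by (auto simp: transpose_def vec_eq_iff mat_def)
  show ?case
    unfolding Sp_def symplectic_form_mat4 mem_Collect_eq partial_inversion_def E_def[symmetric] Let_def mat4_transpose T E mat4_mult
    by (simp add: matrix_minus_left matrix_minus_right matrix_diff_left matrix_diff_right E)
next
  case (mult M N)
  thus ?case by (intro Sp_mult)
qed

section \<open>Elementary operations and reduction of the lower rows\<close>

definition shear :: "'n \<Rightarrow> ('n \<Rightarrow> int) \<Rightarrow> int^'n^('n::finite)" where
  "shear s t = (\<chi> i j. of_bool (i = j) + of_bool (i = s) * t j)"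

text \<open>The shear is the identity plus the rank 1 matrix with row \<open>s\<close> equal to
  \<open>t\<close>; for \<open>t s = 0\<close> this matrix has square 0.\<close>

lemma shear_inverse: "t s = 0 \<Longrightarrow> shear s t ** shear s (\<lambda>j. - t j) = mat 1"
  by (auto simp: shear_def matrix_matrix_mult_def vec_eq_iff mat_def of_bool_def algebra_simps sum.distrib sum_subtractf
      if_distrib[of "\<lambda>x. a * x" for a] if_distrib[of "\<lambda>x. x * a" for a] cong: if_cong)

lemma mult_shear_right_Inl:
  fixes M :: "int^('n::finite + 'n)^('n + 'n)"
  shows "(M ** mat4 (shear s t) 0 0 D) $ p $ Inl j = M $ p $ Inl j + t j * M $ p $ Inl s"
  by (auto simp: shear_def matrix_matrix_mult_def sum_UNIV_sum transpose_def of_bool_def algebra_simps sum.distrib sum_subtractf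
      if_distrib[of "\<lambda>x. a * x" for a] if_distrib[of "\<lambda>x. x * a" for a] sum_distrib_left sum_negf cong: if_cong)

lemma mult_shear_right_Inr:
  fixes M :: "int^('n::finite + 'n)^('n + 'n)"
  shows "(M ** mat4 A 0 0 (transpose (shear s (\<lambda>j. - t j)))) $ p $ Inr i =
      M $ p $ Inr i - of_bool (i = s) * (\<Sum>j\<in>UNIV. t j * M $ p $ Inr j)"
  by (cases "i = s"; auto simp: shear_def matrix_matrix_mult_def sum_UNIV_sum transpose_def of_bool_def algebra_simps sum.distrib sum_subtractf
      if_distrib[of "\<lambda>x. a * x" for a] if_distrib[of "\<lambda>x. x * a" for a] sum_distrib_left sum_negf cong: if_cong)

lemmas mult_shear_right = mult_shear_right_Inl mult_shear_right_Inr

lemma mult_shear_left: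
  fixes M :: "int^('n::finite + 'n)^('n + 'n)"
  shows "(mat4 (transpose (shear s t)) 0 0 (shear s (\<lambda>j. - t j)) ** M) $ Inr i $ q =
     M $ Inr i $ q - of_bool (i = s) * (\<Sum>j\<in>UNIV. t j * M $ Inr j $ q)"
  by (cases "i = s"; auto simp: shear_def matrix_matrix_mult_def sum_UNIV_sum transpose_def of_bool_def algebra_simps sum.distrib sum_subtractf
      if_distrib[of "\<lambda>x. a * x" for a] if_distrib[of "\<lambda>x. x * a" for a] sum_distrib_left sum_negf cong: if_cong)

lemma mult_translation_right:
  fixes M :: "int^('n::finite + 'n)^('n + 'n)"
  shows "(M ** mat4 (mat 1) S 0 (mat 1)) $ p $ Inl j = M $ p $ Inl j"
    and "(M ** mat4 (mat 1) S 0 (mat 1)) $ p $ Inr j = (\<Sum>i\<in>UNIV. M $ p $ Inl i * S $ i $ j) + M $ p $ Inr j"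
  by (auto simp: matrix_matrix_mult_def sum_UNIV_sum mat_def
      if_distrib[of "\<lambda>x. a * x" for a] if_distrib[of "\<lambda>x. x * a" for a] cong: if_cong)

text \<open>The goal of the reduction: when all lower rows are unit vectors, the lower blocks are 0
  and 1, and a symplectic matrix of this shape is a translation.\<close>

definition rows_reduced :: "'n set \<Rightarrow> int^('n::finite + 'n)^('n + 'n) \<Rightarrow> bool" where
  "rows_reduced K M \<longleftrightarrow> (\<forall>i\<in>K. M $ Inr i = axis (Inr i) 1)"

lemma rows_reducedD:
  "rows_reduced K M \<Longrightarrow> i \<in> K \<Longrightarrow> M $ Inr i $ Inl j = 0"
  "rows_reduced K M \<Longrightarrow> i \<in> K \<Longrightarrow> M $ Inr i $ Inr j = of_bool (i = j)"
  by (auto simp: rows_reduced_def axis_def)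

lemma rows_reducedI:
  "(\<And>i j. i \<in> K \<Longrightarrow> M $ Inr i $ Inl j = 0) \<Longrightarrow> (\<And>i j. i \<in> K \<Longrightarrow> M $ Inr i $ Inr j = of_bool (i = j)) \<Longrightarrow> rows_reduced K M"
  unfolding rows_reduced_def vec_eq_iff all_sum by (auto simp: axis_def)

text \<open>The symplectic product of row \<open>Inr k\<close> with a reduced row
  \<open>Inr l\<close> is exactly this entry.\<close>

lemma rows_reduced_column_zero:
  assumes "M \<in> Sp" "rows_reduced K M" "l \<in> K"
  shows "M $ Inr k $ Inl l = 0"
proof -
  have "(\<Sum>i\<in>UNIV. M $ Inr k $ Inl i * of_bool (l = i)) = 0"
    using Sp_row_Inr(1)[OF assms(1), of k l] by (simp add: rows_reducedD[OF assms(2,3)])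
  thus ?thesis by (simp add: of_bool_def if_distrib[of "\<lambda>x. a * x" for a] cong: if_cong)
qed

text \<open>Euclid's algorithm as a minimal choice: among all reachable matrices take the least nonzero absolute
  value in the left half of the \<open>k\<close>-th lower row. By minimality it divides the whole row, since a
  one-coordinate inversion moves entries between the two halves, and it is 1 because the matrix is symplectic.\<close>

lemma rows_reduced_step:
  fixes \<gamma> :: "int^('n::finite + 'n)^('n + 'n)"
  assumes \<gamma>: "\<gamma> \<in> Sp" and red: "rows_reduced K \<gamma>" and k: "k \<notin> K"
  shows "\<exists>a\<in>spgen. \<exists>b\<in>spgen. rows_reduced (insert k K) (a ** \<gamma> ** b)"
proof -
  define P where "P M \<longleftrightarrow> rows_reduced K M \<and> (\<exists>a\<in>spgen. \<exists>b\<in>spgen. M = a ** \<gamma> ** b)" for M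
  have PSp: "M \<in> Sp" if "P M" for M
    using that \<gamma> Sp_mult spgen_subset_Sp unfolding P_def by blast
  have Pred: "rows_reduced K M" if "P M" for M using that by (simp add: P_def)
  have one: "mat 1 \<in> (spgen :: (int^('n + 'n)^('n + 'n)) set)"
    unfolding mat4_1 by (rule spgen.translation) simp
  have P0: "P \<gamma>" unfolding P_def using red one by (metis matrix_mul_lid matrix_mul_rid)
  have Pright: "P (M ** g)" if "P M" "g \<in> spgen" "rows_reduced K (M ** g)" for M g
    using that unfolding P_def by (metis matrix_mul_assoc spgen.mult)
  have Pleft: "P (g ** M)" if "P M" "g \<in> spgen" "rows_reduced K (g ** M)" for M g
    using that unfolding P_def by (metis matrix_mul_assoc spgen.mult)
  have opJ: "P (M ** partial_inversion l)" if "P M" "l \<notin> K" for M l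
  proof (rule Pright[OF that(1) spgen.inversion])
    show "rows_reduced K (M ** partial_inversion l)"
      using that(2) rows_reducedD[OF Pred[OF that(1)]]
      by (intro rows_reducedI) (auto simp: matrix_mult_partial_inversion)
  qed
  have opU: "\<exists>M'. P M' \<and> (\<forall>j. M' $ Inr k $ Inl j = M $ Inr k $ Inl j + t j * M $ Inr k $ Inl s)"
    if "P M" "s \<notin> K" "t s = 0" "\<And>j. j \<in> K \<Longrightarrow> t j = 0" for M s t
  proof -
    let ?g = "mat4 (shear s t) 0 0 (transpose (shear s (\<lambda>j. - t j)))"
    have "rows_reduced K (M ** ?g)"
    proof (rule rows_reducedI)
      fix i j assume i: "i \<in> K"
      show "(M ** ?g) $ Inr i $ Inl j = 0"
        using rows_reducedD[OF Pred[OF that(1)] i] by (simp add: mult_shear_right)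
      have "(\<Sum>j\<in>UNIV. t j * M $ Inr i $ Inr j) = 0"
        using rows_reducedD[OF Pred[OF that(1)] i] that(4)[OF i]
        by (simp add: of_bool_def if_distrib[of "\<lambda>x. a * x" for a] cong: if_cong)
      thus "(M ** ?g) $ Inr i $ Inr j = of_bool (i = j)"
        using rows_reducedD[OF Pred[OF that(1)] i] by (simp add: mult_shear_right)
    qed
    hence "P (M ** ?g)"
      using that by (intro Pright spgen.unimodular shear_inverse) auto
    thus ?thesis by (intro exI[of _ "M ** ?g"]) (simp add: mult_shear_right)
  qed
  have opT: "\<exists>M'. P M' \<and> (\<forall>j. M' $ Inr k $ Inl j = M $ Inr k $ Inl j) \<and>
        (\<forall>j. M' $ Inr k $ Inr j = M $ Inr k $ Inr j + t j * M $ Inr k $ Inl k)"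
    if "P M" "\<And>j. j \<noteq> k \<Longrightarrow> M $ Inr k $ Inl j = 0" for M t
  proof -
    \<comment> \<open>The symmetric matrix with \<open>k\<close>-th row and column \<open>t\<close>.
      The left half of row \<open>k\<close> is concentrated in column \<open>k\<close>, so only the
      \<open>k\<close>-th row of \<open>S\<close> contributes to the new right half.\<close>
    define S :: "int^'n^'n" where "S = (\<chi> i j. if i = k then t j else if j = k then t i else 0)"
    let ?g = "mat4 (mat 1) S 0 (mat 1)"
    have "rows_reduced K (M ** ?g)"
      using rows_reducedD[OF Pred[OF that(1)]]
      by (intro rows_reducedI) (auto simp: mult_translation_right)
    moreover have "transpose S = S" by (simp add: S_def transpose_def vec_eq_iff)
    ultimately have "P (M ** ?g)"
      using that by (intro Pright spgen.translation) auto
    moreover have "(\<Sum>i\<in>UNIV. M $ Inr k $ Inl i * S $ i $ j) = t j * M $ Inr k $ Inl k" for j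
    proof -
      have "(\<Sum>i\<in>UNIV. M $ Inr k $ Inl i * S $ i $ j) = (\<Sum>i\<in>{k}. M $ Inr k $ Inl i * S $ i $ j)"
        by (rule sum.mono_neutral_right) (use that(2) in auto)
      thus ?thesis by (simp add: S_def)
    qed
    ultimately show ?thesis by (intro exI[of _ "M ** ?g"]) (simp add: mult_translation_right)
  qed
  have opL: "\<exists>M'. P M' \<and> (\<forall>j. M' $ Inr k $ Inl j = M $ Inr k $ Inl j) \<and>
        (\<forall>j. M' $ Inr k $ Inr j = (if j \<in> K then 0 else M $ Inr k $ Inr j))"
    if "P M" for M
  proof -
    \<comment> \<open>The reduced rows are unit vectors in the columns \<open>Inr j\<close>.
      Subtracting \<open>t j\<close> times each of them from row \<open>k\<close> clears precisely
      these columns.\<close>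
    define t where "t j = (if j \<in> K then M $ Inr k $ Inr j else 0)" for j
    let ?g = "mat4 (transpose (shear k t)) 0 0 (shear k (\<lambda>j. - t j)) :: int^('n + 'n)^('n + 'n)"
    have tk: "t k = 0" using k by (simp add: t_def)
    have "transpose (shear k t) ** transpose (shear k (\<lambda>j. - t j)) = mat 1"
      using int_matrix_left_right_inverse[OF shear_inverse[of t k, OF tk]] by (simp flip: matrix_transpose_mul)
    from spgen.unimodular[OF this] have "?g \<in> spgen" by simp
    moreover have "rows_reduced K (?g ** M)"
      using rows_reducedD[OF Pred[OF that]] k
      by (intro rows_reducedI) (auto simp: mult_shear_left)
    ultimately have "P (?g ** M)" using that by (intro Pleft) auto
    moreover have "(\<Sum>j\<in>UNIV. t j * M $ Inr j $ Inl i) = 0" for i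
      using rows_reducedD[OF Pred[OF that]] by (intro sum.neutral) (auto simp: t_def)
    moreover have "(\<Sum>j\<in>UNIV. t j * M $ Inr j $ Inr i) = t i" for i
    proof -
      have "(\<Sum>j\<in>UNIV. t j * M $ Inr j $ Inr i) = (\<Sum>j\<in>UNIV. if j = i then t i else 0)"
        by (rule sum.cong) (use rows_reducedD[OF Pred[OF that]] in \<open>auto simp: t_def\<close>)
      thus ?thesis by simp
    qed
    ultimately show ?thesis
      by (intro exI[of _ "?g ** M"], simp add: mult_shear_left) (simp add: t_def)
  qed
  define V where "V = {nat \<bar>M $ Inr k $ Inl l\<bar> | M l. P M \<and> l \<notin> K \<and> M $ Inr k $ Inl l \<noteq> 0}"
  \<comment> \<open>Otherwise all left entries of row \<open>k\<close> vanish for every reachable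
    matrix. Inversions transfer this to the right entries outside \<open>K\<close>, and
    \<open>opL\<close> clears those inside \<open>K\<close>; a zero row contradicts the symplectic
    relation.\<close>
  have "V \<noteq> {}"
  proof
    assume "V = {}"
    hence z: "M $ Inr k $ Inl l = 0" if "P M" "l \<notin> K" for M l using that unfolding V_def by blast
    obtain M where M: "P M" "\<And>j. M $ Inr k $ Inr j = (if j \<in> K then 0 else \<gamma> $ Inr k $ Inr j)"
      using opL[OF P0] by blast
    have 1: "M $ Inr k $ Inl l = 0" for l
      using z[OF M(1)] rows_reduced_column_zero[OF PSp[OF M(1)] Pred[OF M(1)]] by blast
    have "M $ Inr k $ Inr l = 0" for l
      using M(2)[of l] z[OF opJ[OF M(1)], of l l] by (auto simp: matrix_mult_partial_inversion)
    with 1 show False using Sp_row_Inr(2)[OF PSp[OF M(1)], of k] by simp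
  qed
  define d where "d = (LEAST n. n \<in> V)"
  have dV: "d \<in> V" unfolding d_def using \<open>V \<noteq> {}\<close> by (metis LeastI ex_in_conv)
  have min: "int d \<le> \<bar>M $ Inr k $ Inl l\<bar>" if "P M" "l \<notin> K" "M $ Inr k $ Inl l \<noteq> 0" for M l
  proof -
    have "nat \<bar>M $ Inr k $ Inl l\<bar> \<in> V" unfolding V_def using that by blast
    hence "d \<le> nat \<bar>M $ Inr k $ Inl l\<bar>" unfolding d_def by (rule Least_le)
    thus ?thesis by simp
  qed
  obtain M0 l0 where M0: "P M0" "l0 \<notin> K" "M0 $ Inr k $ Inl l0 \<noteq> 0" "int d = \<bar>M0 $ Inr k $ Inl l0\<bar>"
    using dV unfolding V_def by auto
  have dvdU: "M $ Inr k $ Inl s dvd M $ Inr k $ Inl j"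
    if M: "P M" "s \<notin> K" "j \<notin> K" "int d = \<bar>M $ Inr k $ Inl s\<bar>" "M $ Inr k $ Inl s \<noteq> 0" for M s j
  proof (cases "j = s")
    case False
    let ?x = "M $ Inr k $ Inl j" and ?c = "M $ Inr k $ Inl s"
    have "\<exists>M'. P M' \<and> (\<forall>i. M' $ Inr k $ Inl i = M $ Inr k $ Inl i + (if i = j then - (?x div ?c) else 0) * ?c)"
      by (rule opU[OF M(1,2)]) (use False M(3) in auto)
    then obtain M' where M': "P M'" "M' $ Inr k $ Inl j = ?x + - (?x div ?c) * ?c" by fastforce
    have "M' $ Inr k $ Inl j = ?x mod ?c" unfolding M'(2) by (simp add: minus_div_mult_eq_mod)
    hence "?x mod ?c = 0" using min[OF M'(1) M(3)] abs_mod_less[of ?c ?x] M(4,5) by fastforce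
    thus ?thesis by (rule mod_0_imp_dvd)
  qed simp
  obtain M1 where M1: "P M1" "M1 $ Inr k $ Inl k \<noteq> 0" "int d = \<bar>M1 $ Inr k $ Inl k\<bar>"
  proof (cases "l0 = k")
    case False
    let ?x = "M0 $ Inr k $ Inl k" and ?c = "M0 $ Inr k $ Inl l0"
    have "?c dvd ?x" using M0 k by (intro dvdU) auto
    \<comment> \<open>Since \<open>?c\<close> divides \<open>?x\<close>, this multiple changes the
      entry \<open>?x\<close> into \<open>?c\<close>, which carries the minimal value to column
      \<open>k\<close>.\<close>
    have "\<exists>M'. P M' \<and> (\<forall>i. M' $ Inr k $ Inl i = M0 $ Inr k $ Inl i + (if i = k then 1 - ?x div ?c else 0) * ?c)"
      by (rule opU[OF M0(1,2)]) (use False k in auto)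
    then obtain M' where M': "P M'" "M' $ Inr k $ Inl k = ?x + (1 - ?x div ?c) * ?c" by fastforce
    have "M' $ Inr k $ Inl k = ?c" unfolding M'(2) using \<open>?c dvd ?x\<close> by (simp add: algebra_simps)
    thus ?thesis using that[of M'] M' M0 by simp
  qed (use that M0 in blast)
  define c where "c = M1 $ Inr k $ Inl k"
  have c: "c \<noteq> 0" "int d = \<bar>c\<bar>" using M1 by (auto simp: c_def)
  obtain M2 where M2: "P M2" "M2 $ Inr k $ Inl k = c" "\<And>j. j \<noteq> k \<Longrightarrow> M2 $ Inr k $ Inl j = 0"
  proof -
    define t where "t j = (if j \<in> K \<or> j = k then 0 else - (M1 $ Inr k $ Inl j div c))" for j
    have "\<exists>M'. P M' \<and> (\<forall>j. M' $ Inr k $ Inl j = M1 $ Inr k $ Inl j + t j * M1 $ Inr k $ Inl k)"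
      by (rule opU[OF M1(1) k]) (auto simp: t_def)
    then obtain M' where M': "P M'" "\<And>j. M' $ Inr k $ Inl j = M1 $ Inr k $ Inl j + t j * c"
      unfolding c_def by blast
    have "M' $ Inr k $ Inl j = 0" if "j \<noteq> k" for j
    proof (cases "j \<in> K")
      case True
      thus ?thesis using rows_reduced_column_zero[OF PSp[OF M'(1)] Pred[OF M'(1)]] by blast
    next
      case False
      have "c dvd M1 $ Inr k $ Inl j" unfolding c_def using M1 k False by (intro dvdU) auto
      thus ?thesis using that False unfolding M'(2) t_def by simp
    qed
    thus ?thesis using that[of M'] M' by (simp add: t_def c_def)
  qed
  have dvdT: "c dvd M2 $ Inr k $ Inr j" if j: "j \<notin> K" for j
  proof -
    let ?x = "M2 $ Inr k $ Inr j"
    obtain M' where M': "P M'" "M' $ Inr k $ Inr j = ?x + - (?x div c) * c"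
      using opT[OF M2(1,3), of "\<lambda>_. - (?x div c)"] M2(2) by auto
    \<comment> \<open>The remainder sits in the right half; the inversion at \<open>j\<close> moves
      it to the left half, where minimality applies.\<close>
    have "(M' ** partial_inversion j) $ Inr k $ Inl j = ?x mod c"
      unfolding matrix_mult_partial_inversion using M'(2) by (simp add: minus_div_mult_eq_mod)
    hence "?x mod c = 0" using min[OF opJ[OF M'(1) j] j] abs_mod_less[of c ?x] c by fastforce
    thus ?thesis by (rule mod_0_imp_dvd)
  qed
  obtain M3 where M3: "P M3" "M3 $ Inr k $ Inl k = c" "\<And>j. j \<noteq> k \<Longrightarrow> M3 $ Inr k $ Inl j = 0"
      "\<And>j. j \<notin> K \<Longrightarrow> M3 $ Inr k $ Inr j = 0"
  proof -
    obtain M' where M': "P M'" "\<And>j. M' $ Inr k $ Inl j = M2 $ Inr k $ Inl j"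
        "\<And>j. M' $ Inr k $ Inr j = M2 $ Inr k $ Inr j + - (M2 $ Inr k $ Inr j div c) * c"
      using opT[OF M2(1,3), of "\<lambda>j. - (M2 $ Inr k $ Inr j div c)"] M2(2) by auto
    show ?thesis using that[of M'] M' M2 dvdT by auto
  qed
  obtain M4 where M4: "P M4" "M4 $ Inr k $ Inl k = c" "\<And>j. j \<noteq> k \<Longrightarrow> M4 $ Inr k $ Inl j = 0"
      "\<And>j. M4 $ Inr k $ Inr j = 0"
    using opL[OF M3(1)] M3 by metis
  have "\<bar>c\<bar> = 1"
  proof -
    have "(\<Sum>i\<in>UNIV. M4 $ Inr k $ Inl i * M4 $ Inl k $ Inr i) = - 1"
      using Sp_row_Inr(2)[OF PSp[OF M4(1)], of k] M4(4) by simp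
    moreover have "(\<Sum>i\<in>UNIV. M4 $ Inr k $ Inl i * M4 $ Inl k $ Inr i) = (\<Sum>i\<in>{k}. M4 $ Inr k $ Inl i * M4 $ Inl k $ Inr i)"
      by (rule sum.mono_neutral_right) (use M4(3) in auto)
    ultimately have "c * M4 $ Inl k $ Inr k = - 1" using M4(2) by simp
    hence "c dvd -1" by (metis dvd_triv_left)
    thus ?thesis by simp
  qed
  \<comment> \<open>An inversion sends the entries (x, y) in columns \<open>Inl k\<close>,
    \<open>Inr k\<close> to (y, -x). From (-1, 0) one inversion gives (0, 1), from (1, 0) three
    do.\<close>
  hence "c = - 1 \<or> c = 1" by linarith
  then obtain M5 where M5: "P M5" "\<And>j. M5 $ Inr k $ Inl j = 0" "\<And>j. M5 $ Inr k $ Inr j = of_bool (k = j)"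
  proof
    assume "c = - 1"
    thus ?thesis using that[OF opJ[OF M4(1) k]] M4 by (auto simp: matrix_mult_partial_inversion)
  next
    assume "c = 1"
    thus ?thesis using that[OF opJ[OF opJ[OF opJ[OF M4(1) k] k] k]] M4 by (auto simp: matrix_mult_partial_inversion)
  qed
  have "rows_reduced (insert k K) M5"
    by (rule rows_reducedI) (use M5 rows_reducedD[OF Pred[OF M5(1)]] in auto)
  thus ?thesis using M5(1) unfolding P_def by blast
qed

text \<open>After all lower rows are reduced, the symplectic relation forces the upper left block to
  be 1 and the upper right block to be symmetric. What remains is a translation, and the multipliers
  on both sides are inverted within \<open>spgen\<close>.\<close>

theorem Sp_eq_spgen: "Sp = (spgen :: (int^('n::finite + 'n)^('n + 'n)) set)"
proof (intro equalityI subsetI)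
  fix \<gamma> :: "int^('n + 'n)^('n + 'n)" assume \<gamma>: "\<gamma> \<in> Sp"
  have one: "mat 1 \<in> (spgen :: (int^('n + 'n)^('n + 'n)) set)"
    unfolding mat4_1 by (rule spgen.translation) simp
  have "\<exists>a\<in>spgen. \<exists>b\<in>spgen. rows_reduced K (a ** \<gamma> ** b)" if "finite K" for K :: "'n set"
    using that
  proof induction
    case empty
    show ?case using one by (auto simp: rows_reduced_def)
  next
    case (insert k K)
    then obtain a b where ab: "a \<in> spgen" "b \<in> spgen" "rows_reduced K (a ** \<gamma> ** b)" by blast
    have "a ** \<gamma> ** b \<in> Sp" using ab \<gamma> Sp_mult spgen_subset_Sp by blast
    from rows_reduced_step[OF this ab(3) insert(2)] obtain a' b' where
      "a' \<in> spgen" "b' \<in> spgen" "rows_reduced (insert k K) (a' ** (a ** \<gamma> ** b) ** b')" by blast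
    moreover have "a' ** (a ** \<gamma> ** b) ** b' = (a' ** a) ** \<gamma> ** (b ** b')" by (simp only: matrix_mul_assoc)
    ultimately show ?case using ab spgen.mult by metis
  qed
  from this[of UNIV] obtain a b where ab: "a \<in> spgen" "b \<in> spgen" "rows_reduced UNIV (a ** \<gamma> ** b)" by auto
  define M where "M = a ** \<gamma> ** b"
  have MSp: "M \<in> Sp" unfolding M_def using ab \<gamma> Sp_mult spgen_subset_Sp by blast
  have r: "blockC M = 0" "blockD M = mat 1"
    using rows_reducedD[OF ab(3)[folded M_def]] by (auto simp: blockC_def blockD_def vec_eq_iff mat_def)
  have M: "M = mat4 (blockA M) (blockB M) 0 (mat 1)" using mat4_blocks[of M] r by simp
  have "symplectic_form = transpose M ** symplectic_form ** M" using MSp by (simp add: Sp_def)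
  also have "\<dots> = mat4 0 (transpose (blockA M)) (- blockA M) (transpose (blockB M) - blockB M)"
    by (subst (1 2) M) (simp add: symplectic_form_mat4 mat4_transpose mat4_mult matrix_minus_left matrix_minus_right)
  finally have e: "mat4 0 (mat 1) (- mat 1) 0 = mat4 0 (transpose (blockA M)) (- blockA M) (transpose (blockB M) - blockB M)"
    by (simp only: symplectic_form_mat4)
  have "- mat 1 = - blockA M" using arg_cong[OF e, of blockC] by simp
  hence A: "blockA M = mat 1" by simp
  have "transpose (blockB M) = blockB M" using arg_cong[OF e, of blockD] by simp
  hence "M \<in> spgen" using M A spgen.translation by metis
  obtain a' b' where "a' \<in> spgen" "a' ** a = mat 1" "b' \<in> spgen" "b ** b' = mat 1"
    using spgen_inverse ab by metis
  moreover have "a' ** M ** b' = (a' ** a) ** \<gamma> ** (b ** b')" unfolding M_def by (simp only: matrix_mul_assoc)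
  ultimately have "\<gamma> = a' ** M ** b'" by simp
  thus "\<gamma> \<in> spgen" using \<open>M \<in> spgen\<close> \<open>a' \<in> spgen\<close> \<open>b' \<in> spgen\<close> by (simp add: spgen.mult)
qed (rule spgen_subset_Sp)

section \<open>Theta series with integral characteristics\<close>

declare add_bit_eq_xor [simp del] mult_bit_eq_and [simp del]

definition qf :: "complex^'n^'n \<Rightarrow> ('n \<Rightarrow> complex) \<Rightarrow> complex" where
  "qf \<tau> x = (\<Sum>i\<in>UNIV. \<Sum>j\<in>UNIV. x i * \<tau> $ i $ j * x j)"

definition lattice_point :: "int^'n \<Rightarrow> int^'n \<Rightarrow> 'n \<Rightarrow> real" where
  "lattice_point e n i = of_int (n $ i) + of_int (e $ i) / 2"

definition theta_term :: "int^'n \<Rightarrow> int^'n \<Rightarrow> complex^'n^'n \<Rightarrow> int^'n \<Rightarrow> complex" where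
  "theta_term e d \<tau> n = exp (pi * \<i> * (qf \<tau> (\<lambda>i. of_real (lattice_point e n i))
     + (\<Sum>i\<in>UNIV. of_real (lattice_point e n i) * of_int (d $ i))))"

text \<open>Characteristics are allowed to be arbitrary integer vectors: the generators of the symplectic
  group move the characteristic by integer matrices, and reduction modulo 2 only costs a sign.\<close>

definition itheta :: "int^'n \<Rightarrow> int^'n \<Rightarrow> complex^'n^'n \<Rightarrow> complex" where
  "itheta e d \<tau> = (\<Sum>\<^sub>\<infinity>n. theta_term e d \<tau> n)"

lemma of_real_of_bool: "of_real (of_bool P) = of_bool P"
  by simp

lemma theta_eq_itheta: "theta v \<tau> = itheta (\<chi> i. of_bit (v $ Inl i)) (\<chi> i. of_bit (v $ Inr i)) \<tau>"
  unfolding theta_def itheta_def theta_term_def qf_def lattice_point_def Let_def by (simp add: of_real_of_bool)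

section \<open>Positivity of the imaginary part and absolute convergence\<close>

lemma Im_qf: "Im (qf \<tau> (\<lambda>i. of_real (x $ i))) = x \<bullet> (map_matrix Im \<tau> *v x)"
proof -
  have "Im (of_real a * z * of_real b) = a * Im z * b" for a b z by simp
  thus ?thesis
    unfolding qf_def by (simp add: inner_vec_def matrix_vector_mult_def map_matrix_def sum_distrib_left mult_ac)
qed

lemma siegel_iff: "\<tau> \<in> siegel \<longleftrightarrow> transpose \<tau> = \<tau> \<and> (\<forall>x::real^'n. x \<noteq> 0 \<longrightarrow> 0 < Im (qf \<tau> (\<lambda>i. of_real (x $ i))))"
  for \<tau> :: "complex^'n^'n"
  unfolding siegel_def Im_qf by simp

text \<open>The constant is the minimum of the positive definite form on the compact unit sphere;
  homogeneity extends the bound to all vectors.\<close>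

lemma siegel_lower_bound:
  fixes \<tau> :: "complex^'n^'n"
  assumes "\<tau> \<in> siegel"
  obtains c where "c > 0" "\<And>x::'n \<Rightarrow> real. c * (\<Sum>i\<in>UNIV. x i ^ 2) \<le> Im (qf \<tau> (\<lambda>i. of_real (x i)))"
proof -
  let ?Y = "map_matrix Im \<tau>"
  let ?q = "\<lambda>x::real^'n. x \<bullet> (?Y *v x)"
  have "axis undefined 1 \<in> sphere (0::real^'n) 1" by simp
  hence "sphere (0::real^'n) 1 \<noteq> {}" by blast
  moreover have "continuous_on (sphere 0 1) ?q"
    by (intro continuous_intros linear_continuous_on linear_linear[THEN iffD2] matrix_vector_mul_linear)
  ultimately obtain u where u: "u \<in> sphere 0 1" "\<And>x. x \<in> sphere 0 1 \<Longrightarrow> ?q u \<le> ?q x"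
    using continuous_attains_inf[of "sphere (0::real^'n) 1" ?q] by auto
  have "u \<noteq> 0" using u(1) by auto
  hence "?q u > 0" using assms by (simp add: siegel_def)
  moreover have "?q u * (\<Sum>i\<in>UNIV. x i ^ 2) \<le> Im (qf \<tau> (\<lambda>i. of_real (x i)))" for x :: "'n \<Rightarrow> real"
  proof -
    define v :: "real^'n" where "v = (\<chi> i. x i)"
    have n: "norm v ^ 2 = (\<Sum>i\<in>UNIV. x i ^ 2)"
      unfolding power2_norm_eq_inner v_def inner_vec_def by (simp add: power2_eq_square)
    have "?q u * norm v ^ 2 \<le> ?q v"
    proof (cases "v = 0")
      case False
      have "?q u \<le> ?q ((1 / norm v) *\<^sub>R v)" using False by (intro u(2)) simp
      also have "\<dots> = ?q v / norm v ^ 2"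
        by (simp add: matrix_vector_mult_scaleR power2_eq_square)
      finally show ?thesis using False by (simp add: field_simps)
    qed simp
    thus ?thesis using Im_qf[of \<tau> v] by (simp add: n) (simp add: v_def)
  qed
  ultimately show ?thesis using that by blast
qed

lemma norm_theta_term: "norm (theta_term e d \<tau> n) = exp (- (pi * Im (qf \<tau> (\<lambda>i. of_real (lattice_point e n i)))))"
proof -
  have "Im (\<Sum>i\<in>UNIV. of_real (lattice_point e n i) * of_int (d $ i)) = 0" by simp
  thus ?thesis unfolding theta_term_def norm_exp_eq_Re by simp
qed

lemma summable_on_gaussian_lattice:
  fixes e :: "int^'n"
  assumes "c > 0"
  shows "(\<lambda>n. exp (- c * (\<Sum>i\<in>UNIV. lattice_point e n i ^ 2))) summable_on UNIV"
proof (rule summable_on_comparison_test)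
  define C where "C = (\<Prod>i\<in>(UNIV::'n set). exp (1 / (4 * c)) * exp (\<bar>of_int (e $ i)\<bar> / 2) :: real)"
  show "(\<lambda>n::int^'n. C * exp (- (\<Sum>i\<in>UNIV. \<bar>real_of_int (n $ i)\<bar>))) summable_on UNIV"
    by (rule summable_on_cmult_right[OF summable_on_exp_neg_abs_vec])
  fix n :: "int^'n"
  have "exp (- c * (\<Sum>i\<in>UNIV. lattice_point e n i ^ 2)) = (\<Prod>i\<in>UNIV. exp (- c * lattice_point e n i ^ 2))"
    by (simp add: exp_sum sum_distrib_left flip: sum_negf)
  also have "\<dots> \<le> (\<Prod>i\<in>UNIV. exp (1 / (4 * c)) * exp (\<bar>of_int (e $ i)\<bar> / 2) * exp (- \<bar>real_of_int (n $ i)\<bar>))"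
  proof (intro prod_mono conjI)
    fix i
    have "exp (- c * lattice_point e n i ^ 2) \<le> exp (1 / (4 * c)) * exp (- \<bar>lattice_point e n i\<bar>)"
      using exp_quadratic_le[OF assms, of "lattice_point e n i" 0] by simp
    also have "exp (- \<bar>lattice_point e n i\<bar>) \<le> exp (\<bar>of_int (e $ i)\<bar> / 2) * exp (- \<bar>real_of_int (n $ i)\<bar>)"
      unfolding mult_exp_exp lattice_point_def by simp
    hence "exp (1 / (4 * c)) * exp (- \<bar>lattice_point e n i\<bar>) \<le> exp (1 / (4 * c)) * (exp (\<bar>of_int (e $ i)\<bar> / 2) * exp (- \<bar>real_of_int (n $ i)\<bar>))"
      by (rule mult_left_mono) simp
    finally show "exp (- c * lattice_point e n i ^ 2) \<le> exp (1 / (4 * c)) * exp (\<bar>of_int (e $ i)\<bar> / 2) * exp (- \<bar>real_of_int (n $ i)\<bar>)"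
      by (simp only: mult.assoc)
  qed simp
  also have "\<dots> = C * exp (- (\<Sum>i\<in>UNIV. \<bar>real_of_int (n $ i)\<bar>))"
    unfolding C_def prod.distrib by (simp add: exp_sum flip: sum_negf)
  finally show "exp (- c * (\<Sum>i\<in>UNIV. lattice_point e n i ^ 2)) \<le> C * exp (- (\<Sum>i\<in>UNIV. \<bar>real_of_int (n $ i)\<bar>))" .
qed simp

lemma abs_summable_theta_term:
  assumes "\<tau> \<in> siegel" shows "(\<lambda>n. norm (theta_term e d \<tau> n)) summable_on UNIV"
proof -
  obtain c where c: "c > 0" "\<And>x. c * (\<Sum>i\<in>UNIV. x i ^ 2) \<le> Im (qf \<tau> (\<lambda>i. of_real (x i)))"
    using siegel_lower_bound[OF assms] by blast
  show ?thesis
  proof (rule summable_on_comparison_test)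
    show "(\<lambda>n. exp (- (pi * c) * (\<Sum>i\<in>UNIV. lattice_point e n i ^ 2))) summable_on UNIV"
      using c by (intro summable_on_gaussian_lattice) simp
    show "norm (theta_term e d \<tau> n) \<le> exp (- (pi * c) * (\<Sum>i\<in>UNIV. lattice_point e n i ^ 2))" for n
      unfolding norm_theta_term using mult_left_mono[OF c(2), of pi "lattice_point e n"] by (simp add: mult_ac)
  qed simp
qed

lemma summable_theta_term: "\<tau> \<in> siegel \<Longrightarrow> theta_term e d \<tau> summable_on UNIV"
  by (rule abs_summable_summable[OF abs_summable_theta_term])

lemma qf_add: "qf (A + B) x = qf A x + qf B x"
  by (simp add: qf_def algebra_simps sum.distrib)

lemma qf_diff: "qf (A - B) x = qf A x - qf B x"
  by (simp add: qf_def algebra_simps sum_subtractf)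

lemma qf_scaleR: "qf (r *\<^sub>R A) x = of_real r * qf A x"
  by (simp add: qf_def sum_distrib_left mult_ac scaleR_conv_of_real[where 'a=complex])

lemma norm_qf_le:
  fixes A :: "complex^'n^'n" and x :: "'n \<Rightarrow> real"
  shows "norm (qf A (\<lambda>i. of_real (x i))) \<le> real CARD('n) * (\<Sum>i\<in>UNIV. x i ^ 2) * norm A"
proof -
  have "norm (qf A (\<lambda>i. of_real (x i))) \<le> (\<Sum>i\<in>UNIV. \<Sum>j\<in>UNIV. (x i ^ 2 / 2 + x j ^ 2 / 2) * norm A)"
    unfolding qf_def
  proof (intro order.trans[OF norm_sum] sum_mono)
    fix i j
    have "norm (A $ i $ j) \<le> norm A"
      using Finite_Cartesian_Product.norm_nth_le[of "A $ i" j] Finite_Cartesian_Product.norm_nth_le[of A i] by linarith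
    moreover have "\<bar>x i\<bar> * \<bar>x j\<bar> \<le> x i ^ 2 / 2 + x j ^ 2 / 2"
      using sum_squares_bound[of "\<bar>x i\<bar>" "\<bar>x j\<bar>"] by simp
    ultimately have "(\<bar>x i\<bar> * \<bar>x j\<bar>) * norm (A $ i $ j) \<le> (x i ^ 2 / 2 + x j ^ 2 / 2) * norm A"
      by (intro mult_mono) auto
    thus "norm (of_real (x i) * A $ i $ j * of_real (x j)) \<le> (x i ^ 2 / 2 + x j ^ 2 / 2) * norm A"
      by (simp add: norm_mult mult_ac)
  qed
  also have "\<dots> = real CARD('n) * (\<Sum>i\<in>UNIV. x i ^ 2) * norm A"
    by (simp add: sum.distrib sum_distrib_right[symmetric] sum_divide_distrib[symmetric]
        sum_distrib_left[symmetric] ring_distribs)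
  finally show ?thesis .
qed

text \<open>For each lattice point the exponent is affine in the matrix and its linear part is
  complex linear. The derivative is taken in the space of all matrices at a point of
  \<open>siegel\<close> and then restricted.\<close>

lemma holomorphic_on_siegel_itheta: "holomorphic_on_siegel (itheta e d :: complex^'n^'n \<Rightarrow> complex)"
  unfolding holomorphic_on_siegel_def
proof
  fix \<tau> :: "complex^'n^'n" assume \<tau>: "\<tau> \<in> siegel"
  obtain c where c: "c > 0" "\<And>x. c * (\<Sum>i\<in>UNIV. x i ^ 2) \<le> Im (qf \<tau> (\<lambda>i. of_real (x i)))"
    using siegel_lower_bound[OF \<tau>] by blast
  define w where "w n H = pi * \<i> * qf H (\<lambda>i. of_real (lattice_point e n i))" for n and H :: "complex^'n^'n"
  have "(itheta e d has_derivative (\<lambda>H. \<Sum>\<^sub>\<infinity>n. theta_term e d \<tau> n * w n H)) (at \<tau>)"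
  proof (rule has_derivative_infsum_exp_at)
    show "itheta e d \<tau>' = (\<Sum>\<^sub>\<infinity>n. theta_term e d \<tau> n * exp (w n (\<tau>' - \<tau>)))" for \<tau>'
      unfolding itheta_def theta_term_def w_def mult_exp_exp qf_diff by (simp add: algebra_simps)
    show "linear (w n)" for n
    proof (rule linearI)
      show "w n (A + B) = w n A + w n B" for A B by (simp add: w_def qf_add algebra_simps)
      show "w n (r *\<^sub>R A) = r *\<^sub>R w n A" for r A
        by (simp only: w_def qf_scaleR scaleR_conv_of_real[where 'a=complex] mult_ac)
    qed
    show "norm (w n H) \<le> (pi * real CARD('n) * (\<Sum>i\<in>UNIV. lattice_point e n i ^ 2)) * norm H" for n H
      using mult_left_mono[OF norm_qf_le[of H "lattice_point e n"], of pi] by (simp add: w_def norm_mult mult_ac)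
    show "pi * real CARD('n) * (\<Sum>i\<in>UNIV. lattice_point e n i ^ 2) \<ge> 0" for n
      by (intro mult_nonneg_nonneg sum_nonneg) auto
    \<comment> \<open>This radius spends exactly half of the decay rate \<open>pi * c\<close> on the
      enlarged terms; the factor \<open>CARD('n)\<close> comes from
      \<open>norm_qf_le\<close>.\<close>
    show "c / (2 * real CARD('n)) > 0" using c by simp
    show "(\<lambda>n. norm (theta_term e d \<tau> n) * exp (c / (2 * real CARD('n)) * (pi * real CARD('n) * (\<Sum>i\<in>UNIV. lattice_point e n i ^ 2)))) summable_on UNIV"
    proof (rule summable_on_comparison_test)
      show "(\<lambda>n. exp (- (pi * c / 2) * (\<Sum>i\<in>UNIV. lattice_point e n i ^ 2))) summable_on UNIV"
        using c by (intro summable_on_gaussian_lattice) simp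
      fix n
      define s where "s = (\<Sum>i\<in>UNIV. lattice_point e n i ^ 2)"
      have "norm (theta_term e d \<tau> n) \<le> exp (- (pi * (c * s)))"
        unfolding norm_theta_term s_def using c(2) by simp
      hence "norm (theta_term e d \<tau> n) * exp (pi * c * s / 2) \<le> exp (- (pi * (c * s))) * exp (pi * c * s / 2)"
        by (rule mult_right_mono) simp
      thus "norm (theta_term e d \<tau> n) * exp (c / (2 * real CARD('n)) * (pi * real CARD('n) * (\<Sum>i\<in>UNIV. lattice_point e n i ^ 2))) \<le> exp (- (pi * c / 2) * (\<Sum>i\<in>UNIV. lattice_point e n i ^ 2))"
        unfolding mult_exp_exp s_def[symmetric] by (simp add: field_simps)
    qed simp
  qed
  hence "(itheta e d has_derivative (\<lambda>H. \<Sum>\<^sub>\<infinity>n. theta_term e d \<tau> n * w n H)) (at \<tau> within siegel)"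
    by (rule has_derivative_at_withinI)
  moreover have "w n (map_matrix ((*) a) X) = a * w n X" for n a X
    by (simp add: w_def qf_def map_matrix_def sum_distrib_left mult_ac)
  hence "(\<Sum>\<^sub>\<infinity>n. theta_term e d \<tau> n * w n (map_matrix ((*) a) X)) = a * (\<Sum>\<^sub>\<infinity>n. theta_term e d \<tau> n * w n X)" for a X
    by (simp add: infsum_cmult_right'[symmetric] mult_ac)
  ultimately show "\<exists>f'. (itheta e d has_derivative f') (at \<tau> within siegel) \<and> (\<forall>c X. f' (map_matrix ((*) c) X) = c * f' X)"
    by blast
qed

section \<open>Closure properties of holomorphic functions on Siegel space\<close>

lemma holomorphic_on_siegel_const: "holomorphic_on_siegel (\<lambda>_. c)"
  unfolding holomorphic_on_siegel_def by (intro ballI exI[of _ "\<lambda>_. 0"]) simp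

lemma holomorphic_on_siegel_add:
  assumes "holomorphic_on_siegel f" "holomorphic_on_siegel h"
  shows "holomorphic_on_siegel (\<lambda>\<tau>. f \<tau> + h \<tau>)"
  unfolding holomorphic_on_siegel_def
proof
  fix \<tau> :: "complex^'a^'a" assume "\<tau> \<in> siegel"
  then obtain f' h' where "(f has_derivative f') (at \<tau> within siegel)" "\<forall>c X. f' (map_matrix ((*) c) X) = c * f' X"
    "(h has_derivative h') (at \<tau> within siegel)" "\<forall>c X. h' (map_matrix ((*) c) X) = c * h' X"
    using assms unfolding holomorphic_on_siegel_def by meson
  thus "\<exists>f'. ((\<lambda>\<tau>. f \<tau> + h \<tau>) has_derivative f') (at \<tau> within siegel) \<and> (\<forall>c X. f' (map_matrix ((*) c) X) = c * f' X)"
    by (intro exI[of _ "\<lambda>X. f' X + h' X"]) (auto intro: has_derivative_add simp: algebra_simps)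
qed

lemma holomorphic_on_siegel_mult:
  assumes "holomorphic_on_siegel f" "holomorphic_on_siegel h"
  shows "holomorphic_on_siegel (\<lambda>\<tau>. f \<tau> * h \<tau>)"
  unfolding holomorphic_on_siegel_def
proof
  fix \<tau> :: "complex^'a^'a" assume "\<tau> \<in> siegel"
  then obtain f' h' where "(f has_derivative f') (at \<tau> within siegel)" "\<forall>c X. f' (map_matrix ((*) c) X) = c * f' X"
    "(h has_derivative h') (at \<tau> within siegel)" "\<forall>c X. h' (map_matrix ((*) c) X) = c * h' X"
    using assms unfolding holomorphic_on_siegel_def by meson
  thus "\<exists>f'. ((\<lambda>\<tau>. f \<tau> * h \<tau>) has_derivative f') (at \<tau> within siegel) \<and> (\<forall>c X. f' (map_matrix ((*) c) X) = c * f' X)"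
    by (intro exI[of _ "\<lambda>X. f \<tau> * h' X + f' X * h \<tau>"]) (auto intro: has_derivative_mult simp: algebra_simps)
qed

lemma holomorphic_on_siegel_power: "holomorphic_on_siegel f \<Longrightarrow> holomorphic_on_siegel (\<lambda>\<tau>. f \<tau> ^ k)"
  by (induction k) (auto intro: holomorphic_on_siegel_mult holomorphic_on_siegel_const)

lemma holomorphic_on_siegel_sum:
  "(\<And>i. i \<in> I \<Longrightarrow> holomorphic_on_siegel (f i)) \<Longrightarrow> holomorphic_on_siegel (\<lambda>\<tau>. \<Sum>i\<in>I. f i \<tau>)"
  by (induction I rule: infinite_finite_induct) (auto intro: holomorphic_on_siegel_add holomorphic_on_siegel_const)

lemma holomorphic_on_siegel_prod:
  "(\<And>i. i \<in> I \<Longrightarrow> holomorphic_on_siegel (f i)) \<Longrightarrow> holomorphic_on_siegel (\<lambda>\<tau>. \<Prod>i\<in>I. f i \<tau>)"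
  by (induction I rule: infinite_finite_induct) (auto intro: holomorphic_on_siegel_mult holomorphic_on_siegel_const)

lemma holomorphic_on_siegel_G: "holomorphic_on_siegel (G i :: complex^'n^'n \<Rightarrow> complex)"
proof -
  have "holomorphic_on_siegel (theta v :: complex^'n^'n \<Rightarrow> complex)" for v
    unfolding theta_eq_itheta[abs_def] by (rule holomorphic_on_siegel_itheta)
  thus ?thesis unfolding G_def[abs_def] theta_prod_def
    by (intro holomorphic_on_siegel_sum holomorphic_on_siegel_power holomorphic_on_siegel_prod)
qed

section \<open>Shifts of the characteristic, translations and changes of basis\<close>

lemma exp_pi_i_int_square: "exp (pi * \<i> * of_int m) ^ 2 = 1"
  unfolding exp_of_nat_mult[symmetric] exp_eq_1 by (auto intro!: exI[of _ m])

lemma exp_2pi_i_int: "exp (2 * (pi * \<i> * of_int m)) = 1"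
  unfolding exp_eq_1 by (auto intro!: exI[of _ m])

lemma itheta_shift_e: "itheta (e + 2 * k) d \<tau> = itheta e d \<tau>"
proof -
  have "lattice_point (e + 2 * k) n = lattice_point e (n + k)" for n
    by (simp add: lattice_point_def fun_eq_iff vec_eq_iff field_simps)
  hence "theta_term (e + 2 * k) d \<tau> n = theta_term e d \<tau> (n + k)" for n
    by (simp add: theta_term_def)
  thus ?thesis unfolding itheta_def
    by (intro infsum_reindex_bij_witness[of _ "\<lambda>n. n - k" "\<lambda>n. n + k"]) auto
qed

lemma itheta_shift_d:
  "itheta e (d + 2 * k) \<tau> = exp (pi * \<i> * of_int (\<Sum>i\<in>UNIV. e $ i * k $ i)) * itheta e d \<tau>"
proof -
  have "theta_term e (d + 2 * k) \<tau> n = exp (pi * \<i> * of_int (\<Sum>i\<in>UNIV. e $ i * k $ i)) * theta_term e d \<tau> n" for n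
  proof -
    have "(\<Sum>i\<in>UNIV. complex_of_real (lattice_point e n i) * of_int ((d + 2 * k) $ i)) =
       (\<Sum>i\<in>UNIV. complex_of_real (lattice_point e n i) * of_int (d $ i)) + of_int (\<Sum>i\<in>UNIV. e $ i * k $ i) + 2 * of_int (\<Sum>i\<in>UNIV. n $ i * k $ i)"
      unfolding of_int_sum sum_distrib_left sum.distrib[symmetric]
      by (rule sum.cong) (simp_all add: lattice_point_def algebra_simps)
    hence "theta_term e (d + 2 * k) \<tau> n = exp (pi * \<i> * of_int (\<Sum>i\<in>UNIV. e $ i * k $ i)) * theta_term e d \<tau> n * exp (2 * (pi * \<i> * of_int (\<Sum>i\<in>UNIV. n $ i * k $ i)))"
      unfolding theta_term_def mult_exp_exp by (intro arg_cong[where f = exp]) (simp add: algebra_simps)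
    thus ?thesis unfolding exp_2pi_i_int by simp
  qed
  thus ?thesis unfolding itheta_def infsum_cmult_right'[symmetric] by (intro infsum_cong)
qed

lemma vec_double_nth: "(2 * k) $ i = 2 * k $ i" for k :: "int^'n"
  by (simp add: numeral_eq_Suc plus_1_eq_Suc)

text \<open>An even shift of \<open>e\<close> only reindexes the series, and an even shift of
  \<open>d\<close> multiplies it by a sign. Squaring removes the sign, so the square depends on the
  characteristic modulo 2.\<close>

lemma itheta_square_cong:
  assumes "\<And>i. even (e $ i - e' $ i)" "\<And>i. even (d $ i - d' $ i)"
  shows "itheta e d \<tau> ^ 2 = itheta e' d' \<tau> ^ 2"
proof -
  have e: "e = e' + 2 * (\<chi> i. (e $ i - e' $ i) div 2)" and d: "d = d' + 2 * (\<chi> i. (d $ i - d' $ i) div 2)"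
    using assms by (simp_all add: vec_eq_iff vec_double_nth)
  obtain k where k: "e = e' + 2 * k" using e by blast
  obtain l where l: "d = d' + 2 * l" using d by blast
  show ?thesis
    unfolding k l itheta_shift_e itheta_shift_d power_mult_distrib exp_pi_i_int_square by simp
qed

text \<open>Off-diagonal terms occur in equal pairs. The case \<open>c = 1\<close> gives the parity
  of an integral quadratic form, the case \<open>c = 2\<close> the divisibility by 4 of phases
  summed over a cube.\<close>

lemma sum_symmetric_mod:
  fixes M :: "'a \<Rightarrow> 'a \<Rightarrow> int"
  assumes "finite A" "\<And>i j. M i j = M j i" "\<And>i j. i \<noteq> j \<Longrightarrow> c dvd M i j"
  shows "2 * c dvd (\<Sum>i\<in>A. \<Sum>j\<in>A. M i j) - (\<Sum>i\<in>A. M i i)"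
  using assms(1)
proof induction
  case (insert a A)
  have sw: "(\<Sum>i\<in>A. M i a) = (\<Sum>i\<in>A. M a i)" by (rule sum.cong[OF refl]) (rule assms(2))
  have "(\<Sum>i\<in>insert a A. \<Sum>j\<in>insert a A. M i j) - (\<Sum>i\<in>insert a A. M i i)
     = ((\<Sum>i\<in>A. \<Sum>j\<in>A. M i j) - (\<Sum>i\<in>A. M i i)) + 2 * (\<Sum>j\<in>A. M a j)"
    using insert(1,2) by (simp add: sum.distrib sw)
  moreover have "c dvd (\<Sum>j\<in>A. M a j)"
    using insert by (intro dvd_sum assms(3)) auto
  hence "2 * c dvd 2 * (\<Sum>j\<in>A. M a j)" by (rule mult_dvd_mono[OF dvd_refl])
  ultimately show ?case using insert.IH by (simp only: dvd_add)
qed simp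

text \<open>Modulo 2 the integral quadratic form of \<open>S\<close> at \<open>n\<close> equals the
  linear form given by the diagonal of \<open>S\<close>, so it is absorbed into \<open>d\<close>.
  The cross terms between \<open>n\<close> and \<open>e\<close> shift \<open>d\<close> by
  \<open>S *v e\<close>, and the factor in front collects what is independent of
  \<open>n\<close>.\<close>

lemma itheta_translation:
  fixes e d :: "int^'n"
  assumes S: "transpose S = S"
  shows "itheta e d (\<tau> + complex_mat S) =
    exp (- pi * \<i> / 4 * of_int ((\<Sum>i\<in>UNIV. \<Sum>j\<in>UNIV. e $ i * S $ i $ j * e $ j) + 2 * (\<Sum>i\<in>UNIV. S $ i $ i * e $ i)))
      * itheta e (d + S *v e + (\<chi> i. S $ i $ i)) \<tau>"
proof -
  define Q where "Q = (\<Sum>i\<in>UNIV. \<Sum>j\<in>UNIV. e $ i * S $ i $ j * e $ j)"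
  define L where "L = (\<Sum>i\<in>UNIV. S $ i $ i * e $ i)"
  have Ssym: "S $ i $ j = S $ j $ i" for i j using S by (metis transpose_def vec_lambda_beta)
  have "theta_term e d (\<tau> + complex_mat S) n = exp (- pi * \<i> / 4 * of_int (Q + 2 * L)) * theta_term e (d + S *v e + (\<chi> i. S $ i $ i)) \<tau> n" for n
  proof -
    define N where "N = (\<Sum>i\<in>UNIV. \<Sum>j\<in>UNIV. n $ i * S $ i $ j * n $ j)"
    define D where "D = (\<Sum>i\<in>UNIV. S $ i $ i * n $ i)"
    define B where "B = (\<Sum>i\<in>UNIV. \<Sum>j\<in>UNIV. n $ i * S $ i $ j * e $ j)"
    have "2 * 1 dvd N - (\<Sum>i\<in>UNIV. n $ i * S $ i $ i * n $ i)"
      unfolding N_def by (rule sum_symmetric_mod) (auto simp: Ssym mult_ac)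
    moreover have "2 dvd (\<Sum>i\<in>UNIV. n $ i * S $ i $ i * n $ i) - D"
      unfolding D_def sum_subtractf[symmetric] by (intro dvd_sum) auto
    ultimately have "2 dvd N - D" by (metis dvd_add diff_add_cancel add_diff_eq mult_1_right)
    then obtain k where k: "N = D + 2 * k" by (metis diff_eq_eq dvdE add.commute)
    have B': "(\<Sum>i\<in>UNIV. \<Sum>j\<in>UNIV. e $ i * S $ i $ j * n $ j) = B"
      unfolding B_def by (subst sum.swap) (simp add: Ssym mult_ac)
    have q: "qf (complex_mat S) (\<lambda>i. of_real (lattice_point e n i)) = of_int N + of_int B + of_int Q / 4"
    proof -
      have "qf (complex_mat S) (\<lambda>i. of_real (lattice_point e n i)) =
        (\<Sum>i\<in>UNIV. \<Sum>j\<in>UNIV. of_int (n $ i * S $ i $ j * n $ j) + of_int (n $ i * S $ i $ j * e $ j) / 2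
          + of_int (e $ i * S $ i $ j * n $ j) / 2 + of_int (e $ i * S $ i $ j * e $ j) / 4)"
        unfolding qf_def by (intro sum.cong refl) (simp add: lattice_point_def map_matrix_def field_simps)
      also have "\<dots> = of_int N + of_int B / 2 + of_int B / 2 + of_int Q / 4"
        unfolding sum.distrib sum_divide_distrib[symmetric] of_int_sum[symmetric] B' N_def[symmetric] B_def[symmetric] Q_def[symmetric] ..
      finally show ?thesis by simp
    qed
    have l: "(\<Sum>i\<in>UNIV. complex_of_real (lattice_point e n i) * of_int ((d + S *v e + (\<chi> i. S $ i $ i)) $ i)) =
       (\<Sum>i\<in>UNIV. complex_of_real (lattice_point e n i) * of_int (d $ i)) + of_int B + of_int Q / 2 + of_int D + of_int L / 2"
    proof -
      have "(\<Sum>i\<in>UNIV. complex_of_real (lattice_point e n i) * of_int ((d + S *v e + (\<chi> i. S $ i $ i)) $ i)) =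
        (\<Sum>i\<in>UNIV. complex_of_real (lattice_point e n i) * of_int (d $ i) + of_int (\<Sum>j\<in>UNIV. n $ i * S $ i $ j * e $ j)
          + of_int (\<Sum>j\<in>UNIV. e $ i * S $ i $ j * e $ j) / 2 + of_int (S $ i $ i * n $ i) + of_int (S $ i $ i * e $ i) / 2)"
        by (intro sum.cong refl) (simp add: lattice_point_def matrix_vector_mult_def sum_distrib_left field_simps sum_divide_distrib sum.distrib)
      also have "\<dots> = (\<Sum>i\<in>UNIV. complex_of_real (lattice_point e n i) * of_int (d $ i)) + of_int B + of_int Q / 2 + of_int D + of_int L / 2"
        unfolding sum.distrib sum_divide_distrib[symmetric] of_int_sum[symmetric] B_def D_def Q_def L_def ..
      finally show ?thesis .
    qed
    have "theta_term e d (\<tau> + complex_mat S) n * exp (2 * (pi * \<i> * of_int (- k))) = exp (- pi * \<i> / 4 * of_int (Q + 2 * L)) * theta_term e (d + S *v e + (\<chi> i. S $ i $ i)) \<tau> n"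
      unfolding theta_term_def mult_exp_exp qf_add q l k by (intro arg_cong[where f = exp]) (simp add: field_simps)
    thus ?thesis unfolding exp_2pi_i_int by simp
  qed
  thus ?thesis unfolding itheta_def Q_def L_def infsum_cmult_right'[symmetric] by (intro infsum_cong)
qed

lemma qf_congruence:
  "qf (A ** \<tau> ** transpose A) x = qf \<tau> (\<lambda>j. \<Sum>i\<in>UNIV. A $ i $ j * x i)"
proof -
  have "qf (A ** \<tau> ** transpose A) x = (\<Sum>i\<in>UNIV. \<Sum>j\<in>UNIV. \<Sum>l\<in>UNIV. \<Sum>k\<in>UNIV. (A $ i $ k * x i) * \<tau> $ k $ l * (A $ j $ l * x j))"
    unfolding qf_def matrix_matrix_mult_def transpose_def
    by (simp add: sum_distrib_left sum_distrib_right mult_ac)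
  also have "\<dots> = (\<Sum>i\<in>UNIV. \<Sum>l\<in>UNIV. \<Sum>k\<in>UNIV. \<Sum>j\<in>UNIV. (A $ i $ k * x i) * \<tau> $ k $ l * (A $ j $ l * x j))"
    by (intro sum.cong refl) (subst sum.swap, intro sum.cong refl, rule sum.swap)
  also have "\<dots> = (\<Sum>l\<in>UNIV. \<Sum>k\<in>UNIV. \<Sum>i\<in>UNIV. \<Sum>j\<in>UNIV. (A $ i $ k * x i) * \<tau> $ k $ l * (A $ j $ l * x j))"
    by (subst sum.swap, intro sum.cong refl, rule sum.swap)
  also have "\<dots> = (\<Sum>k\<in>UNIV. \<Sum>l\<in>UNIV. \<Sum>i\<in>UNIV. \<Sum>j\<in>UNIV. (A $ i $ k * x i) * \<tau> $ k $ l * (A $ j $ l * x j))"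
    by (rule sum.swap)
  also have "\<dots> = qf \<tau> (\<lambda>j. \<Sum>i\<in>UNIV. A $ i $ j * x i)"
    unfolding qf_def by (simp add: sum_distrib_left sum_distrib_right mult_ac)
  finally show ?thesis .
qed

text \<open>The sum is reindexed by the bijection \<open>n \<mapsto> transpose A *v n\<close> of the
  lattice.\<close>

lemma itheta_unimodular:
  fixes A A' :: "int^'n^'n"
  assumes AA: "A ** A' = mat 1"
  shows "itheta e d (complex_mat A ** \<tau> ** transpose (complex_mat A)) = itheta (transpose A *v e) (A' *v d) \<tau>"
proof -
  have A'A: "A' ** A = mat 1" using AA by (rule int_matrix_left_right_inverse)
  have pt: "(\<Sum>i\<in>UNIV. of_int (A $ i $ j) * lattice_point e n i) = lattice_point (transpose A *v e) (transpose A *v n) j" for n j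
    by (simp add: lattice_point_def matrix_vector_mult_def transpose_def sum.distrib sum_divide_distrib sum_distrib_left algebra_simps)
  have d: "d = A *v (A' *v d)" by (simp add: AA matrix_vector_mul_assoc)
  have "theta_term e d (complex_mat A ** \<tau> ** transpose (complex_mat A)) n = theta_term (transpose A *v e) (A' *v d) \<tau> (transpose A *v n)" for n
  proof -
    have "(\<Sum>i\<in>UNIV. complex_of_real (lattice_point e n i) * of_int (d $ i)) =
        (\<Sum>i\<in>UNIV. \<Sum>j\<in>UNIV. complex_of_real (of_int (A $ i $ j) * lattice_point e n i) * of_int ((A' *v d) $ j))"
      by (subst d) (simp add: matrix_vector_mult_def[of A] sum_distrib_left mult_ac)
    also have "\<dots> = (\<Sum>j\<in>UNIV. complex_of_real (lattice_point (transpose A *v e) (transpose A *v n) j) * of_int ((A' *v d) $ j))"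
      by (subst sum.swap) (simp only: pt[symmetric] of_real_sum sum_distrib_right)
    finally have "(\<Sum>i\<in>UNIV. complex_of_real (lattice_point e n i) * of_int (d $ i)) = \<dots>" .
    moreover have "qf (complex_mat A ** \<tau> ** transpose (complex_mat A)) (\<lambda>i. of_real (lattice_point e n i)) = qf \<tau> (\<lambda>j. of_real (lattice_point (transpose A *v e) (transpose A *v n) j))"
      unfolding qf_congruence pt[symmetric] by (simp add: map_matrix_def)
    ultimately show ?thesis by (simp add: theta_term_def)
  qed
  moreover have "transpose A' *v (transpose A *v n) = n" "transpose A *v (transpose A' *v n) = n" for n
    by (simp_all only: matrix_vector_mul_assoc matrix_transpose_mul[symmetric] AA A'A transpose_mat matrix_vector_mul_lid)
  ultimately show ?thesis unfolding itheta_def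
    by (intro infsum_reindex_bij_witness[of _ "\<lambda>n. transpose A' *v n" "\<lambda>n. transpose A *v n"]) auto
qed

text \<open>The functional equation of the one-dimensional theta function, with characteristic
  \<open>(a, b)\<close> and argument \<open>w\<close>. It is applied to a single summation index at a time, so that the
  multidimensional Poisson summation formula is not needed.\<close>

lemma theta_series_inversion:
  fixes t w :: complex and a b :: int
  assumes t: "Im t > 0"
  shows "(\<Sum>\<^sub>\<infinity>m::int. exp (pi * \<i> * (- ((of_int m + of_int a / 2 - w) ^ 2) / t + (of_int m + of_int a / 2) * of_int b))) =
    csqrt (- \<i> * t) * exp (pi * \<i> * of_int (a * b) / 2) *
    (\<Sum>\<^sub>\<infinity>m::int. exp (pi * \<i> * (t * (of_int m + of_int b / 2) ^ 2 + 2 * (of_int m + of_int b / 2) * w - (of_int m + of_int b / 2) * of_int a)))"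
    (is "?L = _ * ?R")
proof -
  define z where "z = w - of_int a / 2 + of_int b * t / 2"
  define E where "E = exp (pi * \<i> * (w * of_int b + of_int b ^ 2 * t / 4))"
  have t0: "t \<noteq> 0" using t by auto
  have "pi * \<i> * (- ((of_int m + of_int a / 2 - w) ^ 2) / t + (of_int m + of_int a / 2) * of_int b) =
     pi * \<i> * (w * of_int b + of_int b ^ 2 * t / 4) + - (pi * \<i> * (z - of_int m) ^ 2 / t)" for m :: int
    using t0 by (simp add: z_def field_simps power2_eq_square)
  hence "?L = E * (\<Sum>\<^sub>\<infinity>m::int. exp (- (pi * \<i> * (z - of_int m) ^ 2 / t)))"
    by (simp only: E_def exp_add infsum_cmult_right')
  also have "\<dots> = E * (csqrt (- \<i> * t) * jtheta z t)"
    unfolding jtheta_inverse_eq[symmetric] jtheta_inversion[OF t] ..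
  finally have L: "?L = csqrt (- \<i> * t) * (E * jtheta z t)" by (simp only: mult_ac)
  have "pi * \<i> * (t * (of_int m + of_int b / 2) ^ 2 + 2 * (of_int m + of_int b / 2) * w - (of_int m + of_int b / 2) * of_int a) =
     pi * \<i> * (w * of_int b + of_int b ^ 2 * t / 4) + - (pi * \<i> * of_int (a * b) / 2) + pi * \<i> * (t * of_int m ^ 2 + 2 * of_int m * z)" for m :: int
    by (simp add: z_def field_simps power2_eq_square)
  hence "?R = E * exp (- (pi * \<i> * of_int (a * b) / 2)) * jtheta z t"
    by (simp only: E_def exp_add infsum_cmult_right' jtheta_def)
  hence "exp (pi * \<i> * of_int (a * b) / 2) * ?R = E * jtheta z t"
    by (simp add: exp_minus)
  with L show ?thesis by (simp only: mult.assoc)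
qed

section \<open>Inversion of a symmetric matrix in one coordinate\<close>

definition invert_at :: "'n \<Rightarrow> complex^'n^'n \<Rightarrow> complex^'n^'n" where
  "invert_at k \<tau> = (\<chi> i j.
     if i = k then (if j = k then - 1 / \<tau> $ k $ k else \<tau> $ k $ j / \<tau> $ k $ k)
     else (if j = k then \<tau> $ i $ k / \<tau> $ k $ k else \<tau> $ i $ j - \<tau> $ i $ k * \<tau> $ k $ j / \<tau> $ k $ k))"

text \<open>For symmetric \<tau>, \<open>qf \<tau> x\<close> is a quadratic polynomial in
  \<open>x k\<close>: its linear coefficient is \<open>2 * cross_part k \<tau> x\<close>, and
  \<open>minor_part k \<tau> x\<close> is its value at \<open>x k = 0\<close>.\<close>

definition cross_part :: "'n \<Rightarrow> complex^'n^'n \<Rightarrow> ('n::finite \<Rightarrow> complex) \<Rightarrow> complex" where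
  "cross_part k \<tau> x = (\<Sum>j\<in>UNIV - {k}. \<tau> $ k $ j * x j)"

definition minor_part :: "'n \<Rightarrow> complex^'n^'n \<Rightarrow> ('n::finite \<Rightarrow> complex) \<Rightarrow> complex" where
  "minor_part k \<tau> x = (\<Sum>i\<in>UNIV - {k}. \<Sum>j\<in>UNIV - {k}. x i * \<tau> $ i $ j * x j)"

lemma qf_split_raw:
  "qf \<tau> x = x k * \<tau> $ k $ k * x k + (\<Sum>j\<in>UNIV - {k}. x k * \<tau> $ k $ j * x j)
     + (\<Sum>i\<in>UNIV - {k}. x i * \<tau> $ i $ k * x k) + (\<Sum>i\<in>UNIV - {k}. \<Sum>j\<in>UNIV - {k}. x i * \<tau> $ i $ j * x j)"
  unfolding qf_def by (simp add: sum.remove[of UNIV k] sum.distrib)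

lemma qf_split:
  assumes "transpose \<tau> = \<tau>"
  shows "qf \<tau> x = \<tau> $ k $ k * x k ^ 2 + 2 * x k * cross_part k \<tau> x + minor_part k \<tau> x"
proof -
  have s: "\<tau> $ i $ j = \<tau> $ j $ i" for i j using assms by (metis transpose_def vec_lambda_beta)
  have "(\<Sum>i\<in>UNIV - {k}. x i * \<tau> $ i $ k * x k) = x k * cross_part k \<tau> x"
    unfolding cross_part_def sum_distrib_left by (intro sum.cong refl) (simp add: s[of k])
  moreover have "(\<Sum>j\<in>UNIV - {k}. x k * \<tau> $ k $ j * x j) = x k * cross_part k \<tau> x"
    unfolding cross_part_def sum_distrib_left by (simp add: mult_ac)
  ultimately show ?thesis unfolding qf_split_raw[of \<tau> x k] minor_part_def by (simp add: power2_eq_square)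
qed

text \<open>The entries of \<open>invert_at\<close>, including the Schur complement in the remaining
  block, are such that everything involving the pivot becomes one square while the minor part of
  \<tau> survives unchanged. This matches the exponent of the one-dimensional inversion
  formula.\<close>

lemma qf_invert_at:
  assumes "transpose \<tau> = \<tau>" and t0: "\<tau> $ k $ k \<noteq> 0"
  shows "qf (invert_at k \<tau>) x = - ((x k - cross_part k \<tau> x) ^ 2) / \<tau> $ k $ k + minor_part k \<tau> x"
proof -
  have s: "\<tau> $ i $ j = \<tau> $ j $ i" for i j using assms by (metis transpose_def vec_lambda_beta)
  let ?t = "\<tau> $ k $ k" and ?w = "cross_part k \<tau> x"
  have 1: "(\<Sum>j\<in>UNIV - {k}. x k * invert_at k \<tau> $ k $ j * x j) = x k * ?w / ?t"
    unfolding cross_part_def sum_distrib_left sum_divide_distrib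
    by (intro sum.cong refl) (simp add: invert_at_def)
  have i2: "invert_at k \<tau> $ i $ k = \<tau> $ k $ i / ?t" if "i \<noteq> k" for i
    using that s[of i k] by (simp add: invert_at_def)
  have i3: "invert_at k \<tau> $ i $ j = \<tau> $ i $ j - \<tau> $ k $ i * \<tau> $ k $ j / ?t" if "i \<noteq> k" "j \<noteq> k" for i j
    using that s[of i k] by (simp add: invert_at_def)
  have 2: "(\<Sum>i\<in>UNIV - {k}. x i * invert_at k \<tau> $ i $ k * x k) = x k * ?w / ?t"
    unfolding cross_part_def sum_distrib_left sum_divide_distrib
    by (intro sum.cong refl) (simp add: i2)
  have "(\<Sum>i\<in>UNIV - {k}. \<Sum>j\<in>UNIV - {k}. x i * invert_at k \<tau> $ i $ j * x j) =
     (\<Sum>i\<in>UNIV - {k}. \<Sum>j\<in>UNIV - {k}. x i * \<tau> $ i $ j * x j - (\<tau> $ k $ i * x i) * (\<tau> $ k $ j * x j) / ?t)"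
    by (intro sum.cong refl) (simp add: i3 algebra_simps)
  also have "\<dots> = minor_part k \<tau> x - ?w * ?w / ?t"
    unfolding minor_part_def cross_part_def by (simp only: sum_subtractf sum_product sum_divide_distrib)
  finally have 3: "(\<Sum>i\<in>UNIV - {k}. \<Sum>j\<in>UNIV - {k}. x i * invert_at k \<tau> $ i $ j * x j) = minor_part k \<tau> x - ?w * ?w / ?t" .
  have "invert_at k \<tau> $ k $ k = - 1 / ?t" by (simp add: invert_at_def)
  thus ?thesis unfolding qf_split_raw[of "invert_at k \<tau>" x k] 1 2 3
    using t0 by (simp add: field_simps power2_eq_square)
qed

lemma siegel_symmetric: "\<tau> \<in> siegel \<Longrightarrow> transpose \<tau> = \<tau>"
  by (simp add: siegel_def)

lemma Im_siegel_diag_pos: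
  assumes "\<tau> \<in> siegel" shows "Im (\<tau> $ k $ k) > 0"
proof -
  have "(axis k 1 :: real^'a) \<noteq> 0" by (simp add: axis_eq_0_iff)
  hence "0 < Im (qf \<tau> (\<lambda>i. of_real ((axis k 1 :: real^'a) $ i)))"
    using assms unfolding siegel_iff by blast
  also have "qf \<tau> (\<lambda>i. of_real ((axis k 1 :: real^'a) $ i)) = \<tau> $ k $ k"
    unfolding qf_split[OF siegel_symmetric[OF assms], of _ k] by (simp add: cross_part_def minor_part_def axis_def)
  finally show ?thesis .
qed

text \<open>Let \<open>p = (x k - w) / t\<close> and let \<open>u\<close> be \<open>x\<close> with
  its \<open>k\<close>-th entry replaced by \<open>Re p\<close>. The imaginary part of the new form
  at \<open>x\<close> is that of the old form at \<open>u\<close> plus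
  \<open>Im p ^ 2 * Im t\<close>. If \<open>u = 0\<close>, then \<open>p\<close> is nonzero with
  real part 0, and the second term is positive.\<close>

lemma invert_at_siegel:
  fixes \<tau> :: "complex^'n^'n"
  assumes \<tau>: "\<tau> \<in> siegel" shows "invert_at k \<tau> \<in> siegel"
  unfolding siegel_iff
proof (intro conjI allI impI)
  note sym = siegel_symmetric[OF \<tau>]
  have s: "\<tau> $ i $ j = \<tau> $ j $ i" for i j using sym by (metis transpose_def vec_lambda_beta)
  show "transpose (invert_at k \<tau>) = invert_at k \<tau>"
    by (simp add: transpose_def invert_at_def vec_eq_iff s mult_ac)
  let ?t = "\<tau> $ k $ k"
  have t: "Im ?t > 0" by (rule Im_siegel_diag_pos[OF \<tau>])
  hence t0: "?t \<noteq> 0" by auto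
  fix x :: "real^'n" assume x: "x \<noteq> 0"
  define X where "X = (\<lambda>i. complex_of_real (x $ i))"
  define w where "w = cross_part k \<tau> X"
  define r where "r = minor_part k \<tau> X"
  define p where "p = (X k - w) / ?t"
  define u :: "real^'n" where "u = (\<chi> i. if i = k then Re p else x $ i)"
  have cu: "cross_part k \<tau> (\<lambda>i. of_real (u $ i)) = w"
    unfolding w_def cross_part_def X_def u_def by (intro sum.cong) auto
  have mu: "minor_part k \<tau> (\<lambda>i. of_real (u $ i)) = r"
    unfolding r_def minor_part_def X_def u_def by (intro sum.cong) auto
  have qu: "qf \<tau> (\<lambda>i. of_real (u $ i)) = ?t * of_real (Re p) ^ 2 + 2 * of_real (Re p) * w + r"
    unfolding qf_split[OF sym, of _ k] cu mu by (simp add: u_def)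
  have qx: "qf (invert_at k \<tau>) X = - (p ^ 2 * ?t) + r"
    unfolding qf_invert_at[OF sym t0] w_def[symmetric] r_def[symmetric] p_def
    using t0 by (simp add: power_divide power2_eq_square)
  have pt: "p * ?t = X k - w" using t0 by (simp add: p_def)
  have "Im (p * ?t) = - Im w" unfolding pt by (simp add: X_def)
  hence e: "Im p * Re ?t = - Im w - Re p * Im ?t" by simp
  have "Im (- (p ^ 2 * ?t)) = Im p ^ 2 * Im ?t - Re p ^ 2 * Im ?t - 2 * Re p * (Im p * Re ?t)"
    by (simp add: power2_eq_square algebra_simps)
  also have "\<dots> = Im p ^ 2 * Im ?t + Re p ^ 2 * Im ?t + 2 * Re p * Im w"
    unfolding e by (simp add: power2_eq_square algebra_simps)
  finally have key: "Im (qf (invert_at k \<tau>) X) = Im (qf \<tau> (\<lambda>i. of_real (u $ i))) + Im p ^ 2 * Im ?t"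
    unfolding qx qu by (simp add: power2_eq_square algebra_simps)
  show "0 < Im (qf (invert_at k \<tau>) (\<lambda>i. of_real (x $ i)))"
  proof (cases "u = 0")
    case False
    hence "0 < Im (qf \<tau> (\<lambda>i. of_real (u $ i)))" using \<tau> unfolding siegel_iff by blast
    moreover have "Im p ^ 2 * Im ?t \<ge> 0" using t by simp
    ultimately show ?thesis using key by (simp add: X_def)
  next
    case True
    hence u0: "(if i = k then Re p else x $ i) = 0" for i
      unfolding u_def vec_eq_iff by simp
    have z: "x $ i = 0" if "i \<noteq> k" for i using u0[of i] that by simp
    have "w = 0" unfolding w_def cross_part_def X_def using z by simp
    have "x $ k \<noteq> 0" using x z by (metis vec_eq_iff zero_index)
    hence "p \<noteq> 0" using t0 \<open>w = 0\<close> by (simp add: p_def X_def)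
    moreover have "Re p = 0" using u0[of k] by simp
    ultimately have "Im p \<noteq> 0" by (simp add: complex_eq_iff)
    hence "Im p ^ 2 * Im ?t > 0" using t by simp
    moreover have "qf \<tau> (\<lambda>i. of_real (u $ i)) = 0" unfolding True by (simp add: qf_def)
    ultimately show ?thesis using key by (simp add: X_def)
  qed
qed

text \<open>The remaining coordinates are represented by vectors with \<open>k\<close>-th entry 0,
  so that the index type stays \<open>int^'n\<close>.\<close>

lemma infsum_split_coordinate:
  fixes f :: "int^'n \<Rightarrow> complex"
  assumes "f summable_on UNIV"
  shows "infsum f UNIV = (\<Sum>\<^sub>\<infinity>r\<in>{r. r $ k = 0}. \<Sum>\<^sub>\<infinity>m. f (\<chi> i. if i = k then m else r $ i))"
proof -
  define F where "F = (\<lambda>(r :: int^'n, m). f (\<chi> i. if i = k then m else r $ i))"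
  have "F summable_on ({r. r $ k = 0} \<times> UNIV) \<longleftrightarrow> f summable_on UNIV"
    by (rule summable_on_reindex_bij_witness[of _ "\<lambda>n. (\<chi> i. if i = k then 0 else n $ i, n $ k)" "\<lambda>(r, m). \<chi> i. if i = k then m else r $ i"])
       (auto simp: F_def vec_eq_iff)
  hence s: "F summable_on ({r. r $ k = 0} \<times> UNIV)" using assms by simp
  have "infsum F ({r. r $ k = 0} \<times> UNIV) = infsum f UNIV"
    by (rule infsum_reindex_bij_witness[of _ "\<lambda>n. (\<chi> i. if i = k then 0 else n $ i, n $ k)" "\<lambda>(r, m). \<chi> i. if i = k then m else r $ i"])
       (auto simp: F_def vec_eq_iff)
  also have "infsum F ({r. r $ k = 0} \<times> UNIV) = (\<Sum>\<^sub>\<infinity>r\<in>{r. r $ k = 0}. \<Sum>\<^sub>\<infinity>m. F (r, m))"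
    using infsum_Sigma_banach[OF s] by simp
  finally show ?thesis by (simp add: F_def)
qed

text \<open>With the other coordinates fixed, the sum over the \<open>k\<close>-th one is a
  one-dimensional theta series whose argument is the cross part. Its inversion exchanges the
  \<open>k\<close>-th entries of \<open>e\<close> and \<open>d\<close> up to sign; the factor
  \<open>exp (pi * \<i> * R)\<close> is common to both sides.\<close>

lemma itheta_invert_at:
  fixes \<tau> :: "complex^'n^'n"
  assumes \<tau>: "\<tau> \<in> siegel"
  shows "itheta e d (invert_at k \<tau>) = csqrt (- \<i> * \<tau> $ k $ k) * exp (pi * \<i> * of_int (e $ k * d $ k) / 2) *
     itheta (\<chi> i. if i = k then d $ k else e $ i) (\<chi> i. if i = k then - e $ k else d $ i) \<tau>"
proof -
  define e' where "e' = (\<chi> i. if i = k then d $ k else e $ i)"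
  define d' where "d' = (\<chi> i. if i = k then - e $ k else d $ i)"
  note sym = siegel_symmetric[OF \<tau>]
  let ?t = "\<tau> $ k $ k"
  have t: "Im ?t > 0" by (rule Im_siegel_diag_pos[OF \<tau>])
  hence t0: "?t \<noteq> 0" by auto
  define C where "C = csqrt (- \<i> * ?t) * exp (pi * \<i> * of_int (e $ k * d $ k) / 2)"
  define up where "up r m = (\<chi> i. if i = k then m else r $ i)" for r :: "int^'n" and m
  have inner: "(\<Sum>\<^sub>\<infinity>m. theta_term e d (invert_at k \<tau>) (up r m)) = C * (\<Sum>\<^sub>\<infinity>m. theta_term e' d' \<tau> (up r m))" for r
  proof -
    define Y where "Y i = complex_of_real (lattice_point e r i)" for i
    define w where "w = cross_part k \<tau> Y"
    define R where "R = minor_part k \<tau> Y + (\<Sum>i\<in>UNIV - {k}. Y i * of_int (d $ i))"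
    have c: "cross_part k \<tau> (\<lambda>i. of_real (lattice_point f (up r m) i)) = w"
      "minor_part k \<tau> (\<lambda>i. of_real (lattice_point f (up r m) i)) + (\<Sum>i\<in>UNIV - {k}. of_real (lattice_point f (up r m) i) * of_int (h $ i)) = R"
      if "\<And>i. i \<noteq> k \<Longrightarrow> f $ i = e $ i" "\<And>i. i \<noteq> k \<Longrightarrow> h $ i = d $ i" for m f and h :: "int^'n"
    proof -
      have "of_real (lattice_point f (up r m) i) = Y i" if "i \<noteq> k" for i
        using \<open>\<And>i. i \<noteq> k \<Longrightarrow> f $ i = e $ i\<close>[OF that] that by (simp add: Y_def lattice_point_def up_def)
      thus "cross_part k \<tau> (\<lambda>i. of_real (lattice_point f (up r m) i)) = w"
        "minor_part k \<tau> (\<lambda>i. of_real (lattice_point f (up r m) i)) + (\<Sum>i\<in>UNIV - {k}. of_real (lattice_point f (up r m) i) * of_int (h $ i)) = R"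
        unfolding w_def R_def cross_part_def minor_part_def
        by (auto intro!: sum.cong arg_cong2[where f = "(+)"] simp: that(2))
    qed
    have 1: "theta_term e d (invert_at k \<tau>) (up r m) = exp (pi * \<i> * R) *
        exp (pi * \<i> * (- ((of_int m + of_int (e $ k) / 2 - w) ^ 2) / ?t + (of_int m + of_int (e $ k) / 2) * of_int (d $ k)))" for m
    proof -
      let ?x = "\<lambda>i. complex_of_real (lattice_point e (up r m) i)"
      have xk: "?x k = of_int m + of_int (e $ k) / 2" by (simp add: lattice_point_def up_def)
      have cw: "cross_part k \<tau> ?x = w" by (rule c(1)) simp_all
      have cR: "minor_part k \<tau> ?x + (\<Sum>i\<in>UNIV - {k}. ?x i * of_int (d $ i)) = R" by (rule c(2)) simp_all
      have "qf (invert_at k \<tau>) ?x + (\<Sum>i\<in>UNIV. ?x i * of_int (d $ i)) =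
         - ((?x k - w) ^ 2) / ?t + ?x k * of_int (d $ k) + (minor_part k \<tau> ?x + (\<Sum>i\<in>UNIV - {k}. ?x i * of_int (d $ i)))"
        unfolding qf_invert_at[OF sym t0] cw sum.remove[OF finite UNIV_I, of _ k] by simp
      also have "\<dots> = R + (- ((?x k - w) ^ 2) / ?t + ?x k * of_int (d $ k))"
        unfolding cR by (rule add.commute)
      finally show ?thesis unfolding theta_term_def mult_exp_exp xk by (simp only: distrib_left)
    qed
    have 2: "theta_term e' d' \<tau> (up r m) = exp (pi * \<i> * R) *
        exp (pi * \<i> * (?t * (of_int m + of_int (d $ k) / 2) ^ 2 + 2 * (of_int m + of_int (d $ k) / 2) * w - (of_int m + of_int (d $ k) / 2) * of_int (e $ k)))" for m
    proof -
      let ?x = "\<lambda>i. complex_of_real (lattice_point e' (up r m) i)"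
      have xk: "?x k = of_int m + of_int (d $ k) / 2" by (simp add: lattice_point_def up_def e'_def)
      have cw: "cross_part k \<tau> ?x = w" by (rule c(1)) (simp_all add: e'_def)
      have cR: "minor_part k \<tau> ?x + (\<Sum>i\<in>UNIV - {k}. ?x i * of_int (d' $ i)) = R" by (rule c(2)) (simp_all add: e'_def d'_def)
      have dk: "d' $ k = - e $ k" by (simp add: d'_def)
      have "qf \<tau> ?x + (\<Sum>i\<in>UNIV. ?x i * of_int (d' $ i)) =
         ?t * ?x k ^ 2 + 2 * ?x k * w - ?x k * of_int (e $ k) + (minor_part k \<tau> ?x + (\<Sum>i\<in>UNIV - {k}. ?x i * of_int (d' $ i)))"
        unfolding qf_split[OF sym, of _ k] cw sum.remove[OF finite UNIV_I, of _ k] dk by simp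
      also have "\<dots> = R + (?t * ?x k ^ 2 + 2 * ?x k * w - ?x k * of_int (e $ k))"
        unfolding cR by (rule add.commute)
      finally show ?thesis unfolding theta_term_def mult_exp_exp xk by (simp only: distrib_left)
    qed
    show ?thesis
      unfolding 1 2 infsum_cmult_right' theta_series_inversion[OF t] C_def by (simp only: mult_ac)
  qed
  have "itheta e d (invert_at k \<tau>) = (\<Sum>\<^sub>\<infinity>r\<in>{r. r $ k = 0}. \<Sum>\<^sub>\<infinity>m. theta_term e d (invert_at k \<tau>) (up r m))"
    unfolding itheta_def up_def by (rule infsum_split_coordinate[OF summable_theta_term[OF invert_at_siegel[OF \<tau>]]])
  also have "\<dots> = C * (\<Sum>\<^sub>\<infinity>r\<in>{r. r $ k = 0}. \<Sum>\<^sub>\<infinity>m. theta_term e' d' \<tau> (up r m))"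
    unfolding inner by (rule infsum_cmult_right')
  also have "\<dots> = C * itheta e' d' \<tau>"
    unfolding itheta_def up_def by (simp only: infsum_split_coordinate[OF summable_theta_term[OF \<tau>], of e' d' k])
  finally show ?thesis unfolding C_def e'_def d'_def .
qed

section \<open>Theta constants over cubes of characteristics\<close>

lemma of_int_bit: "(of_int m :: bit) = of_bool (odd m)"
proof -
  have "(of_int m :: bit) = of_int (2 * (m div 2) + m mod 2)" by simp
  also have "\<dots> = of_int (m mod 2)" unfolding of_int_add of_int_mult by simp
  finally show ?thesis by (auto simp: odd_iff_mod_2_eq_one even_iff_mod_2_eq_zero)
qed

lemma bit_add_self [simp]: "x + x = (0::bit)" by (cases x) simp_all

lemma bit_vec_add_self [simp]: "x + x = (0::bit^'n)" by (simp add: vec_eq_iff)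

text \<open>In the swapped order, lower before upper half, a symplectic matrix acts on
  characteristics by ordinary multiplication and a translation, as in
  \<open>theta_equivariant\<close>.\<close>

definition dual :: "bit^('n + 'n) \<Rightarrow> bit^('n::finite + 'n)" where
  "dual v = (\<chi> k. case k of Inl i \<Rightarrow> v $ Inr i | Inr i \<Rightarrow> v $ Inl i)"

lemma dual_nth [simp]: "dual v $ Inl i = v $ Inr i" "dual v $ Inr i = v $ Inl i"
  by (simp_all add: dual_def)

lemma dual_dual [simp]: "dual (dual v) = v"
  unfolding vec_eq_iff all_sum by simp

lemma dual_add: "dual (u + v) = dual u + dual v"
  unfolding vec_eq_iff all_sum by simp

lemma dual_0 [simp]: "dual 0 = 0"
  unfolding vec_eq_iff all_sum by simp

abbreviation bit_mat :: "int^'m^'n \<Rightarrow> bit^'m^'n" where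
  "bit_mat \<equiv> map_matrix of_int"

lemma bit_mat_mult: "bit_mat (M ** N) = bit_mat M ** bit_mat N"
  by (simp add: map_matrix_def matrix_matrix_mult_def vec_eq_iff of_int_sum)

lemma bit_mat_1: "bit_mat (mat 1) = mat 1"
  by (simp add: map_matrix_def mat_def vec_eq_iff)

lemma complex_mat_mult: "complex_mat (M ** N) = complex_mat M ** complex_mat N"
  by (simp add: map_matrix_def matrix_matrix_mult_def vec_eq_iff of_int_sum)

lemma complex_mat_add: "complex_mat (M + N) = complex_mat M + complex_mat N"
  by (simp add: map_matrix_def vec_eq_iff)

lemma complex_mat_1: "complex_mat (mat 1) = mat 1"
  by (simp add: map_matrix_def mat_def vec_eq_iff)

lemma complex_mat_0: "complex_mat 0 = 0"
  by (simp add: map_matrix_def vec_eq_iff)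

lemma complex_mat_transpose: "complex_mat (transpose M) = transpose (complex_mat M)"
  by (simp add: map_matrix_def transpose_def vec_eq_iff)

text \<open>Every integer lift of a characteristic gives the same square, so the transformation
  formulas can be applied to whichever lift is convenient.\<close>

lemma theta_square_eq_itheta:
  assumes "\<And>i. of_int (e $ i) = v $ Inl i" "\<And>i. of_int (d $ i) = v $ Inr i"
  shows "theta v \<tau> ^ 2 = itheta e d \<tau> ^ 2"
  unfolding theta_eq_itheta
proof (rule itheta_square_cong)
  fix i
  show "even ((\<chi> i. of_bit (v $ Inl i)) $ i - e $ i)"
    unfolding vec_lambda_beta assms(1)[symmetric] of_int_bit by simp
  show "even ((\<chi> i. of_bit (v $ Inr i)) $ i - d $ i)"
    unfolding vec_lambda_beta assms(2)[symmetric] of_int_bit by simp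
qed

text \<open>The quadratic form \<open>quad\<close> refines the symplectic form modulo 2. The characteristics
  parametrise all such refinements, via \<open>x \<mapsto> quad x + dot u x\<close> with \<open>u\<close> the dual of the characteristic, and
  the symplectic group acts on them by substitution. The vector \<open>t\<close> in \<open>quad_shift\<close> is therefore
  the translation part of the affine action of \<open>\<gamma>\<close> on characteristics.\<close>

definition quad :: "bit^('n::finite + 'n) \<Rightarrow> bit" where
  "quad x = (\<Sum>i\<in>(UNIV::'n set). x $ Inl i * x $ Inr i)"

definition dot :: "bit^'n \<Rightarrow> bit^'n \<Rightarrow> bit" where
  "dot x y = (\<Sum>i\<in>UNIV. x $ i * y $ i)"

definition quad_shift :: "int^('n::finite + 'n)^('n + 'n) \<Rightarrow> bit^('n + 'n) \<Rightarrow> bool" where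
  "quad_shift \<gamma> t \<longleftrightarrow> (\<forall>x. quad (x v* bit_mat \<gamma>) = quad x + dot t x)"

definition cube_prod :: "(bit^'n \<Rightarrow> complex) \<Rightarrow> bit^'n \<Rightarrow> bit^'n \<Rightarrow> bit^'n \<Rightarrow> bit^'n \<Rightarrow> complex" where
  "cube_prod f a b c d = f a * f (a + b) * f (a + c) * f (a + b + c)
     * f (a + d) * f (a + b + d) * f (a + c + d) * f (a + b + c + d)"

text \<open>A property built to be stable under products of matrices. It includes invariance of
  \<open>siegel\<close> and nonvanishing of the determinant, and it records multipliers only through
  products over cubes.\<close>

definition theta_equivariant :: "int^('n::finite + 'n)^('n + 'n) \<Rightarrow> bit^('n + 'n) \<Rightarrow> bool" where
  "theta_equivariant \<gamma> t \<longleftrightarrow> quad_shift \<gamma> t \<and> (\<forall>\<tau>\<in>siegel. siegel_act \<gamma> \<tau> \<in> siegel \<and> det (automorphy \<gamma> \<tau>) \<noteq> 0 \<and>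
     (\<forall>a b c d. cube_prod (\<lambda>u. theta (dual (bit_mat \<gamma> *v u + t)) (siegel_act \<gamma> \<tau>) ^ 2) a b c d =
        det (automorphy \<gamma> \<tau>) ^ 8 * cube_prod (\<lambda>u. theta (dual u) \<tau> ^ 2) a b c d))"

lemma dot_mult_left: "dot (M *v t) x = dot t (x v* M)"
  unfolding dot_def matrix_vector_mult_def vector_matrix_mult_def
  by (simp add: sum_distrib_left sum_distrib_right mult_ac) (rule sum.swap)

lemma dot_add_left: "dot (s + t) x = dot s x + dot t x"
  by (simp add: dot_def sum.distrib ring_distribs)

lemma cube_prod_mult: "cube_prod (\<lambda>u. f u * h u) a b c d = cube_prod f a b c d * cube_prod h a b c d"
  by (simp add: cube_prod_def mult_ac)

lemma cube_prod_const: "cube_prod (\<lambda>_. k) a b c d = k ^ 8"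
  by (simp add: cube_prod_def power_numeral_reduce mult_ac)

lemma cube_prod_affine:
  assumes "\<And>x y. L (x + y) = L x + L y"
  shows "cube_prod (\<lambda>u. f (L u + t)) a b c d = cube_prod f (L a + t) (L b) (L c) (L d)"
  unfolding cube_prod_def assms by (simp only: add_ac)

section \<open>The action on Siegel space and its cocycle\<close>

lemma matrix_add_left: "(A + B) ** C = A ** C + B ** C" for A :: "'a::semiring_1^'n^'m"
  by (simp add: matrix_matrix_mult_def vec_eq_iff ring_distribs sum.distrib)

lemma invertible_matrix_inv:
  "invertible A \<Longrightarrow> A ** matrix_inv A = mat 1 \<and> matrix_inv A ** A = mat 1"
  unfolding matrix_inv_def invertible_def by (rule someI_ex)

lemma siegel_act_mult_automorphy:
  assumes "det (automorphy \<gamma> \<tau>) \<noteq> 0"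
  shows "siegel_act \<gamma> \<tau> ** automorphy \<gamma> \<tau> = complex_mat (blockA \<gamma>) ** \<tau> + complex_mat (blockB \<gamma>)"
proof -
  have "matrix_inv (automorphy \<gamma> \<tau>) ** automorphy \<gamma> \<tau> = mat 1"
    using assms invertible_matrix_inv[of "automorphy \<gamma> \<tau>"] by (simp add: invertible_det_nz)
  thus ?thesis unfolding siegel_act_def by (simp flip: matrix_mul_assoc)
qed

lemma siegel_act_eqI:
  assumes "det (automorphy \<gamma> \<tau>) \<noteq> 0" "\<tau>' ** automorphy \<gamma> \<tau> = complex_mat (blockA \<gamma>) ** \<tau> + complex_mat (blockB \<gamma>)"
  shows "siegel_act \<gamma> \<tau> = \<tau>'"
proof -
  have "automorphy \<gamma> \<tau> ** matrix_inv (automorphy \<gamma> \<tau>) = mat 1"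
    using assms invertible_matrix_inv[of "automorphy \<gamma> \<tau>"] by (simp add: invertible_det_nz)
  thus ?thesis unfolding siegel_act_def assms(2)[symmetric] by (simp flip: matrix_mul_assoc)
qed

lemma block_mult:
  "blockA (M ** N) = blockA M ** blockA N + blockB M ** blockC N"
  "blockB (M ** N) = blockA M ** blockB N + blockB M ** blockD N"
  "blockC (M ** N) = blockC M ** blockA N + blockD M ** blockC N"
  "blockD (M ** N) = blockC M ** blockB N + blockD M ** blockD N"
  by (metis mat4_blocks mat4_mult block_mat4)+

lemma automorphy_mult:
  assumes "det (automorphy N \<tau>) \<noteq> 0"
  shows "automorphy (M ** N) \<tau> = automorphy M (siegel_act N \<tau>) ** automorphy N \<tau>"
proof -
  have "automorphy M (siegel_act N \<tau>) ** automorphy N \<tau> =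
    complex_mat (blockC M) ** (siegel_act N \<tau> ** automorphy N \<tau>) + complex_mat (blockD M) ** automorphy N \<tau>"
    unfolding automorphy_def[of M] matrix_add_left by (simp only: matrix_mul_assoc)
  thus ?thesis unfolding siegel_act_mult_automorphy[OF assms] unfolding automorphy_def block_mult complex_mat_add complex_mat_mult
    by (simp only: matrix_add_left matrix_add_ldistrib matrix_mul_assoc add_ac)
qed

lemma siegel_act_mult:
  assumes "det (automorphy N \<tau>) \<noteq> 0" "det (automorphy M (siegel_act N \<tau>)) \<noteq> 0"
  shows "siegel_act (M ** N) \<tau> = siegel_act M (siegel_act N \<tau>)"
proof (rule siegel_act_eqI)
  show "det (automorphy (M ** N) \<tau>) \<noteq> 0"
    unfolding automorphy_mult[OF assms(1)] det_mul using assms by simp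
  have "siegel_act M (siegel_act N \<tau>) ** automorphy (M ** N) \<tau> =
     (complex_mat (blockA M) ** siegel_act N \<tau> + complex_mat (blockB M)) ** automorphy N \<tau>"
    unfolding automorphy_mult[OF assms(1)] matrix_mul_assoc siegel_act_mult_automorphy[OF assms(2)] ..
  also have "\<dots> = complex_mat (blockA M) ** (siegel_act N \<tau> ** automorphy N \<tau>) + complex_mat (blockB M) ** automorphy N \<tau>"
    unfolding matrix_add_left by (simp only: matrix_mul_assoc)
  also have "\<dots> = complex_mat (blockA (M ** N)) ** \<tau> + complex_mat (blockB (M ** N))"
    unfolding siegel_act_mult_automorphy[OF assms(1)] unfolding automorphy_def block_mult complex_mat_add complex_mat_mult
    by (simp only: matrix_add_left matrix_add_ldistrib matrix_mul_assoc add_ac)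
  finally show "siegel_act M (siegel_act N \<tau>) ** automorphy (M ** N) \<tau> = complex_mat (blockA (M ** N)) ** \<tau> + complex_mat (blockB (M ** N))" .
qed

text \<open>The affine map of \<open>N\<close> carries a cube to a cube, so the relation for
  \<open>M\<close> applies to the image. The determinants multiply by the cocycle relation, and
  composing the affine maps gives the new translation part.\<close>

lemma theta_equivariant_mult:
  assumes M: "theta_equivariant M s" and N: "theta_equivariant N t"
  shows "theta_equivariant (M ** N) (s + bit_mat M *v t)"
  unfolding theta_equivariant_def
proof (intro conjI ballI allI)
  have "quad (x v* bit_mat (M ** N)) = quad x + dot (s + bit_mat M *v t) x" for x
  proof -
    have "quad (x v* bit_mat (M ** N)) = quad (x v* bit_mat M v* bit_mat N)"
      unfolding bit_mat_mult vector_matrix_mul_assoc[symmetric] ..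
    also have "\<dots> = quad x + dot s x + dot t (x v* bit_mat M)"
      using M N by (simp add: theta_equivariant_def quad_shift_def)
    finally show ?thesis by (simp add: dot_add_left dot_mult_left add_ac)
  qed
  thus "quad_shift (M ** N) (s + bit_mat M *v t)" by (simp add: quad_shift_def)
  fix \<tau> :: "complex^'a^'a" assume \<tau>: "\<tau> \<in> siegel"
  let ?\<tau> = "siegel_act N \<tau>"
  have N': "?\<tau> \<in> siegel" "det (automorphy N \<tau>) \<noteq> 0" using N \<tau> by (simp_all add: theta_equivariant_def)
  have M': "siegel_act M ?\<tau> \<in> siegel" "det (automorphy M ?\<tau>) \<noteq> 0" using M N' by (simp_all add: theta_equivariant_def)
  note act = siegel_act_mult[OF N'(2) M'(2)] and aut = automorphy_mult[OF N'(2), of M]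
  show "siegel_act (M ** N) \<tau> \<in> siegel" "det (automorphy (M ** N) \<tau>) \<noteq> 0"
    using N' M' by (simp_all add: act aut det_mul)
  fix a b c d
  let ?f = "\<lambda>u. theta (dual (bit_mat M *v u + s)) (siegel_act M ?\<tau>) ^ 2"
  have "bit_mat (M ** N) *v u + (s + bit_mat M *v t) = bit_mat M *v (bit_mat N *v u + t) + s" for u
    unfolding bit_mat_mult matrix_vector_mul_assoc[symmetric] matrix_vector_right_distrib by (simp only: add_ac)
  hence "cube_prod (\<lambda>u. theta (dual (bit_mat (M ** N) *v u + (s + bit_mat M *v t))) (siegel_act (M ** N) \<tau>) ^ 2) a b c d =
     cube_prod (\<lambda>u. ?f (bit_mat N *v u + t)) a b c d"
    by (simp only: act)
  also have "\<dots> = cube_prod ?f (bit_mat N *v a + t) (bit_mat N *v b) (bit_mat N *v c) (bit_mat N *v d)"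
    by (rule cube_prod_affine) (rule matrix_vector_right_distrib)
  also have "\<dots> = det (automorphy M ?\<tau>) ^ 8 * cube_prod (\<lambda>u. theta (dual u) ?\<tau> ^ 2) (bit_mat N *v a + t) (bit_mat N *v b) (bit_mat N *v c) (bit_mat N *v d)"
    using M N' by (simp add: theta_equivariant_def)
  also have "\<dots> = det (automorphy M ?\<tau>) ^ 8 * cube_prod (\<lambda>u. theta (dual (bit_mat N *v u + t)) ?\<tau> ^ 2) a b c d"
    by (subst cube_prod_affine[of "\<lambda>u. bit_mat N *v u"]) (simp_all add: matrix_vector_right_distrib)
  also have "\<dots> = det (automorphy M ?\<tau>) ^ 8 * (det (automorphy N \<tau>) ^ 8 * cube_prod (\<lambda>u. theta (dual u) \<tau> ^ 2) a b c d)"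
    using N \<tau> by (simp add: theta_equivariant_def)
  finally show "cube_prod (\<lambda>u. theta (dual (bit_mat (M ** N) *v u + (s + bit_mat M *v t))) (siegel_act (M ** N) \<tau>) ^ 2) a b c d =
      det (automorphy (M ** N) \<tau>) ^ 8 * cube_prod (\<lambda>u. theta (dual u) \<tau> ^ 2) a b c d"
    by (simp add: aut det_mul power_mult_distrib mult_ac)
qed

text \<open>The form in which generators are checked: a factor \<kappa> common to all
  characteristics, agreeing with the determinant after taking eighth powers, and a phase
  \<open>p\<close> whose product over every cube is 1.\<close>

lemma theta_equivariantI:
  assumes "quad_shift \<gamma> t"
    and "\<And>\<tau>. \<tau> \<in> siegel \<Longrightarrow> \<exists>\<kappa> p. \<kappa> ^ 8 = det (automorphy \<gamma> \<tau>) ^ 8 \<and> (\<forall>a b c d. cube_prod p a b c d = 1) \<and>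
      siegel_act \<gamma> \<tau> \<in> siegel \<and> det (automorphy \<gamma> \<tau>) \<noteq> 0 \<and>
      (\<forall>u. theta (dual (bit_mat \<gamma> *v u + t)) (siegel_act \<gamma> \<tau>) ^ 2 = \<kappa> * p u * theta (dual u) \<tau> ^ 2)"
  shows "theta_equivariant \<gamma> t"
  unfolding theta_equivariant_def
proof (intro conjI ballI allI assms(1))
  fix \<tau> :: "complex^'a^'a" assume "\<tau> \<in> siegel"
  then obtain \<kappa> p where *: "\<kappa> ^ 8 = det (automorphy \<gamma> \<tau>) ^ 8" "\<And>a b c d. cube_prod p a b c d = 1"
    "siegel_act \<gamma> \<tau> \<in> siegel" "det (automorphy \<gamma> \<tau>) \<noteq> 0"
    "\<And>u. theta (dual (bit_mat \<gamma> *v u + t)) (siegel_act \<gamma> \<tau>) ^ 2 = \<kappa> * p u * theta (dual u) \<tau> ^ 2"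
    using assms(2) by meson
  show "siegel_act \<gamma> \<tau> \<in> siegel" "det (automorphy \<gamma> \<tau>) \<noteq> 0" by fact+
  show "cube_prod (\<lambda>u. theta (dual (bit_mat \<gamma> *v u + t)) (siegel_act \<gamma> \<tau>) ^ 2) a b c d =
        det (automorphy \<gamma> \<tau>) ^ 8 * cube_prod (\<lambda>u. theta (dual u) \<tau> ^ 2) a b c d" for a b c d
    unfolding *(5) cube_prod_mult cube_prod_const *(1,2) by simp
qed

section \<open>Exponents of phases summed over cubes\<close>

definition cube_sum :: "(bit^'n \<Rightarrow> int) \<Rightarrow> bit^'n \<Rightarrow> bit^'n \<Rightarrow> bit^'n \<Rightarrow> bit^'n \<Rightarrow> int" where
  "cube_sum f a b c d = f a + f (a + b) + f (a + c) + f (a + b + c)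
     + f (a + d) + f (a + b + d) + f (a + c + d) + f (a + b + c + d)"

lemma cube_prod_exp: "cube_prod (\<lambda>u. exp (z * of_int (f u))) a b c d = exp (z * of_int (cube_sum f a b c d))"
  unfolding cube_prod_def cube_sum_def by (simp add: exp_add ring_distribs)

lemma cube_sum_sum: "cube_sum (\<lambda>u. \<Sum>i\<in>I. f i u) a b c d = (\<Sum>i\<in>I. cube_sum (f i) a b c d)"
  unfolding cube_sum_def by (simp add: sum.distrib)

lemma cube_sum_add: "cube_sum (\<lambda>u. f u + h u) a b c d = cube_sum f a b c d + cube_sum h a b c d"
  unfolding cube_sum_def by simp

lemma cube_sum_cmult: "cube_sum (\<lambda>u. k * f u) a b c d = k * cube_sum f a b c d"
  unfolding cube_sum_def by (simp add: ring_distribs)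

text \<open>A coordinate is an affine function of the three cube parameters, so it equals 1 at 0, 4
  or 8 of the eight points.\<close>

lemma cube_sum_bit_dvd: "4 dvd cube_sum (\<lambda>u. of_bit (u $ i)) a b c d"
  unfolding cube_sum_def
  by (cases "a $ i"; cases "b $ i"; cases "c $ i"; cases "d $ i"; simp)

text \<open>Modulo 2 this is a polynomial of degree at most 2 in three parameters, and such a
  polynomial sums to 0 over all eight parameter values.\<close>

lemma cube_sum_bit_mult_even: "even (cube_sum (\<lambda>u. of_bit (u $ i) * of_bit (u $ j)) a b c d)"
proof -
  have b: "(of_int (of_bit x * of_bit y) :: bit) = x * y" for x y :: bit
    by (cases x; cases y) simp_all
  have "(of_int (cube_sum (\<lambda>u. of_bit (u $ i) * of_bit (u $ j)) a b c d) :: bit) = 0"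
    unfolding cube_sum_def of_int_add b vector_add_component
    by (simp add: ring_distribs add_ac)
  thus ?thesis by (simp add: of_int_bit split: if_splits)
qed

definition lift :: "bit^'n \<Rightarrow> int^'n" where "lift v = (\<chi> i. of_bit (v $ i))"

definition upper :: "bit^('n + 'n) \<Rightarrow> bit^'n" where "upper u = (\<chi> i. u $ Inl i)"

definition lower :: "bit^('n + 'n) \<Rightarrow> bit^'n" where "lower u = (\<chi> i. u $ Inr i)"

lemma of_int_lift: "of_int (lift v $ i) = v $ i"
  by (cases "v $ i") (simp_all add: lift_def)

lemma of_int_mult_lift: "of_int ((M *v lift v) $ i) = (bit_mat M *v v) $ i"
  by (simp add: matrix_vector_mult_def map_matrix_def of_int_sum of_int_lift)

lemma mat4_mult_vec:
  fixes A B C D :: "int^'n^'n"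
  shows "(bit_mat (mat4 A B C D) *v u) $ Inl i = (bit_mat A *v upper u) $ i + (bit_mat B *v lower u) $ i"
    "(bit_mat (mat4 A B C D) *v u) $ Inr i = (bit_mat C *v upper u) $ i + (bit_mat D *v lower u) $ i"
  by (simp_all add: matrix_vector_mult_def map_matrix_def sum_UNIV_sum upper_def lower_def)

lemma vec_mult_mat4:
  fixes A B C D :: "int^'n^'n"
  shows "(u v* bit_mat (mat4 A B C D)) $ Inl i = (upper u v* bit_mat A) $ i + (lower u v* bit_mat C) $ i"
    "(u v* bit_mat (mat4 A B C D)) $ Inr i = (upper u v* bit_mat B) $ i + (lower u v* bit_mat D) $ i"
  by (simp_all add: vector_matrix_mult_def map_matrix_def sum_UNIV_sum upper_def lower_def)

lemma quad_eq_dot: "quad x = dot (upper x) (lower x)"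
  by (simp add: quad_def dot_def upper_def lower_def)

lemma dot_add_right: "dot x (s + t) = dot x s + dot x t"
  by (simp add: dot_def sum.distrib ring_distribs)

lemma dot_commute: "dot x y = dot y x"
  by (simp add: dot_def mult.commute)

lemma automorphy_mat4: "automorphy (mat4 A B C D) \<tau> = complex_mat C ** \<tau> + complex_mat D"
  by (simp add: automorphy_def)

lemma sum_symmetric_bit:
  fixes M :: "'a \<Rightarrow> 'a \<Rightarrow> bit"
  assumes "finite I" "\<And>i j. M i j = M j i"
  shows "(\<Sum>i\<in>I. \<Sum>j\<in>I. M i j) = (\<Sum>i\<in>I. M i i)"
  using assms(1)
proof induction
  case (insert a I)
  have "(\<Sum>i\<in>I. M i a) = (\<Sum>i\<in>I. M a i)" by (rule sum.cong[OF refl]) (rule assms(2))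
  hence "(\<Sum>i\<in>insert a I. \<Sum>j\<in>insert a I. M i j) = M a a + (\<Sum>i\<in>I. \<Sum>j\<in>I. M i j) + ((\<Sum>i\<in>I. M a i) + (\<Sum>i\<in>I. M a i))"
    using insert(1,2) by (simp add: sum.distrib add_ac del: bit_add_self)
  thus ?case using insert by simp
qed simp

section \<open>Equivariance under the three kinds of generators\<close>

lemma quad_shift_translation:
  fixes S :: "int^'n^'n"
  assumes S: "transpose S = S"
  shows "quad_shift (mat4 (mat 1) S 0 (mat 1)) (\<chi> k. case k of Inl i \<Rightarrow> of_int (S $ i $ i) | Inr i \<Rightarrow> 0)"
  unfolding quad_shift_def
proof
  fix x :: "bit^('n + 'n)"
  let ?x = "upper x" and ?y = "lower x" and ?t = "(\<chi> k. case k of Inl i \<Rightarrow> of_int (S $ i $ i) | Inr i \<Rightarrow> 0) :: bit^('n + 'n)"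
  have Ssym: "S $ i $ j = S $ j $ i" for i j using S by (metis transpose_def vec_lambda_beta)
  have z: "bit_mat 0 = (0 :: bit^'n^'n)" by (simp add: map_matrix_def vec_eq_iff)
  have u: "upper (x v* bit_mat (mat4 (mat 1) S 0 (mat 1))) = ?x"
    "lower (x v* bit_mat (mat4 (mat 1) S 0 (mat 1))) = ?x v* bit_mat S + ?y"
    unfolding upper_def[of "_ v* _"] lower_def[of "_ v* _"] vec_eq_iff vec_lambda_beta vec_mult_mat4
    by (simp_all add: bit_mat_1 z)
  \<comment> \<open>In characteristic 2 the off-diagonal terms of a symmetric matrix cancel and
    squares of bits are the bits themselves. The form is therefore linear, given by the diagonal of
    \<open>S\<close>.\<close>
  have "dot ?x (?x v* bit_mat S) = (\<Sum>i\<in>UNIV. \<Sum>j\<in>UNIV. ?x $ i * of_int (S $ i $ j) * ?x $ j)"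
    unfolding dot_def vector_matrix_mult_def map_matrix_def
    by (subst sum.swap) (simp add: sum_distrib_left mult_ac)
  also have "\<dots> = (\<Sum>i\<in>UNIV. ?x $ i * of_int (S $ i $ i) * ?x $ i)"
    by (rule sum_symmetric_bit) (simp_all add: Ssym mult_ac)
  also have "\<dots> = dot ?t x"
  proof -
    have b: "p * q * p = q * p" for p q :: bit by (cases p) simp_all
    show ?thesis unfolding b dot_def sum_UNIV_sum by (simp add: upper_def)
  qed
  finally show "quad (x v* bit_mat (mat4 (mat 1) S 0 (mat 1))) = quad x + dot ?t x"
    unfolding quad_eq_dot u dot_add_right by (simp only: add.commute)
qed

lemma translation_siegel:
  assumes S: "transpose S = S" and \<tau>: "\<tau> \<in> siegel"
  shows "\<tau> + complex_mat S \<in> siegel"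
proof -
  have "Im (qf (complex_mat S) (\<lambda>i. of_real (x $ i))) = 0" for x :: "real^'a"
    unfolding Im_qf by (simp add: matrix_vector_mult_def map_matrix_def inner_vec_def)
  moreover have "transpose (\<tau> + complex_mat S) = \<tau> + complex_mat S"
    using S siegel_symmetric[OF \<tau>] complex_mat_transpose[of S] by (simp add: transpose_def vec_eq_iff)
  ultimately show ?thesis using \<tau> by (simp add: siegel_iff qf_add)
qed

lemma cube_prod_exp_eq_1:
  assumes "\<And>a b c d. 4 dvd cube_sum f a b c d"
  shows "cube_prod (\<lambda>u. exp (- pi * \<i> / 2 * of_int (f u))) a b c d = 1"
proof -
  obtain k where k: "cube_sum f a b c d = 4 * k" using assms by blast
  have "- pi * \<i> / 2 * of_int (4 * k) = 2 * (pi * \<i> * of_int (- k))" by simp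
  thus ?thesis unfolding cube_prod_exp k by (simp only: exp_2pi_i_int)
qed

lemma theta_equivariant_translation:
  fixes S :: "int^'n^'n"
  assumes S: "transpose S = S"
  shows "theta_equivariant (mat4 (mat 1) S 0 (mat 1)) (\<chi> k. case k of Inl i \<Rightarrow> of_int (S $ i $ i) | Inr i \<Rightarrow> 0)"
proof (rule theta_equivariantI[OF quad_shift_translation[OF S]])
  fix \<tau> :: "complex^'n^'n" assume \<tau>: "\<tau> \<in> siegel"
  let ?g = "mat4 (mat 1) S 0 (mat 1)"
  let ?t = "(\<chi> k. case k of Inl i \<Rightarrow> of_int (S $ i $ i) | Inr i \<Rightarrow> 0) :: bit^('n + 'n)"
  have Ssym: "S $ i $ j = S $ j $ i" for i j using S by (metis transpose_def vec_lambda_beta)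
  have aut: "automorphy ?g \<tau> = mat 1"
    by (simp add: automorphy_mat4 complex_mat_0 complex_mat_1)
  have act: "siegel_act ?g \<tau> = \<tau> + complex_mat S"
    by (rule siegel_act_eqI) (simp_all add: aut complex_mat_1)
  define q where "q u = (\<Sum>i\<in>UNIV. \<Sum>j\<in>UNIV. S $ i $ j * (of_bit (u $ Inr i) * of_bit (u $ Inr j)))
      + 2 * (\<Sum>i\<in>UNIV. S $ i $ i * of_bit (u $ Inr i))" for u :: "bit^('n + 'n)"
  define p where "p u = exp (- pi * \<i> / 2 * of_int (q u))" for u :: "bit^('n + 'n)"
  \<comment> \<open>Diagonal terms reduce to single coordinates, because 0 and 1 are their own
    squares, and contribute multiples of 4. Off-diagonal terms occur twice with an even cube
    sum.\<close>
  have "4 dvd cube_sum q a b c d" for a b c d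
  proof -
    define N where "N i j = cube_sum (\<lambda>u. of_bit (u $ Inr i) * of_bit (u $ Inr j)) a b c d" for i j :: 'n
    have cs: "cube_sum q a b c d = (\<Sum>i\<in>UNIV. \<Sum>j\<in>UNIV. S $ i $ j * N i j) + 2 * (\<Sum>i\<in>UNIV. S $ i $ i * cube_sum (\<lambda>u. of_bit (u $ Inr i)) a b c d)"
      unfolding q_def N_def cube_sum_add cube_sum_cmult cube_sum_sum ..
    have "4 dvd (\<Sum>i\<in>UNIV. S $ i $ i * cube_sum (\<lambda>u. of_bit (u $ Inr i)) a b c d)"
      by (intro dvd_sum dvd_mult cube_sum_bit_dvd)
    moreover have "4 dvd (\<Sum>i\<in>UNIV. \<Sum>j\<in>UNIV. S $ i $ j * N i j)"
    proof -
      have "2 * 2 dvd (\<Sum>i\<in>UNIV. \<Sum>j\<in>UNIV. S $ i $ j * N i j) - (\<Sum>i\<in>UNIV. S $ i $ i * N i i)"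
      proof (rule sum_symmetric_mod)
        show "S $ i $ j * N i j = S $ j $ i * N j i" for i j
          using Ssym[of i j] by (simp add: N_def mult.commute)
        show "2 dvd S $ i $ j * N i j" for i j
          unfolding N_def by (intro dvd_mult cube_sum_bit_mult_even)
      qed simp
      moreover have "N i i = cube_sum (\<lambda>u. of_bit (u $ Inr i)) a b c d" for i
        unfolding N_def by (rule arg_cong[where f = "\<lambda>f. cube_sum f a b c d"]) (simp add: fun_eq_iff of_bool_def)
      hence "4 dvd (\<Sum>i\<in>UNIV. S $ i $ i * N i i)"
        by (simp only:) (intro dvd_sum dvd_mult cube_sum_bit_dvd)
      ultimately have "4 dvd ((\<Sum>i\<in>UNIV. \<Sum>j\<in>UNIV. S $ i $ j * N i j) - (\<Sum>i\<in>UNIV. S $ i $ i * N i i)) + (\<Sum>i\<in>UNIV. S $ i $ i * N i i)"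
        by (intro dvd_add) simp_all
      thus ?thesis by (simp only: diff_add_cancel)
    qed
    ultimately show ?thesis unfolding cs by (intro dvd_add dvd_mult)
  qed
  hence p1: "cube_prod p a b c d = 1" for a b c d
    unfolding p_def[abs_def] by (rule cube_prod_exp_eq_1)
  have "theta (dual (bit_mat ?g *v u + ?t)) (\<tau> + complex_mat S) ^ 2 = p u * theta (dual u) \<tau> ^ 2" for u
  proof -
    define e where "e = lift (lower u)"
    \<comment> \<open>The shift is built into \<open>d\<close> here, and
      \<open>itheta_translation\<close> adds it a second time. The result is congruent to
      \<open>lift (upper u)\<close> modulo 2.\<close>
    define d where "d = lift (upper u) + S *v e + (\<chi> i. S $ i $ i)"
    have z: "bit_mat 0 = (0 :: bit^'n^'n)" by (simp add: map_matrix_def vec_eq_iff)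
    have "theta (dual (bit_mat ?g *v u + ?t)) (\<tau> + complex_mat S) ^ 2 = itheta e d (\<tau> + complex_mat S) ^ 2"
      by (rule theta_square_eq_itheta)
         (simp_all add: mat4_mult_vec bit_mat_1 z e_def d_def of_int_lift of_int_mult_lift add_ac)
    also have "\<dots> = p u * itheta e (d + S *v e + (\<chi> i. S $ i $ i)) \<tau> ^ 2"
    proof -
      have "(\<Sum>i\<in>UNIV. \<Sum>j\<in>UNIV. e $ i * S $ i $ j * e $ j) + 2 * (\<Sum>i\<in>UNIV. S $ i $ i * e $ i) = q u"
        by (simp add: q_def e_def lift_def lower_def mult_ac)
      hence i: "itheta e d (\<tau> + complex_mat S) = exp (- pi * \<i> / 4 * of_int (q u)) * itheta e (d + S *v e + (\<chi> i. S $ i $ i)) \<tau>"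
        using itheta_translation[OF S, of e d \<tau>] by (simp only:)
      have "exp (- pi * \<i> / 4 * of_int (q u)) ^ 2 = p u"
        unfolding p_def exp_of_nat_mult[symmetric] by (rule arg_cong[where f = exp]) simp
      thus ?thesis unfolding i power_mult_distrib by (simp only:)
    qed
    also have "itheta e (d + S *v e + (\<chi> i. S $ i $ i)) \<tau> ^ 2 = theta (dual u) \<tau> ^ 2"
      by (rule theta_square_eq_itheta[symmetric])
         (simp_all add: e_def d_def of_int_lift of_int_mult_lift lower_def upper_def add_ac)
    finally show ?thesis .
  qed
  thus "\<exists>\<kappa> p. \<kappa> ^ 8 = det (automorphy ?g \<tau>) ^ 8 \<and> (\<forall>a b c d. cube_prod p a b c d = 1) \<and>
      siegel_act ?g \<tau> \<in> siegel \<and> det (automorphy ?g \<tau>) \<noteq> 0 \<and>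
      (\<forall>u. theta (dual (bit_mat ?g *v u + ?t)) (siegel_act ?g \<tau>) ^ 2 = \<kappa> * p u * theta (dual u) \<tau> ^ 2)"
    unfolding act aut using p1 translation_siegel[OF S \<tau>]
    by (intro exI[of _ 1] exI[of _ p]) simp
qed

lemma unimodular_siegel:
  fixes A A' :: "int^'n^'n"
  assumes AA: "A ** A' = mat 1" and \<tau>: "\<tau> \<in> siegel"
  shows "complex_mat A ** \<tau> ** transpose (complex_mat A) \<in> siegel"
  unfolding siegel_iff
proof (intro conjI allI impI)
  show "transpose (complex_mat A ** \<tau> ** transpose (complex_mat A)) = complex_mat A ** \<tau> ** transpose (complex_mat A)"
    by (simp add: matrix_transpose_mul siegel_symmetric[OF \<tau>] matrix_mul_assoc)
  fix x :: "real^'n" assume x: "x \<noteq> 0"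
  define y :: "real^'n" where "y = (\<chi> j. \<Sum>i\<in>UNIV. of_int (A $ i $ j) * x $ i)"
  have yj: "(\<Sum>i\<in>UNIV. complex_mat A $ i $ j * complex_of_real (x $ i)) = of_real (y $ j)" for j
    by (simp add: y_def map_matrix_def)
  have "y \<noteq> 0"
  proof
    assume "y = 0"
    have "(\<Sum>j\<in>UNIV. of_int (A' $ j $ l) * y $ j) = x $ l" for l
    proof -
      have "(\<Sum>j\<in>UNIV. of_int (A' $ j $ l) * y $ j) = (\<Sum>i\<in>UNIV. of_int ((A ** A') $ i $ l) * x $ i)"
        unfolding y_def matrix_matrix_mult_def by (simp add: sum_distrib_left sum_distrib_right mult_ac) (rule sum.swap)
      thus ?thesis by (simp add: AA mat_def of_bool_def if_distrib[of "\<lambda>x. x * a" for a] if_distrib[of of_int] cong: if_cong)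
    qed
    hence "x = 0" using \<open>y = 0\<close> by (simp add: vec_eq_iff)
    with x show False by simp
  qed
  thus "0 < Im (qf (complex_mat A ** \<tau> ** transpose (complex_mat A)) (\<lambda>i. of_real (x $ i)))"
    unfolding qf_congruence yj using \<tau> by (simp add: siegel_iff)
qed

lemma of_int_det: "det (complex_mat M) = of_int (det M)"
  by (simp add: det_def map_matrix_def of_int_sum of_int_prod)

lemma theta_equivariant_unimodular:
  fixes A A' :: "int^'n^'n"
  assumes AA: "A ** A' = mat 1"
  shows "theta_equivariant (mat4 A 0 0 (transpose A')) 0"
proof (rule theta_equivariantI)
  let ?g = "mat4 A 0 0 (transpose A')"
  have A'A: "A' ** A = mat 1" using AA by (rule int_matrix_left_right_inverse)
  have z: "bit_mat 0 = (0 :: bit^'n^'n)" by (simp add: map_matrix_def vec_eq_iff)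
  have bt: "bit_mat (transpose M) = transpose (bit_mat M)" for M :: "int^'n^'n"
    by (simp add: map_matrix_def transpose_def vec_eq_iff)
  show "quad_shift ?g 0"
    unfolding quad_shift_def
  proof
    fix x :: "bit^('n + 'n)"
    have u: "upper (x v* bit_mat ?g) = upper x v* bit_mat A" "lower (x v* bit_mat ?g) = bit_mat A' *v lower x"
      unfolding upper_def[of "_ v* _"] lower_def[of "_ v* _"] vec_eq_iff vec_lambda_beta vec_mult_mat4
      by (simp_all add: z bt)
    have "quad (x v* bit_mat ?g) = dot (bit_mat A' *v lower x) (upper x v* bit_mat A)"
      unfolding quad_eq_dot u by (rule dot_commute)
    also have "\<dots> = dot (bit_mat A *v (bit_mat A' *v lower x)) (upper x)"
      by (simp only: dot_mult_left)
    also have "\<dots> = quad x"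
      by (simp add: matrix_vector_mul_assoc AA bit_mat_1 quad_eq_dot dot_commute flip: bit_mat_mult)
    finally show "quad (x v* bit_mat ?g) = quad x + dot 0 x" by (simp add: dot_def)
  qed
  fix \<tau> :: "complex^'n^'n" assume \<tau>: "\<tau> \<in> siegel"
  have aut: "automorphy ?g \<tau> = transpose (complex_mat A')"
    by (simp add: automorphy_mat4 complex_mat_0 complex_mat_transpose)
  have "det A * det A' = 1" using arg_cong[OF AA, of det] by (simp add: det_mul)
  hence "det A' = 1 \<or> det A' = -1" by (metis zmult_eq_1_iff)
  hence d: "det (automorphy ?g \<tau>) ^ 8 = 1" "det (automorphy ?g \<tau>) \<noteq> 0"
    unfolding aut det_transpose of_int_det by auto
  have act: "siegel_act ?g \<tau> = complex_mat A ** \<tau> ** transpose (complex_mat A)"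
  proof (rule siegel_act_eqI[OF d(2)])
    have "transpose (complex_mat A) ** transpose (complex_mat A') = mat 1"
      unfolding matrix_transpose_mul[symmetric] complex_mat_mult[symmetric] A'A complex_mat_1 by simp
    thus "complex_mat A ** \<tau> ** transpose (complex_mat A) ** automorphy ?g \<tau> = complex_mat (blockA ?g) ** \<tau> + complex_mat (blockB ?g)"
      unfolding aut by (simp add: complex_mat_0 flip: matrix_mul_assoc)
  qed
  have "theta (dual (bit_mat ?g *v u + 0)) (complex_mat A ** \<tau> ** transpose (complex_mat A)) ^ 2 = theta (dual u) \<tau> ^ 2" for u
  proof -
    define e where "e = transpose A' *v lift (lower u)"
    define d where "d = A *v lift (upper u)"
    have "theta (dual (bit_mat ?g *v u + 0)) (complex_mat A ** \<tau> ** transpose (complex_mat A)) ^ 2 = itheta e d (complex_mat A ** \<tau> ** transpose (complex_mat A)) ^ 2"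
      by (rule theta_square_eq_itheta)
         (simp_all only: mat4_mult_vec z e_def d_def of_int_mult_lift dual_nth add_0_right add_0_left matrix_vector_mult_0 zero_index)
    also have "\<dots> = itheta (transpose A *v e) (A' *v d) \<tau> ^ 2"
      by (simp only: itheta_unimodular[OF AA])
    also have "transpose A *v e = lift (lower u)"
      unfolding e_def matrix_vector_mul_assoc matrix_transpose_mul[symmetric] A'A by simp
    also have "A' *v d = lift (upper u)"
      unfolding d_def matrix_vector_mul_assoc A'A by simp
    also have "itheta (lift (lower u)) (lift (upper u)) \<tau> ^ 2 = theta (dual u) \<tau> ^ 2"
      by (rule theta_square_eq_itheta[symmetric]) (simp_all add: of_int_lift lower_def upper_def)
    finally show ?thesis .
  qed
  thus "\<exists>\<kappa> p. \<kappa> ^ 8 = det (automorphy ?g \<tau>) ^ 8 \<and> (\<forall>a b c d. cube_prod p a b c d = 1) \<and>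
      siegel_act ?g \<tau> \<in> siegel \<and> det (automorphy ?g \<tau>) \<noteq> 0 \<and>
      (\<forall>u. theta (dual (bit_mat ?g *v u + 0)) (siegel_act ?g \<tau>) ^ 2 = \<kappa> * p u * theta (dual u) \<tau> ^ 2)"
    unfolding act using unimodular_siegel[OF AA \<tau>] d
    by (intro exI[of _ 1] exI[of _ "\<lambda>_. 1"]) (simp add: cube_prod_const)
qed

lemma bit_mat_partial_inversion_mult_vec:
  "(bit_mat (partial_inversion k) *v u) $ Inl i = (if i = k then u $ Inr k else u $ Inl i)"
  "(bit_mat (partial_inversion k) *v u) $ Inr i = (if i = k then u $ Inl k else u $ Inr i)"
  by (auto simp: partial_inversion_def Let_def matrix_vector_mult_def map_matrix_def sum_UNIV_sum mat_def of_bool_def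
      if_distrib[of "\<lambda>x. x * a" for a] if_distrib[of of_int] ring_distribs sum.distrib cong: if_cong conj_cong)

lemma vec_mult_bit_mat_partial_inversion:
  "(u v* bit_mat (partial_inversion k)) $ Inl i = (if i = k then u $ Inr k else u $ Inl i)"
  "(u v* bit_mat (partial_inversion k)) $ Inr i = (if i = k then u $ Inl k else u $ Inr i)"
  by (auto simp: partial_inversion_def Let_def vector_matrix_mult_def map_matrix_def sum_UNIV_sum mat_def of_bool_def
      if_distrib[of "\<lambda>x. a * x" for a] if_distrib[of "\<lambda>x. x * a" for a] if_distrib[of of_int] ring_distribs sum.distrib cong: if_cong conj_cong)

lemma automorphy_partial_inversion_nth:
  "automorphy (partial_inversion k) \<tau> $ i $ j = (if i = k then \<tau> $ k $ j else of_bool (i = j))"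
  by (auto simp: partial_inversion_def Let_def automorphy_mat4 matrix_matrix_mult_def map_matrix_def mat_def of_bool_def
      if_distrib[of "\<lambda>x. x * a" for a] if_distrib[of of_int] cong: if_cong conj_cong)

text \<open>The automorphy matrix is the identity with its \<open>k\<close>-th row replaced by that
  of \<tau>, so its determinant is an instance of Cramer's rule.\<close>

lemma det_automorphy_partial_inversion:
  fixes \<tau> :: "complex^'n^'n"
  shows "det (automorphy (partial_inversion k) \<tau>) = \<tau> $ k $ k"
proof -
  have eq: "transpose (automorphy (partial_inversion k) \<tau>) = (\<chi> i j. if j = k then (mat 1 *v (\<tau> $ k)) $ i else mat 1 $ i $ j)"
    unfolding matrix_vector_mul_lid by (auto simp: vec_eq_iff transpose_def automorphy_partial_inversion_nth mat_def)
  have "det (automorphy (partial_inversion k) \<tau>) = det (transpose (automorphy (partial_inversion k) \<tau>))"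
    by (rule det_transpose[symmetric])
  also have "\<dots> = \<tau> $ k $ k * det (mat 1 :: complex^'n^'n)"
    unfolding eq by (rule cramer_lemma)
  finally show ?thesis by simp
qed

lemma siegel_act_partial_inversion:
  fixes \<tau> :: "complex^'n^'n"
  assumes \<tau>: "\<tau> \<in> siegel"
  shows "siegel_act (partial_inversion k) \<tau> = invert_at k \<tau>"
proof (rule siegel_act_eqI)
  have "Im (\<tau> $ k $ k) > 0" by (rule Im_siegel_diag_pos[OF \<tau>])
  hence t0: "\<tau> $ k $ k \<noteq> 0" by auto
  thus "det (automorphy (partial_inversion k) \<tau>) \<noteq> 0"
    by (simp add: det_automorphy_partial_inversion)
  show "invert_at k \<tau> ** automorphy (partial_inversion k) \<tau> =
    complex_mat (blockA (partial_inversion k)) ** \<tau> + complex_mat (blockB (partial_inversion k))"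
    unfolding vec_eq_iff
  proof (intro allI)
    fix i j
    have L: "(invert_at k \<tau> ** automorphy (partial_inversion k) \<tau>) $ i $ j = invert_at k \<tau> $ i $ k * \<tau> $ k $ j + (if j = k then 0 else invert_at k \<tau> $ i $ j)"
      by (simp add: matrix_matrix_mult_def automorphy_partial_inversion_nth sum.remove[of UNIV k] of_bool_def
          if_distrib[of "\<lambda>x. a * x" for a] cong: if_cong)
    have R: "(complex_mat (blockA (partial_inversion k)) ** \<tau> + complex_mat (blockB (partial_inversion k))) $ i $ j =
      (if i = k then (if j = k then - 1 else 0) else \<tau> $ i $ j)"
      by (cases "i = k") (auto simp: partial_inversion_def Let_def matrix_matrix_mult_def map_matrix_def mat_def of_bool_def
          if_distrib[of "\<lambda>x. x * a" for a] if_distrib[of of_int] left_diff_distrib sum_subtractf cong: if_cong conj_cong)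
    show "(invert_at k \<tau> ** automorphy (partial_inversion k) \<tau>) $ i $ j =
      (complex_mat (blockA (partial_inversion k)) ** \<tau> + complex_mat (blockB (partial_inversion k))) $ i $ j"
      unfolding L R using t0 by (auto simp: invert_at_def)
  qed
qed

lemma theta_equivariant_inversion:
  fixes k :: "'n::finite"
  shows "theta_equivariant (partial_inversion k) 0"
proof (rule theta_equivariantI)
  let ?g = "partial_inversion k"
  show "quad_shift ?g 0"
    unfolding quad_shift_def quad_def vec_mult_bit_mat_partial_inversion
    by (auto simp: dot_def mult.commute intro!: sum.cong)
  fix \<tau> :: "complex^'n^'n" assume \<tau>: "\<tau> \<in> siegel"
  have "Im (\<tau> $ k $ k) > 0" by (rule Im_siegel_diag_pos[OF \<tau>])
  hence t0: "\<tau> $ k $ k \<noteq> 0" by auto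
  \<comment> \<open>The squared phase is the sign attached to the product of the two
    \<open>k\<close>-th entries. Written as a fourth root of unity its exponent has a factor 2,
    which raises an even cube sum to a multiple of 4.\<close>
  define f :: "bit^('n + 'n) \<Rightarrow> int" where "f u = 2 * (of_bit (u $ Inl k) * of_bit (u $ Inr k))" for u :: "bit^('n + 'n)"
  define p where "p u = exp (- pi * \<i> / 2 * of_int (f u))" for u :: "bit^('n + 'n)"
  have "4 dvd cube_sum f a b c d" for a b c d
  proof -
    have "2 * 2 dvd 2 * cube_sum (\<lambda>u. of_bit (u $ Inl k) * of_bit (u $ Inr k)) a b c d"
      by (intro mult_dvd_mono dvd_refl cube_sum_bit_mult_even)
    thus ?thesis unfolding f_def cube_sum_cmult by simp
  qed
  hence p1: "cube_prod p a b c d = 1" for a b c d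
    unfolding p_def[abs_def] by (rule cube_prod_exp_eq_1)
  have "theta (dual (bit_mat ?g *v u + 0)) (invert_at k \<tau>) ^ 2 = (- \<i> * \<tau> $ k $ k) * p u * theta (dual u) \<tau> ^ 2" for u
  proof -
    define e :: "int^'n" where "e = (\<chi> i. if i = k then of_bit (u $ Inl k) else of_bit (u $ Inr i))"
    define d :: "int^'n" where "d = (\<chi> i. if i = k then of_bit (u $ Inr k) else of_bit (u $ Inl i))"
    define e' where "e' = (\<chi> i. if i = k then d $ k else e $ i)"
    define d' where "d' = (\<chi> i. if i = k then - e $ k else d $ i)"
    have b: "of_int (of_bit x) = x" for x :: bit by (cases x) simp_all
    have "theta (dual (bit_mat ?g *v u + 0)) (invert_at k \<tau>) ^ 2 = itheta e d (invert_at k \<tau>) ^ 2"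
      by (rule theta_square_eq_itheta)
         (simp_all only: add_0_right dual_nth bit_mat_partial_inversion_mult_vec e_def d_def vec_lambda_beta if_distrib[of of_int] b)
    also have "\<dots> = (- \<i> * \<tau> $ k $ k) * exp (pi * \<i> * of_int (e $ k * d $ k) / 2) ^ 2 * itheta e' d' \<tau> ^ 2"
      unfolding itheta_invert_at[OF \<tau>, of e d k] e'_def d'_def power_mult_distrib power2_csqrt ..
    also have "exp (pi * \<i> * of_int (e $ k * d $ k) / 2) ^ 2 = p u"
    proof -
      have "exp (pi * \<i> * of_int (e $ k * d $ k) / 2) ^ 2 = p u * exp (2 * (pi * \<i> * of_int (e $ k * d $ k)))"
        unfolding p_def f_def exp_of_nat_mult[symmetric] mult_exp_exp
        by (rule arg_cong[where f = exp]) (simp add: e_def d_def)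
      thus ?thesis unfolding exp_2pi_i_int by simp
    qed
    also have "itheta e' d' \<tau> ^ 2 = theta (dual u) \<tau> ^ 2"
      by (rule theta_square_eq_itheta[symmetric])
         (simp_all only: dual_nth e'_def d'_def e_def d_def vec_lambda_beta if_distrib[of of_int] b of_int_minus uminus_bit_def id_apply if_True, auto)
    finally show ?thesis .
  qed
  moreover have "(- \<i> * \<tau> $ k $ k) ^ 8 = det (automorphy ?g \<tau>) ^ 8"
  proof -
    have "(- \<i>) ^ 8 = ((- \<i>) ^ 2) ^ 4" by (simp only: power_mult[symmetric]) simp
    hence "(- \<i>) ^ 8 = 1" by simp
    thus ?thesis unfolding det_automorphy_partial_inversion power_mult_distrib by (simp only: mult_1)
  qed
  ultimately show "\<exists>\<kappa> p. \<kappa> ^ 8 = det (automorphy ?g \<tau>) ^ 8 \<and> (\<forall>a b c d. cube_prod p a b c d = 1) \<and>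
      siegel_act ?g \<tau> \<in> siegel \<and> det (automorphy ?g \<tau>) \<noteq> 0 \<and>
      (\<forall>u. theta (dual (bit_mat ?g *v u + 0)) (siegel_act ?g \<tau>) ^ 2 = \<kappa> * p u * theta (dual u) \<tau> ^ 2)"
    unfolding siegel_act_partial_inversion[OF \<tau>] using invert_at_siegel[OF \<tau>] p1 t0
    by (intro exI[of _ "- \<i> * \<tau> $ k $ k"] exI[of _ p]) (simp add: det_automorphy_partial_inversion)
qed

section \<open>Equivariance under the whole group and under \<open>Gamma12\<close>\<close>

theorem Sp_theta_equivariant:
  fixes \<gamma> :: "int^('n::finite + 'n)^('n + 'n)"
  assumes "\<gamma> \<in> Sp"
  shows "\<exists>t. theta_equivariant \<gamma> t"
  using assms unfolding Sp_eq_spgen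
proof (induction rule: spgen.induct)
  case (mult M N)
  thus ?case using theta_equivariant_mult by blast
qed (use theta_equivariant_translation theta_equivariant_unimodular theta_equivariant_inversion in blast)+

text \<open>At the unit vectors \<open>quad_shift\<close> says that \<open>t $ k\<close> is
  \<open>quad\<close> of the \<open>k\<close>-th row of \<gamma>. These values are the diagonal
  entries of the two products in the definition of \<open>Gamma12\<close>, modulo 2.\<close>

lemma Gamma12_theta_equivariant:
  fixes \<gamma> :: "int^('n::finite + 'n)^('n + 'n)"
  assumes \<gamma>: "\<gamma> \<in> Gamma12"
  shows "theta_equivariant \<gamma> 0"
proof -
  obtain t where t: "theta_equivariant \<gamma> t"
    using Sp_theta_equivariant[of \<gamma>] \<gamma> by (auto simp: Gamma12_def)
  hence q: "quad (x v* bit_mat \<gamma>) = quad x + dot t x" for x by (simp add: theta_equivariant_def quad_shift_def)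
  have "t $ k = quad (bit_mat \<gamma> $ k)" for k
  proof -
    have "axis k 1 v* bit_mat \<gamma> = bit_mat \<gamma> $ k"
      by (simp add: vector_matrix_mult_def vec_eq_iff axis_def of_bool_def if_distrib[of "\<lambda>x. a * x" for a]
          if_distrib[of "\<lambda>x. x * a" for a] cong: if_cong)
    moreover have "quad (axis k 1 :: bit^('n + 'n)) = 0"
      unfolding quad_def axis_def by (intro sum.neutral) auto
    moreover have "dot t (axis k 1) = t $ k"
      by (simp add: dot_def axis_def of_bool_def if_distrib[of "\<lambda>x. a * x" for a] cong: if_cong)
    ultimately show ?thesis using q[of "axis k 1"] by simp
  qed
  moreover have "quad (bit_mat \<gamma> $ k) = 0" for k
  proof -
    have "quad (bit_mat \<gamma> $ k) = of_int (\<Sum>i\<in>UNIV. \<gamma> $ k $ Inl i * \<gamma> $ k $ Inr i)"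
      by (simp add: quad_def map_matrix_def of_int_sum)
    moreover have "even (\<Sum>i\<in>UNIV. \<gamma> $ k $ Inl i * \<gamma> $ k $ Inr i)"
    proof (cases k)
      case (Inl i)
      have "even ((blockA \<gamma> ** transpose (blockB \<gamma>)) $ i $ i)" using \<gamma> by (simp add: Gamma12_def)
      thus ?thesis by (simp add: Inl matrix_matrix_mult_def transpose_def blockA_def blockB_def)
    next
      case (Inr i)
      have "even ((blockC \<gamma> ** transpose (blockD \<gamma>)) $ i $ i)" using \<gamma> by (simp add: Gamma12_def)
      thus ?thesis by (simp add: Inr matrix_matrix_mult_def transpose_def blockC_def blockD_def)
    qed
    ultimately show ?thesis by (simp add: of_int_bit)
  qed
  ultimately have "t = 0" by (simp add: vec_eq_iff)
  with t show ?thesis by simp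
qed

section \<open>Subgroups of characteristics and modularity\<close>

text \<open>A purely additive description of the \<open>i\<close>-dimensional subspaces over the
  field with two elements. It applies also to the product type of pairs of characteristics of genus
  1 and 2.\<close>

definition subgroups :: "nat \<Rightarrow> 'a::ab_group_add set set" where
  "subgroups i = {V. 0 \<in> V \<and> (\<forall>x\<in>V. \<forall>y\<in>V. x + y \<in> V) \<and> card V = 2 ^ i}"

lemma subspace_bit_iff: "vec.subspace V \<longleftrightarrow> 0 \<in> V \<and> (\<forall>x\<in>V. \<forall>y\<in>V. x + y \<in> V)" for V :: "(bit^'n) set"
proof -
  have "c *s x \<in> V" if "0 \<in> V" "x \<in> V" for c x using that by (cases c) simp_all
  thus ?thesis unfolding vec.subspace_def by blast
qed

lemma span_insert_bit: "vec.span (insert a S) = vec.span S \<union> (+) a ` vec.span S" for a :: "bit^'n"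
proof -
  have "(\<exists>k. x - k *s a \<in> vec.span S) \<longleftrightarrow> x \<in> vec.span S \<or> x - a \<in> vec.span S" for x
  proof
    assume "\<exists>k. x - k *s a \<in> vec.span S"
    then obtain k where "x - k *s a \<in> vec.span S" by blast
    thus "x \<in> vec.span S \<or> x - a \<in> vec.span S" by (cases k) simp_all
  next
    assume "x \<in> vec.span S \<or> x - a \<in> vec.span S"
    thus "\<exists>k. x - k *s a \<in> vec.span S"
    proof
      assume "x \<in> vec.span S" thus ?thesis by (intro exI[of _ 0]) simp
    next
      assume "x - a \<in> vec.span S" thus ?thesis by (intro exI[of _ 1]) simp
    qed
  qed
  moreover have "x - a \<in> vec.span S \<longleftrightarrow> x \<in> (+) a ` vec.span S" for x
    by (force simp: image_iff algebra_simps)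
  ultimately show ?thesis unfolding vec.span_insert by auto
qed

lemma span_insert_bit_disjoint:
  fixes a :: "bit^'n"
  assumes "a \<notin> vec.span S"
  shows "vec.span S \<inter> (+) a ` vec.span S = {}"
proof -
  have False if "x \<in> vec.span S" "a + x \<in> vec.span S" for x
  proof -
    have "(a + x) - x \<in> vec.span S" using that by (intro vec.span_diff)
    thus False using assms by simp
  qed
  thus ?thesis by blast
qed

lemma prod_span_insert_bit:
  fixes a :: "bit^'n" and f :: "bit^'n \<Rightarrow> complex"
  assumes "a \<notin> vec.span S"
  shows "prod f (vec.span (insert a S)) = prod f (vec.span S) * prod (\<lambda>v. f (a + v)) (vec.span S)"
  unfolding span_insert_bit using span_insert_bit_disjoint[OF assms]
  by (subst prod.union_disjoint) (auto simp: prod.reindex)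

lemma card_span_bit:
  fixes B :: "(bit^'n) set"
  assumes "finite B" "vec.independent B"
  shows "card (vec.span B) = 2 ^ card B"
  using assms
proof (induction B rule: finite_induct)
  case (insert a B)
  hence a: "a \<notin> vec.span B" and B: "vec.independent B" by (auto simp: vec.independent_insert)
  have "card (vec.span (insert a B)) = card (vec.span B) + card ((+) a ` vec.span B)"
    unfolding span_insert_bit using span_insert_bit_disjoint[OF a] by (intro card_Un_disjoint) auto
  also have "card ((+) a ` vec.span B) = card (vec.span B)" by (intro card_image) simp
  finally show ?case using insert B by simp
qed simp

text \<open>A subspace of dimension \<open>d\<close> has \<open>2 ^ d\<close> elements, so the
  cardinality determines the dimension.\<close>

lemma subspace_dim_iff: "{V. vec.subspace V \<and> vec.dim V = i} = (subgroups i :: (bit^'n) set set)"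
proof -
  have "card V = 2 ^ vec.dim V" if V: "vec.subspace V" for V :: "(bit^'n) set"
  proof -
    obtain B where B: "B \<subseteq> V" "vec.independent B" "V \<subseteq> vec.span B" "card B = vec.dim V"
      using vec.basis_exists by blast
    have "vec.span B = V" using B V by (meson subset_antisym vec.span_minimal)
    thus ?thesis using card_span_bit[of B] B by simp
  qed
  hence "vec.dim V = i \<longleftrightarrow> card V = 2 ^ i" if "vec.subspace V" for V :: "(bit^'n) set"
    using that by (simp only: power_inject_exp)
  thus ?thesis unfolding subgroups_def subspace_bit_iff[symmetric] conj_assoc[symmetric] by (intro Collect_cong conj_cong refl)
qed

lemma G_eq: "G i \<tau> = (\<Sum>V\<in>subgroups i. (\<Prod>v\<in>V. theta v \<tau>) ^ 2 ^ (4 - i))"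
  unfolding G_def theta_prod_def subspace_dim_iff ..

text \<open>Subspaces of dimension less than 3 are degenerate cubes, in which every point is hit equally often.\<close>

lemma subgroup_cube:
  fixes V :: "(bit^'n) set"
  assumes "V \<in> subgroups i" "i \<le> 3"
  obtains b c d where "\<And>f. (\<Prod>v\<in>V. f v) ^ 2 ^ (3 - i) = cube_prod f 0 b c d"
proof -
  have V: "vec.subspace V" "vec.dim V = i" using assms(1) subspace_dim_iff[of i] by auto
  obtain B where B: "B \<subseteq> V" "vec.independent B" "V \<subseteq> vec.span B" "card B = i"
    using vec.basis_exists V(2) by blast
  have sV: "vec.span B = V" using B V by (meson subset_antisym vec.span_minimal)
  consider "i = 0" | "i = 1" | "i = 2" | "i = 3" using assms(2) by linarith
  thus ?thesis
  proof cases
    case 1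
    hence "B = {}" using B by simp
    hence "V = {0}" using sV by simp
    thus ?thesis using that[of 0 0 0] 1 by (simp add: cube_prod_def power_numeral_reduce)
  next
    case 2
    then obtain x where x: "B = {x}" using B(4) card_1_singletonE by auto
    have "x \<notin> vec.span {}" using B(2) unfolding x vec.independent_insert by auto
    hence "(\<Prod>v\<in>V. f v) = f 0 * f x" for f :: "bit^'n \<Rightarrow> complex"
      unfolding sV[symmetric] x by (subst prod_span_insert_bit) auto
    thus ?thesis using that[of x 0 0] 2 by (simp add: cube_prod_def power_numeral_reduce mult_ac)
  next
    case 3
    then obtain x y where x: "B = {x, y}" "x \<noteq> y" using B(4) by (metis card_2_iff)
    have "x \<notin> vec.span {y}" "y \<notin> vec.span {}" using B(2) x(2) unfolding x(1) vec.independent_insert by auto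
    hence "(\<Prod>v\<in>V. f v) = f 0 * f y * (f x * f (x + y))" for f :: "bit^'n \<Rightarrow> complex"
      unfolding sV[symmetric] x(1) by (subst prod_span_insert_bit, simp)+ simp
    thus ?thesis using that[of x y 0] 3 by (simp add: cube_prod_def power_numeral_reduce mult_ac)
  next
    case 4
    then obtain x y z where x: "B = {x, y, z}" "x \<noteq> y" "x \<noteq> z" "y \<noteq> z" using B(4) by (metis card_3_iff)
    have "x \<notin> vec.span {y, z}" "y \<notin> vec.span {z}" "z \<notin> vec.span {}"
      using B(2) x(2-4) unfolding x(1) vec.independent_insert by auto
    hence "(\<Prod>v\<in>V. f v) = f 0 * f z * (f y * f (y + z)) * (f x * f (x + z) * (f (x + y) * f (x + (y + z))))" for f :: "bit^'n \<Rightarrow> complex"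
      unfolding sV[symmetric] x(1) by (subst prod_span_insert_bit, simp)+ simp
    thus ?thesis using that[of x y z] 4 by (simp add: cube_prod_def mult_ac add_ac)
  qed
qed

section \<open>Permutation of the subgroups and modularity\<close>

lemma subgroups_image:
  assumes "V \<in> subgroups i" "inj_on h V" "h 0 = 0" "\<And>x y. h (x + y) = h x + h y"
  shows "h ` V \<in> subgroups i"
proof -
  have "h x + h y \<in> h ` V" if "x \<in> V" "y \<in> V" for x y
    using that assms(1) unfolding subgroups_def assms(4)[symmetric] by blast
  moreover have "0 \<in> h ` V" using assms(1,3) unfolding subgroups_def by force
  ultimately show ?thesis using assms(1) card_image[OF assms(2)] by (auto simp: subgroups_def)
qed

lemma sum_subgroups_reindex:
  fixes h :: "'a::ab_group_add \<Rightarrow> 'b::ab_group_add" and F :: "'b set \<Rightarrow> complex"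
  assumes "\<And>x. h' (h x) = x" "\<And>y. h (h' y) = y" "\<And>x y. h (x + y) = h x + h y"
  shows "(\<Sum>V\<in>subgroups i. F V) = (\<Sum>V\<in>subgroups i. F (h ` V))"
proof -
  have h0: "h 0 = 0" using assms(3)[of 0 0] by simp
  have h': "h' (x + y) = h' x + h' y" for x y using assms by metis
  have h'0: "h' 0 = 0" using h'[of 0 0] by simp
  have inj: "inj_on h V" "inj_on h' W" for V W using assms(1,2) by (metis inj_on_inverseI)+
  show ?thesis
  proof (rule sum.reindex_bij_witness[of _ "\<lambda>V. h ` V" "\<lambda>V. h' ` V"])
    show "h ` h' ` V = V" for V by (simp add: image_image assms(2))
    show "h' ` h ` V = V" for V by (simp add: image_image assms(1))
    show "h' ` V \<in> subgroups i" if "V \<in> subgroups i" for V by (rule subgroups_image[OF that inj(2) h'0 h'])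
    show "h ` V \<in> subgroups i" if "V \<in> subgroups i" for V by (rule subgroups_image[OF that inj(1) h0 assms(3)])
    show "F (h ` h' ` V) = F V" for V by (simp add: image_image assms(2))
  qed
qed

text \<open>For \<open>Gamma12\<close> the affine action \<open>h\<close> on characteristics is
  linear, and it is bijective because \<gamma> has an integral inverse. It thus permutes the
  subgroups of each order, and each summand is multiplied by the same eighth power of the
  determinant.\<close>

lemma G_modular:
  fixes \<gamma> :: "int^('n::finite + 'n)^('n + 'n)"
  assumes \<gamma>: "\<gamma> \<in> Gamma12" and \<tau>: "\<tau> \<in> siegel" and i: "i \<le> 3"
  shows "G i (siegel_act \<gamma> \<tau>) = det (automorphy \<gamma> \<tau>) ^ 8 * G i \<tau>"
proof -
  let ?\<tau> = "siegel_act \<gamma> \<tau>"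
  have eq: "cube_prod (\<lambda>u. theta (dual (bit_mat \<gamma> *v u)) ?\<tau> ^ 2) a b c d = det (automorphy \<gamma> \<tau>) ^ 8 * cube_prod (\<lambda>u. theta (dual u) \<tau> ^ 2) a b c d" for a b c d
    using Gamma12_theta_equivariant[OF \<gamma>] \<tau> by (simp add: theta_equivariant_def)
  define h where "h v = dual (bit_mat \<gamma> *v dual v)" for v
  have hadd: "h (x + y) = h x + h y" for x y
    by (simp add: h_def dual_add matrix_vector_right_distrib)
  have "\<gamma> \<in> spgen" using \<gamma> Sp_eq_spgen by (auto simp: Gamma12_def)
  then obtain \<gamma>' where \<gamma>': "\<gamma> ** \<gamma>' = mat 1" "\<gamma>' ** \<gamma> = mat 1" using spgen_inverse by blast
  define h' where "h' v = dual (bit_mat \<gamma>' *v dual v)" for v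
  have inv: "h' (h v) = v" "h (h' v) = v" for v
    by (simp_all add: h_def h'_def matrix_vector_mul_assoc \<gamma>' bit_mat_1 flip: bit_mat_mult)
  \<comment> \<open>One factor 2 of the exponent squares the theta constants; the remaining power
    fills the cube of \<open>subgroup_cube\<close>. This is where the bound on \<open>i\<close>
    enters.\<close>
  have e: "x ^ 2 ^ (4 - i) = (x ^ 2) ^ 2 ^ (3 - i)" for x :: complex
  proof -
    have "(2::nat) ^ (4 - i) = 2 * 2 ^ (3 - i)" using i by (simp add: Suc_diff_le flip: power_Suc)
    thus ?thesis by (simp add: power_mult)
  qed
  have "(\<Prod>v\<in>h ` V. theta v ?\<tau>) ^ 2 ^ (4 - i) = det (automorphy \<gamma> \<tau>) ^ 8 * (\<Prod>v\<in>V. theta v \<tau>) ^ 2 ^ (4 - i)"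
    if V: "V \<in> subgroups i" for V
  proof -
    obtain b c d where cube: "\<And>f. (\<Prod>v\<in>V. f v) ^ 2 ^ (3 - i) = cube_prod f 0 b c d"
      using subgroup_cube[OF V i] by blast
    have inj: "inj_on h V" using inv by (metis inj_on_inverseI)
    have dualcube: "cube_prod (\<lambda>v. f (dual v)) 0 b c d = cube_prod f 0 (dual b) (dual c) (dual d)" for f
      by (simp add: cube_prod_def dual_add)
    have "(\<Prod>v\<in>h ` V. theta v ?\<tau>) ^ 2 ^ (4 - i) = (\<Prod>v\<in>V. theta (h v) ?\<tau> ^ 2) ^ 2 ^ (3 - i)"
      unfolding e prod.reindex[OF inj] by (simp add: prod_power_distrib)
    also have "\<dots> = cube_prod (\<lambda>v. theta (dual (bit_mat \<gamma> *v dual v)) ?\<tau> ^ 2) 0 b c d"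
      unfolding cube h_def ..
    also have "\<dots> = det (automorphy \<gamma> \<tau>) ^ 8 * cube_prod (\<lambda>u. theta (dual u) \<tau> ^ 2) 0 (dual b) (dual c) (dual d)"
      using dualcube[of "\<lambda>u. theta (dual (bit_mat \<gamma> *v u)) ?\<tau> ^ 2"] eq by simp
    also have "cube_prod (\<lambda>u. theta (dual u) \<tau> ^ 2) 0 (dual b) (dual c) (dual d) = cube_prod (\<lambda>v. theta v \<tau> ^ 2) 0 b c d"
      using dualcube[of "\<lambda>u. theta (dual u) \<tau> ^ 2"] by simp
    also have "\<dots> = (\<Prod>v\<in>V. theta v \<tau>) ^ 2 ^ (4 - i)"
      unfolding cube[symmetric] e by (simp add: prod_power_distrib)
    finally show ?thesis .
  qed
  hence "(\<Sum>V\<in>subgroups i. (\<Prod>v\<in>h ` V. theta v ?\<tau>) ^ 2 ^ (4 - i)) = det (automorphy \<gamma> \<tau>) ^ 8 * G i \<tau>"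
    unfolding G_eq sum_distrib_left by (intro sum.cong) auto
  moreover have "G i ?\<tau> = (\<Sum>V\<in>subgroups i. (\<Prod>v\<in>h ` V. theta v ?\<tau>) ^ 2 ^ (4 - i))"
    unfolding G_eq by (rule sum_subgroups_reindex[of h' h]) (use inv hadd in auto)
  ultimately show ?thesis by simp
qed

theorem Xi3_modular: "modular_form 8 Gamma12 Xi3"
  unfolding modular_form_def
proof (intro conjI ballI)
  have Xi3: "Xi3 = (\<lambda>\<tau>. 1/8 * (G 0 \<tau> + ((-1) * G 1 \<tau> + (2 * G 2 \<tau> + (-8) * G 3 \<tau>))))"
    by (simp add: fun_eq_iff Xi3_def)
  show "holomorphic_on_siegel Xi3"
    by (subst Xi3) (intro holomorphic_on_siegel_add holomorphic_on_siegel_mult holomorphic_on_siegel_const holomorphic_on_siegel_G)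
  fix \<gamma> :: "int^(3 + 3)^(3 + 3)" and \<tau> :: "complex^3^3"
  assume "\<gamma> \<in> Gamma12" "\<tau> \<in> siegel"
  thus "Xi3 (siegel_act \<gamma> \<tau>) = det (automorphy \<gamma> \<tau>) powi 8 * Xi3 \<tau>"
    by (simp add: Xi3_def G_modular algebra_simps)
qed

section \<open>Factorization\<close>

text \<open>The substitution \<open>n \<mapsto> - n - e\<close> negates the lattice points. It
  preserves the quadratic part and changes each term by the sign attached to the sum of
  \<open>e $ i * d $ i\<close>, which is odd here.\<close>

lemma theta_odd_eq_0:
  assumes "quad v = 1"
  shows "theta v \<tau> = 0"
proof -
  define e where "e = lift (upper v)"
  define d where "d = lift (lower v)"
  have th: "theta v \<tau> = itheta e d \<tau>"
    unfolding theta_eq_itheta by (simp add: e_def d_def lift_def upper_def lower_def)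
  have "of_int (\<Sum>i\<in>UNIV. e $ i * d $ i) = quad v"
    by (simp add: quad_def e_def d_def of_int_sum of_int_lift upper_def lower_def)
  hence "odd (\<Sum>i\<in>UNIV. e $ i * d $ i)" using assms by (simp add: of_int_bit split: if_splits)
  then obtain k where k: "(\<Sum>i\<in>UNIV. e $ i * d $ i) = 2 * k + 1" by (elim oddE)
  have "theta_term e d \<tau> (- n - e) = - theta_term e d \<tau> n" for n
  proof -
    have l: "lattice_point e (- n - e) = (\<lambda>i. - lattice_point e n i)"
      by (simp add: lattice_point_def fun_eq_iff)
    define s where "s = (\<Sum>i\<in>UNIV. complex_of_real (lattice_point e n i) * of_int (d $ i))"
    define m where "m = (\<Sum>i\<in>UNIV. n $ i * d $ i)"
    have "2 * s = (\<Sum>i\<in>UNIV. of_int (2 * (n $ i * d $ i) + e $ i * d $ i))"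
      unfolding s_def sum_distrib_left by (intro sum.cong refl) (simp add: lattice_point_def field_simps)
    also have "\<dots> = of_int (2 * m + (2 * k + 1))"
      unfolding of_int_sum[symmetric] sum.distrib sum_distrib_left[symmetric] k m_def ..
    finally have s: "- s = s + - of_int (2 * (m + k) + 1)" by (simp add: algebra_simps)
    have q: "qf \<tau> (\<lambda>i. of_real (- lattice_point e n i)) = qf \<tau> (\<lambda>i. of_real (lattice_point e n i))"
      by (simp add: qf_def)
    have "theta_term e d \<tau> (- n - e) = exp (pi * \<i> * (qf \<tau> (\<lambda>i. of_real (lattice_point e n i)) + - s))"
      unfolding theta_term_def l q s_def by (simp add: sum_negf)
    also have "\<dots> = theta_term e d \<tau> n * (exp (2 * (pi * \<i> * of_int (- (m + k)))) * exp (- (pi * \<i>)))"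
      unfolding theta_term_def s_def[symmetric] s mult_exp_exp by (rule arg_cong[where f = exp]) (simp add: algebra_simps)
    also have "\<dots> = - theta_term e d \<tau> n"
      unfolding exp_2pi_i_int by (simp add: exp_minus)
    finally show ?thesis .
  qed
  hence "itheta e d \<tau> = (\<Sum>\<^sub>\<infinity>n. - theta_term e d \<tau> n)"
    unfolding itheta_def
    by (intro infsum_reindex_bij_witness[of _ "\<lambda>n. - n - e" "\<lambda>n. - n - e"]) (auto simp flip: minus_equation_iff)
  also have "\<dots> = - itheta e d \<tau>" unfolding itheta_def by (rule infsum_uminus)
  finally show ?thesis unfolding th by simp
qed

section \<open>Theta constants at block-diagonal matrices\<close>

lemma summable_on_product_complex:
  fixes f :: "'a \<Rightarrow> complex" and h :: "'b \<Rightarrow> complex"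
  assumes "(\<lambda>x. norm (f x)) summable_on A" "(\<lambda>y. norm (h y)) summable_on B"
  shows "(\<lambda>(x, y). f x * h y) summable_on A \<times> B"
proof -
  have "(\<lambda>p. norm (case p of (x, y) \<Rightarrow> f x * h y)) summable_on A \<times> B"
  proof (rule summable_on_SigmaI)
    fix x assume "x \<in> A"
    have "((\<lambda>y. norm (f x) * norm (h y)) has_sum norm (f x) * (\<Sum>\<^sub>\<infinity>y\<in>B. norm (h y))) B"
      by (rule has_sum_cmult_right[OF has_sum_infsum[OF assms(2)]])
    thus "((\<lambda>y. norm (case (x, y) of (x, y) \<Rightarrow> f x * h y)) has_sum norm (f x) * (\<Sum>\<^sub>\<infinity>y\<in>B. norm (h y))) B"
      by (simp add: norm_mult)
  next
    show "(\<lambda>x. norm (f x) * (\<Sum>\<^sub>\<infinity>y\<in>B. norm (h y))) summable_on A"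
      by (rule summable_on_cmult_left[OF assms(1)])
  qed auto
  thus ?thesis by (rule abs_summable_summable)
qed

lemma infsum_product_complex:
  fixes f :: "'a \<Rightarrow> complex" and h :: "'b \<Rightarrow> complex"
  assumes "(\<lambda>x. norm (f x)) summable_on A" "(\<lambda>y. norm (h y)) summable_on B"
  shows "(\<Sum>\<^sub>\<infinity>(x, y)\<in>A \<times> B. f x * h y) = infsum f A * infsum h B"
proof -
  have "(\<Sum>\<^sub>\<infinity>(x, y)\<in>A \<times> B. f x * h y) = (\<Sum>\<^sub>\<infinity>x\<in>A. \<Sum>\<^sub>\<infinity>y\<in>B. f x * h y)"
    using infsum_Sigma'_banach[OF summable_on_product_complex[OF assms]] by simp
  thus ?thesis by (simp only: infsum_cmult_right' infsum_cmult_left')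
qed

definition join3 :: "'a^1 \<Rightarrow> 'a^2 \<Rightarrow> 'a^3" where
  "join3 x y = (\<chi> i. if i = 1 then x $ 1 else if i = 2 then y $ 1 else y $ 2)"

lemma join3_nth [simp]: "join3 x y $ 1 = x $ 1" "join3 x y $ 2 = y $ 1" "join3 x y $ 3 = y $ 2"
  by (simp_all add: join3_def)

definition join_char :: "(bit^(1 + 1)) \<times> (bit^(2 + 2)) \<Rightarrow> bit^(3 + 3)" where
  "join_char = (\<lambda>(p, w). \<chi> k. case k of Inl i \<Rightarrow> join3 (upper p) (upper w) $ i | Inr i \<Rightarrow> join3 (lower p) (lower w) $ i)"

lemma theta_diag12:
  assumes "\<tau>\<^sub>1 \<in> siegel" "\<tau>\<^sub>2 \<in> siegel"
  shows "theta (join_char (p, w)) (diag12 \<tau>\<^sub>1 \<tau>\<^sub>2) = theta p \<tau>\<^sub>1 * theta w \<tau>\<^sub>2"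
proof -
  define e1 d1 e2 d2 where "e1 = lift (upper p)" and "d1 = lift (lower p)" and "e2 = lift (upper w)" and "d2 = lift (lower w)"
  have th: "theta p \<tau>\<^sub>1 = itheta e1 d1 \<tau>\<^sub>1" "theta w \<tau>\<^sub>2 = itheta e2 d2 \<tau>\<^sub>2"
    unfolding theta_eq_itheta by (simp_all add: e1_def d1_def e2_def d2_def lift_def upper_def lower_def)
  have j: "(\<chi> i. of_bit (join3 x y $ i)) = join3 (lift x) (lift y)" for x y
    unfolding vec_eq_iff forall_3 by (simp add: lift_def)
  have th3: "theta (join_char (p, w)) \<tau> = itheta (join3 e1 e2) (join3 d1 d2) \<tau>" for \<tau>
    unfolding theta_eq_itheta join_char_def e1_def d1_def e2_def d2_def j[symmetric] by simp
  have split: "theta_term (join3 e1 e2) (join3 d1 d2) (diag12 \<tau>\<^sub>1 \<tau>\<^sub>2) (join3 m n) = theta_term e1 d1 \<tau>\<^sub>1 m * theta_term e2 d2 \<tau>\<^sub>2 n" for m n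
    unfolding theta_term_def mult_exp_exp qf_def sum_3 sum_2 sum_1 diag12_def lattice_point_def
    by (rule arg_cong[where f = exp]) (simp add: algebra_simps)
  have "(\<Sum>\<^sub>\<infinity>(m, n)\<in>UNIV \<times> UNIV. theta_term e1 d1 \<tau>\<^sub>1 m * theta_term e2 d2 \<tau>\<^sub>2 n) = itheta (join3 e1 e2) (join3 d1 d2) (diag12 \<tau>\<^sub>1 \<tau>\<^sub>2)"
    unfolding itheta_def
    by (rule infsum_reindex_bij_witness[of _ "\<lambda>n. (\<chi> i. n $ 1, \<chi> i. if i = 1 then n $ 2 else n $ 3)" "\<lambda>(m, n). join3 m n"])
       (auto simp: split vec_eq_iff forall_3 forall_2 forall_1)
  thus ?thesis unfolding th th3 itheta_def
    using infsum_product_complex[OF abs_summable_theta_term[OF assms(1)] abs_summable_theta_term[OF assms(2)]] by simp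
qed

subsection \<open>Jacobi's identity\<close>

text \<open>\<open>theta1 0\<close>, \<open>theta1_alt\<close> and \<open>theta1 1\<close> are the
  three even theta constants of genus 1 as series over the integers; \<open>theta_genus1\<close>
  makes the identification.\<close>

definition theta1 :: "complex \<Rightarrow> complex \<Rightarrow> complex" where
  "theta1 a t = (\<Sum>\<^sub>\<infinity>m::int. exp (pi * \<i> * t * (of_int m + a / 2) ^ 2))"

definition theta1_alt :: "complex \<Rightarrow> complex" where
  "theta1_alt t = (\<Sum>\<^sub>\<infinity>m::int. (if even m then 1 else - 1) * exp (pi * \<i> * t * of_int m ^ 2))"

lemma abs_summable_theta1:
  fixes a :: real
  assumes "Im t > 0"
  shows "(\<lambda>m::int. norm (exp (pi * \<i> * t * (of_int m + of_real a / 2) ^ 2))) summable_on UNIV"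
proof (rule summable_on_comparison_test)
  show "(\<lambda>m::int. exp (- (pi * Im t) * of_int m ^ 2 + (pi * Im t * \<bar>a\<bar>) * \<bar>of_int m\<bar>)) summable_on UNIV"
    using assms by (intro summable_on_gaussian_int) simp
  fix m :: int
  define x where "x = of_int m + a / 2"
  have "complex_of_int m + of_real a / 2 = of_real x" by (simp add: x_def)
  hence n: "norm (exp (pi * \<i> * t * (of_int m + of_real a / 2) ^ 2)) = exp (- (pi * Im t) * x ^ 2)"
    by (simp add: flip: of_real_power)
  have x2: "of_int m ^ 2 - \<bar>a\<bar> * \<bar>of_int m\<bar> \<le> x ^ 2"
  proof -
    have le: "- (\<bar>a\<bar> * \<bar>of_int m\<bar>) \<le> a * of_int m" by (metis abs_ge_minus_self abs_mult minus_le_iff)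
    have "2 * of_int m * (a / 2) = a * of_int m" "0 \<le> (a / 2) ^ 2" by simp_all
    with le show ?thesis unfolding x_def power2_sum by linarith
  qed
  from x2 have "(pi * Im t) * (of_int m ^ 2 - \<bar>a\<bar> * \<bar>of_int m\<bar>) \<le> (pi * Im t) * x ^ 2"
    using assms by (intro mult_left_mono) auto
  hence "exp (- (pi * Im t) * x ^ 2) \<le> exp (- (pi * Im t) * of_int m ^ 2 + (pi * Im t * \<bar>a\<bar>) * \<bar>of_int m\<bar>)"
    by (simp add: algebra_simps)
  thus "norm (exp (pi * \<i> * t * (of_int m + of_real a / 2) ^ 2)) \<le> exp (- (pi * Im t) * of_int m ^ 2 + (pi * Im t * \<bar>a\<bar>) * \<bar>of_int m\<bar>)"
    unfolding n .
qed simp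

lemma infsum_even_odd:
  fixes F :: "int \<times> int \<Rightarrow> complex"
  assumes "F summable_on UNIV"
  shows "infsum F {p. even (fst p + snd p)} + infsum F {p. odd (fst p + snd p)} = infsum F UNIV"
proof -
  have "infsum F ({p. even (fst p + snd p)} \<union> {p. odd (fst p + snd p)}) = infsum F {p. even (fst p + snd p)} + infsum F {p. odd (fst p + snd p)}"
    by (rule infsum_Un_disjoint) (auto intro: summable_on_subset_banach[OF assms])
  moreover have "{p. even (fst p + snd p)} \<union> {p::int\<times>int. odd (fst p + snd p)} = UNIV" by auto
  ultimately show ?thesis by simp
qed

lemma infsum_even_reindex:
  fixes F :: "int \<times> int \<Rightarrow> complex"
  shows "infsum F {p. even (fst p + snd p)} = (\<Sum>\<^sub>\<infinity>(x, y)\<in>UNIV \<times> UNIV. F (x + y, x - y))"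
proof -
  have e: "even (m + n) \<Longrightarrow> (m + n) div 2 + (m - n) div 2 = m"
    "even (m + n) \<Longrightarrow> (m + n) div 2 - (m - n) div 2 = n" for m n :: int
    by presburger+
  show ?thesis
    by (rule infsum_reindex_bij_witness[of _ "\<lambda>(x, y). (x + y, x - y)" "\<lambda>(m, n). ((m + n) div 2, (m - n) div 2)"])
       (fastforce simp: e | (auto simp: e simp del: even_add even_diff)[1]; presburger)+
qed

text \<open>Two parametrizations of the odd coset. For integral summation variables the first makes
  both new variables half-integral; for half-integral ones the second makes exactly one of them
  half-integral.\<close>

lemma infsum_odd_reindex:
  fixes F :: "int \<times> int \<Rightarrow> complex"
  shows "infsum F {p. odd (fst p + snd p)} = (\<Sum>\<^sub>\<infinity>(x, y)\<in>UNIV \<times> UNIV. F (x + y + 1, x - y))"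
    and "infsum F {p. odd (fst p + snd p)} = (\<Sum>\<^sub>\<infinity>(x, y)\<in>UNIV \<times> UNIV. F (x + y, x - y - 1))"
proof -
  have e: "odd (m + n) \<Longrightarrow> (m + n - 1) div 2 + (m - n - 1) div 2 + 1 = m"
    "odd (m + n) \<Longrightarrow> (m + n - 1) div 2 - (m - n - 1) div 2 = n"
    "odd (m + n) \<Longrightarrow> (m + n + 1) div 2 + (m - n - 1) div 2 = m"
    "odd (m + n) \<Longrightarrow> (m + n + 1) div 2 - (m - n - 1) div 2 - 1 = n" for m n :: int
    by presburger+
  show "infsum F {p. odd (fst p + snd p)} = (\<Sum>\<^sub>\<infinity>(x, y)\<in>UNIV \<times> UNIV. F (x + y + 1, x - y))"
    by (rule infsum_reindex_bij_witness[of _ "\<lambda>(x, y). (x + y + 1, x - y)" "\<lambda>(m, n). ((m + n - 1) div 2, (m - n - 1) div 2)"])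
       (fastforce simp: e | (auto simp: e simp del: even_add even_diff)[1]; presburger)+
  show "infsum F {p. odd (fst p + snd p)} = (\<Sum>\<^sub>\<infinity>(x, y)\<in>UNIV \<times> UNIV. F (x + y, x - y - 1))"
  proof (rule infsum_reindex_bij_witness[of _ "\<lambda>(x, y). (x + y, x - y - 1)" "\<lambda>(m, n). ((m + n + 1) div 2, (m - n - 1) div 2)"])
    fix p :: "int \<times> int" assume p: "p \<in> {p. odd (fst p + snd p)}"
    obtain m n where mn: "p = (m, n)" by (cases p)
    have mn': "odd (m + n)" using p by (simp only: mn mem_Collect_eq fst_conv snd_conv not_False_eq_True)
    show "(case case p of (m, n) \<Rightarrow> ((m + n + 1) div 2, (m - n - 1) div 2) of (x, y) \<Rightarrow> (x + y, x - y - 1)) = p"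
      "(case case p of (m, n) \<Rightarrow> ((m + n + 1) div 2, (m - n - 1) div 2) of (x, y) \<Rightarrow> F (x + y, x - y - 1)) = F p"
      unfolding mn prod.case e(3,4)[OF mn'] by simp_all
  next
    fix p :: "int \<times> int"
    obtain x y where xy: "p = (x, y)" by (cases p)
    have "x + y + (x - y - 1) = 2 * (x - 1) + 1" by simp
    hence "odd (x + y + (x - y - 1))" by presburger
    thus "(case p of (x, y) \<Rightarrow> (x + y, x - y - 1)) \<in> {p. odd (fst p + snd p)}"
      unfolding xy prod.case mem_Collect_eq fst_conv snd_conv .
  qed auto
qed

text \<open>The substitution \<open>m = x + y\<close>, \<open>n = x - y\<close> doubles the modulus,
  since \<open>m ^ 2 + n ^ 2 = 2 * (x ^ 2 + y ^ 2)\<close>. With \<open>a = theta1 0 (2 * t)\<close>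
  and \<open>b = theta1 1 (2 * t)\<close>, the squares of \<open>theta1 0 t\<close>,
  \<open>theta1_alt t\<close> and \<open>theta1 1 t\<close> are \<open>a ^ 2 + b ^ 2\<close>,
  \<open>a ^ 2 - b ^ 2\<close> and \<open>2 * a * b\<close>, a Pythagorean triple.\<close>

lemma Jacobi_identity:
  assumes t: "Im t > 0"
  shows "theta1 0 t ^ 4 = theta1_alt t ^ 4 + theta1 1 t ^ 4"
proof -
  have t2: "Im (2 * t) > 0" using t by simp
  define f where "f a s m = exp (pi * \<i> * s * (of_int m + a / 2) ^ 2)" for a s and m :: int
  define alt where "alt m = (if even m then 1 else - 1 :: complex)" for m :: int
  have th: "theta1 a s = infsum (f a s) UNIV" for a s by (simp add: theta1_def f_def[abs_def])
  have tha: "theta1_alt t = infsum (\<lambda>m. alt m * f 0 t m) UNIV" by (simp add: theta1_alt_def f_def alt_def)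
  have s: "(\<lambda>m. norm (f 0 s m)) summable_on UNIV" "(\<lambda>m. norm (f 1 s m)) summable_on UNIV" if "Im s > 0" for s
    unfolding f_def using abs_summable_theta1[OF that, of 0] abs_summable_theta1[OF that, of 1] by simp_all
  have sa: "(\<lambda>m. norm (alt m * f 0 t m)) summable_on UNIV"
    using s(1)[OF t] by (rule summable_on_cong[THEN iffD1, rotated]) (simp add: alt_def norm_mult)
  define F where "F = (\<lambda>(m, n). f 0 t m * f 0 t n)"
  define H where "H = (\<lambda>(m, n). f 1 t m * f 1 t n)"
  have sF: "F summable_on UNIV" unfolding F_def using summable_on_product_complex[OF s(1)[OF t] s(1)[OF t]] by simp
  have sH: "H summable_on UNIV" unfolding H_def using summable_on_product_complex[OF s(2)[OF t] s(2)[OF t]] by simp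
  define E where "E = {p :: int \<times> int. even (fst p + snd p)}"
  define D where "D = {p :: int \<times> int. odd (fst p + snd p)}"
  have sFE: "F summable_on E" "F summable_on D" by (rule summable_on_subset_banach[OF sF]; simp)+
  have A: "theta1 0 t ^ 2 = infsum F E + infsum F D"
  proof -
    have "theta1 0 t ^ 2 = infsum F UNIV"
      unfolding F_def th power2_eq_square using infsum_product_complex[OF s(1)[OF t] s(1)[OF t]] by simp
    thus ?thesis unfolding E_def D_def infsum_even_odd[OF sF] .
  qed
  have B: "theta1_alt t ^ 2 = infsum F E - infsum F D"
  proof -
    define F' where "F' = (\<lambda>(m, n). (alt m * f 0 t m) * (alt n * f 0 t n))"
    have sF': "F' summable_on UNIV" unfolding F'_def using summable_on_product_complex[OF sa sa] by simp
    have "theta1_alt t ^ 2 = infsum F' UNIV"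
      unfolding F'_def tha power2_eq_square using infsum_product_complex[OF sa sa] by simp
    also have "\<dots> = infsum F' E + infsum F' D"
      unfolding E_def D_def infsum_even_odd[OF sF'] ..
    also have "infsum F' E = infsum F E"
      by (rule infsum_cong) (auto simp: F'_def F_def E_def alt_def)
    also have "infsum F' D = infsum (\<lambda>p. - F p) D"
      by (rule infsum_cong) (auto simp: F'_def F_def D_def alt_def)
    finally show ?thesis by (simp add: infsum_uminus)
  qed
  have C: "theta1 1 t ^ 2 = infsum H E + infsum H D"
  proof -
    have "theta1 1 t ^ 2 = infsum H UNIV"
      unfolding H_def th power2_eq_square using infsum_product_complex[OF s(2)[OF t] s(2)[OF t]] by simp
    thus ?thesis unfolding E_def D_def infsum_even_odd[OF sH] .
  qed
  have ff: "exp (pi * \<i> * t * u ^ 2) * exp (pi * \<i> * t * v ^ 2) = exp (pi * \<i> * (2 * t) * x ^ 2) * exp (pi * \<i> * (2 * t) * y ^ 2)"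
    if "u = x + y" "v = x - y" for u v x y :: complex
    unfolding that mult_exp_exp by (rule arg_cong[where f = exp]) (simp add: algebra_simps power2_eq_square)
  have "F (x + y, x - y) = f 0 (2 * t) x * f 0 (2 * t) y" for x y
    unfolding F_def f_def prod.case by (rule ff) simp_all
  hence 1: "infsum F E = theta1 0 (2 * t) * theta1 0 (2 * t)"
    unfolding E_def infsum_even_reindex th by (simp only: infsum_product_complex[OF s(1)[OF t2] s(1)[OF t2]])
  have "F (x + y + 1, x - y) = f 1 (2 * t) x * f 1 (2 * t) y" for x y
    unfolding F_def f_def prod.case by (rule ff) simp_all
  hence 2: "infsum F D = theta1 1 (2 * t) * theta1 1 (2 * t)"
    unfolding D_def infsum_odd_reindex(1) th by (simp only: infsum_product_complex[OF s(2)[OF t2] s(2)[OF t2]])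
  have "H (x + y, x - y) = f 1 (2 * t) x * f 0 (2 * t) y" for x y
    unfolding H_def f_def prod.case by (rule ff) simp_all
  hence 3: "infsum H E = theta1 1 (2 * t) * theta1 0 (2 * t)"
    unfolding E_def infsum_even_reindex th by (simp only: infsum_product_complex[OF s(2)[OF t2] s(1)[OF t2]])
  have "H (x + y, x - y - 1) = f 0 (2 * t) x * f 1 (2 * t) y" for x y
    unfolding H_def f_def prod.case by (rule ff) simp_all
  hence 4: "infsum H D = theta1 0 (2 * t) * theta1 1 (2 * t)"
    unfolding D_def infsum_odd_reindex(2) th by (simp only: infsum_product_complex[OF s(1)[OF t2] s(2)[OF t2]])
  have "theta1 0 t ^ 4 - theta1_alt t ^ 4 = (theta1 0 t ^ 2 + theta1_alt t ^ 2) * (theta1 0 t ^ 2 - theta1_alt t ^ 2)"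
    by (simp add: algebra_simps power2_eq_square power4_eq_xxxx)
  also have "\<dots> = (theta1 1 t ^ 2) ^ 2"
    unfolding A B C 1 2 3 4 by (simp add: algebra_simps power2_eq_square)
  finally show ?thesis by (simp add: algebra_simps)
qed

section \<open>Subgroups of a product of two groups\<close>

lemma subgroups_0: "subgroups 0 = {{0 :: 'a::ab_group_add}}"
  by (auto simp: subgroups_def card_1_singleton_iff)

lemma subgroups_1:
  assumes "\<And>x::'a::ab_group_add. x + x = 0"
  shows "subgroups 1 = (\<lambda>x. {0, x}) ` (UNIV - {0::'a})"
proof (intro equalityI subsetI)
  fix V :: "'a set" assume V: "V \<in> subgroups 1"
  hence "card V = 2" "0 \<in> V" by (auto simp: subgroups_def)
  then obtain x where "V = {0, x}" "x \<noteq> 0" by (metis card_2_iff insertE insert_commute singletonD)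
  thus "V \<in> (\<lambda>x. {0, x}) ` (UNIV - {0})" by blast
qed (auto simp: subgroups_def assms)

lemma card_subgroups_0_below: "W \<in> subgroups i \<Longrightarrow> card {H \<in> subgroups 0. H \<subseteq> W} = 1"
proof -
  assume "W \<in> subgroups i"
  hence "{H \<in> subgroups 0. H \<subseteq> W} = {{0}}" unfolding subgroups_0 by (auto simp: subgroups_def)
  thus ?thesis by simp
qed

lemma card_subgroups_1_below:
  fixes W :: "'a::{ab_group_add, finite} set"
  assumes char2: "\<And>x::'a. x + x = 0" and W: "W \<in> subgroups 2"
  shows "card {H \<in> subgroups 1. H \<subseteq> W} = 3"
proof -
  have "{H \<in> subgroups 1. H \<subseteq> W} = (\<lambda>x. {0, x}) ` (W - {0})"
    unfolding subgroups_1[OF char2] using W by (auto simp: subgroups_def)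
  moreover have "inj_on (\<lambda>x. {0, x}) (W - {0})" by (auto simp: inj_on_def doubleton_eq_iff)
  moreover have "card (W - {0}) = 3" using W by (auto simp: subgroups_def)
  ultimately show ?thesis by (simp add: card_image)
qed

text \<open>The coset of \<open>c\<close> avoids \<open>H\<close> and has as many elements as the
  complement of a subgroup of index 2.\<close>

lemma index_2_complement:
  fixes H W :: "'a::{ab_group_add, finite} set"
  assumes char2: "\<And>x::'a. x + x = 0" and H: "H \<in> subgroups i" and W: "W \<in> subgroups (Suc i)" and "H \<subseteq> W"
    and c: "c \<in> W" "c \<notin> H"
  shows "W - H = (+) c ` H"
proof -
  have "(+) c ` H \<subseteq> W - H"
  proof
    fix x assume "x \<in> (+) c ` H"
    then obtain h where h: "h \<in> H" "x = c + h" by blast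
    have "x \<in> W" using h c W \<open>H \<subseteq> W\<close> by (auto simp: subgroups_def)
    moreover have "x \<notin> H"
    proof
      assume "x \<in> H"
      hence "x + h \<in> H" using h H by (auto simp: subgroups_def)
      thus False using c h char2[of h] by (simp add: add.assoc)
    qed
    ultimately show "x \<in> W - H" by blast
  qed
  moreover have "card (W - H) = card ((+) c ` H)"
    using H W \<open>H \<subseteq> W\<close> by (simp add: card_Diff_subset card_image subgroups_def)
  ultimately show ?thesis by (metis card_subset_eq finite)
qed

definition fibres :: "'p \<Rightarrow> 'p \<Rightarrow> 'w set \<Rightarrow> 'w set \<Rightarrow> ('p \<times> 'w) set" where
  "fibres z a H C = {z} \<times> H \<union> {a} \<times> C"

lemma subgroups_over_0:
  "{V \<in> subgroups i. fst ` V = {0 :: 'p::ab_group_add}} = (\<lambda>H. {0} \<times> H) ` (subgroups i :: 'w::ab_group_add set set)"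
proof (intro equalityI subsetI)
  fix V :: "('p \<times> 'w) set" assume "V \<in> {V \<in> subgroups i. fst ` V = {0}}"
  hence V: "V \<in> subgroups i" and f: "fst ` V = {0}" by auto
  have f0: "fst x = 0" if "x \<in> V" for x using f that by blast
  have eq: "V = {0} \<times> snd ` V"
  proof (intro equalityI subsetI)
    fix x assume "x \<in> V"
    thus "x \<in> {0} \<times> snd ` V" using f0[of x] by (cases x) force
  next
    fix x :: "'p \<times> 'w" assume "x \<in> {0} \<times> snd ` V"
    then obtain y where "y \<in> V" "x = (0, snd y)" by auto
    thus "x \<in> V" using f0[of y] by (metis prod.collapse)
  qed
  have "snd ` V \<in> subgroups i"
  proof (rule subgroups_image[OF V])
    show "inj_on snd V" by (rule inj_onI) (use f0 in \<open>simp add: prod_eq_iff\<close>)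
  qed auto
  with eq show "V \<in> (\<lambda>H. {0} \<times> H) ` subgroups i" by blast
next
  fix V :: "('p \<times> 'w) set" assume "V \<in> (\<lambda>H. {0} \<times> H) ` subgroups i"
  then obtain H where H: "H \<in> subgroups i" "V = {0} \<times> H" by blast
  hence "H \<noteq> {}" by (auto simp: subgroups_def)
  thus "V \<in> {V \<in> subgroups i. fst ` V = {0}}"
    using H by (auto simp: subgroups_def card_cartesian_product zero_prod_def)
qed

text \<open>The fibre over \<open>a\<close> is a coset of the fibre \<open>H\<close> over 0. Either
  it is \<open>H\<close> itself, or it is the complement of \<open>H\<close> in the subgroup
  \<open>W\<close> formed by \<open>H\<close> and the coset. The second family is indexed by
  \<open>W\<close> first, since the product over both fibres is then a product over
  \<open>W\<close>.\<close>

lemma subgroups_over_pair: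
  fixes a :: "'p::{ab_group_add, finite}"
  assumes char2p: "a + a = 0" and char2: "\<And>x::'w::{ab_group_add, finite}. x + x = 0" and a: "a \<noteq> 0"
  shows "{V \<in> subgroups (Suc i). fst ` V = {0, a}} =
    (\<lambda>H. fibres 0 a H H) ` (subgroups i :: 'w set set) \<union>
    (\<lambda>(W, H). fibres 0 a H (W - H)) ` (SIGMA W:subgroups (Suc i). {H \<in> subgroups i. H \<subseteq> W})" (is "?L = ?S1 \<union> ?S2")
proof (intro equalityI subsetI)
  fix V assume "V \<in> ?L"
  hence V: "0 \<in> V" "\<And>x y. x \<in> V \<Longrightarrow> y \<in> V \<Longrightarrow> x + y \<in> V" "card V = 2 ^ Suc i" and f: "fst ` V = {0, a}"
    by (auto simp: subgroups_def)
  define H where "H = {w. (0, w) \<in> V}"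
  have "a \<in> fst ` V" using f by simp
  then obtain c where c: "(a, c) \<in> V" by auto
  have H0: "0 \<in> H" "\<And>x y. x \<in> H \<Longrightarrow> y \<in> H \<Longrightarrow> x + y \<in> H"
    using V(1,2) by (auto simp: H_def zero_prod_def dest: V(2))
  have aw: "(a, w) \<in> V \<longleftrightarrow> w \<in> (+) c ` H" for w
  proof
    assume "(a, w) \<in> V"
    from V(2)[OF c this] have "c + w \<in> H" by (simp add: H_def char2p)
    moreover have "w = c + (c + w)" using char2[of c] by (simp flip: add.assoc)
    ultimately show "w \<in> (+) c ` H" by blast
  next
    assume "w \<in> (+) c ` H"
    then obtain h where "(0, h) \<in> V" "w = c + h" by (auto simp: H_def)
    thus "(a, w) \<in> V" using V(2)[OF c] by fastforce
  qed
  have VE: "V = fibres 0 a H ((+) c ` H)"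
  proof (intro equalityI subsetI)
    fix x assume x: "x \<in> V"
    obtain p w where pw: "x = (p, w)" by (cases x)
    have "p \<in> fst ` V" using x pw by force
    hence "p = 0 \<or> p = a" using f by blast
    thus "x \<in> fibres 0 a H ((+) c ` H)" using x aw unfolding pw fibres_def H_def by auto
  next
    fix x assume "x \<in> fibres 0 a H ((+) c ` H)"
    thus "x \<in> V" using aw unfolding fibres_def H_def by auto
  qed
  have "card V = card ({0} \<times> H) + card ({a} \<times> ((+) c ` H))"
    unfolding VE fibres_def by (subst card_Un_disjoint) (use a in auto)
  hence "card H = 2 ^ i" using V(3) by (simp add: card_cartesian_product card_image)
  hence Hs: "H \<in> subgroups i" using H0 by (auto simp: subgroups_def)
  show "V \<in> ?S1 \<union> ?S2"
  proof (cases "c \<in> H")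
    case True
    have "(+) c ` H \<subseteq> H" using H0 True by auto
    hence "(+) c ` H = H" by (intro card_subset_eq) (simp_all add: card_image)
    thus ?thesis using VE Hs by auto
  next
    case False
    define W where "W = H \<union> (+) c ` H"
    have disj: "H \<inter> (+) c ` H = {}"
    proof -
      have "c \<in> H" if "h \<in> H" "c + h \<in> H" for h
        using H0(2)[OF that(2,1)] char2[of h] by (simp add: add.assoc)
      thus ?thesis using False by blast
    qed
    have "card W = 2 ^ Suc i"
      unfolding W_def using disj \<open>card H = 2 ^ i\<close> by (subst card_Un_disjoint) (auto simp: card_image)
    moreover have "x + y \<in> W" if "x \<in> W" "y \<in> W" for x y
    proof -
      have c2: "c + (c + z) = z" for z using char2[of c] by (simp flip: add.assoc)
      obtain h k where hk: "h \<in> H" "k \<in> H" "x = h \<or> x = c + h" "y = k \<or> y = c + k"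
      proof -
        have "\<exists>h\<in>H. x = h \<or> x = c + h" "\<exists>k\<in>H. y = k \<or> y = c + k"
          using \<open>x \<in> W\<close> \<open>y \<in> W\<close> unfolding W_def by auto
        thus ?thesis using that by blast
      qed
      have "x + y = h + k \<or> x + y = c + (h + k)"
        using hk(3,4) by (elim disjE) (simp_all add: c2 add.left_commute[of h c k] add.assoc)
      thus ?thesis using H0(2)[OF hk(1,2)] unfolding W_def by auto
    qed
    ultimately have "W \<in> subgroups (Suc i)" using H0(1) by (auto simp: subgroups_def W_def)
    hence WH: "(W, H) \<in> (SIGMA W:subgroups (Suc i). {H \<in> subgroups i. H \<subseteq> W})"
      using Hs unfolding W_def by blast
    have "W - H = (+) c ` H" using disj unfolding W_def by blast
    hence "V = (case (W, H) of (W, H) \<Rightarrow> fibres 0 a H (W - H))" unfolding prod.case by (simp only: VE[symmetric])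
    hence "V \<in> ?S2" using WH by (rule image_eqI)
    thus ?thesis ..
  qed
next
  fix V assume "V \<in> ?S1 \<union> ?S2"
  then obtain H C where V: "V = fibres 0 a H C" "H \<in> subgroups i"
      and C: "C = H \<or> (\<exists>W. W \<in> subgroups (Suc i) \<and> H \<subseteq> W \<and> C = W - H)" by auto
  obtain c where c: "C = (+) c ` H"
    using C
  proof
    assume "C = H"
    thus ?thesis using that[of 0] by simp
  next
    assume "\<exists>W. W \<in> subgroups (Suc i) \<and> H \<subseteq> W \<and> C = W - H"
    then obtain W where W: "W \<in> subgroups (Suc i)" "H \<subseteq> W" "C = W - H" by blast
    have "H \<noteq> W" using V(2) W(1) by (auto simp: subgroups_def)
    then obtain c where "c \<in> W" "c \<notin> H" using W(2) by blast
    thus ?thesis using that[of c] index_2_complement[OF char2 V(2) W(1,2)] W(3) by blast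
  qed
  have H: "0 \<in> H" "\<And>x y. x \<in> H \<Longrightarrow> y \<in> H \<Longrightarrow> x + y \<in> H" "card H = 2 ^ i"
    using V(2) by (auto simp: subgroups_def)
  have "card V = card ({0} \<times> H) + card ({a} \<times> C)"
    unfolding V(1) fibres_def by (subst card_Un_disjoint) (use a in auto)
  hence "card V = 2 ^ Suc i" using H(3) by (simp add: c card_cartesian_product card_image)
  moreover have "fst ` V = {0, a}" unfolding V(1) fibres_def c using H(1) by (auto simp: image_Un)
  moreover have "0 \<in> V" unfolding V(1) fibres_def using H(1) by (simp add: zero_prod_def)
  moreover have "x + y \<in> V" if "x \<in> V" "y \<in> V" for x y :: "'p \<times> 'w"
  proof -
    have c2: "c + (c + z) = z" for z using char2[of c] by (simp flip: add.assoc)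
    obtain p u q v where xy: "x = (p, u)" "y = (q, v)" by (cases x, cases y)
    obtain h k where hk: "h \<in> H" "k \<in> H" "p = 0 \<and> u = h \<or> p = a \<and> u = c + h" "q = 0 \<and> v = k \<or> q = a \<and> v = c + k"
    proof -
      have "\<exists>h\<in>H. p = 0 \<and> u = h \<or> p = a \<and> u = c + h" "\<exists>k\<in>H. q = 0 \<and> v = k \<or> q = a \<and> v = c + k"
        using \<open>x \<in> V\<close> \<open>y \<in> V\<close> unfolding xy V(1) fibres_def c by auto
      thus ?thesis using that by blast
    qed
    have "p + q = 0 \<and> u + v = h + k \<or> p + q = a \<and> u + v = c + (h + k)"
      using hk(3,4) by (elim disjE) (simp_all add: c2 char2p add.left_commute[of h c k] add.assoc)
    thus ?thesis using H(2)[OF hk(1,2)] unfolding xy V(1) fibres_def c by auto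
  qed
  ultimately show "V \<in> ?L" by (auto simp: subgroups_def)
qed

text \<open>The sums \<open>G i\<close> for an arbitrary function on an arbitrary group, so that the
  factorization becomes a combinatorial identity for products of functions.\<close>

definition subgroup_sum :: "('a::ab_group_add \<Rightarrow> complex) \<Rightarrow> nat \<Rightarrow> complex" where
  "subgroup_sum f i = (\<Sum>V\<in>subgroups i. (\<Prod>v\<in>V. f v) ^ 2 ^ (4 - i))"

lemma fibres_inject: "a \<noteq> z \<Longrightarrow> fibres z a H C = fibres z a H' C' \<longleftrightarrow> H = H' \<and> C = C'"
  unfolding fibres_def by (auto simp: set_eq_iff)

lemma prod_fibres:
  fixes g :: "'p \<Rightarrow> complex" and f :: "'w::finite \<Rightarrow> complex"
  assumes "a \<noteq> z"
  shows "(\<Prod>x\<in>fibres z a H C. g (fst x) * f (snd x)) = g z ^ card H * (\<Prod>w\<in>H. f w) * (g a ^ card C * (\<Prod>w\<in>C. f w))"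
proof -
  have 1: "(\<Prod>x\<in>{p} \<times> S. g (fst x) * f (snd x)) = g p ^ card S * (\<Prod>w\<in>S. f w)" for p S
  proof -
    have "(\<Prod>x\<in>{p} \<times> S. g (fst x) * f (snd x)) = (\<Prod>w\<in>S. g p * f w)"
      by (rule prod.reindex_bij_witness[of _ "\<lambda>w. (p, w)" snd]) auto
    thus ?thesis by (simp add: prod.distrib)
  qed
  show ?thesis unfolding fibres_def using assms by (subst prod.union_disjoint) (auto simp: 1)
qed

lemma sum_over_0:
  fixes g :: "'p::{ab_group_add, finite} \<Rightarrow> complex" and f :: "'w::{ab_group_add, finite} \<Rightarrow> complex"
  assumes i: "i \<le> 4"
  shows "(\<Sum>V | V \<in> subgroups i \<and> fst ` V = {0}. (\<Prod>x\<in>V. g (fst x) * f (snd x)) ^ 2 ^ (4 - i)) = g 0 ^ 16 * subgroup_sum f i"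
proof -
  have "(\<Prod>x\<in>{0} \<times> H. g (fst x) * f (snd x)) ^ 2 ^ (4 - i) = g 0 ^ 16 * (\<Prod>w\<in>H. f w) ^ 2 ^ (4 - i)"
    if H: "H \<in> subgroups i" for H
  proof -
    have "(\<Prod>x\<in>{0} \<times> H. g (fst x) * f (snd x)) = (\<Prod>w\<in>H. g 0 * f w)"
      by (rule prod.reindex_bij_witness[of _ "\<lambda>w. (0, w)" snd]) auto
    also have "\<dots> = g 0 ^ 2 ^ i * (\<Prod>w\<in>H. f w)"
      using H by (simp add: prod.distrib subgroups_def)
    finally have "(\<Prod>x\<in>{0} \<times> H. g (fst x) * f (snd x)) ^ 2 ^ (4 - i) = g 0 ^ (2 ^ i * 2 ^ (4 - i)) * (\<Prod>w\<in>H. f w) ^ 2 ^ (4 - i)"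
      by (simp only: power_mult_distrib power_mult)
    thus ?thesis using i by (simp flip: power_add)
  qed
  note eq = this
  have inj: "inj_on (\<lambda>H. {0} \<times> H) (subgroups i :: 'w set set)" by (auto simp: inj_on_def times_eq_iff)
  show ?thesis
    unfolding subgroups_over_0 subgroup_sum_def sum_distrib_left sum.reindex[OF inj] o_def
    by (rule sum.cong[OF refl eq])
qed

text \<open>If both fibres equal \<open>H\<close>, the product over \<open>H\<close> appears
  squared; the exponent \<open>2 ^ (3 - i)\<close> thus becomes \<open>2 ^ (4 - i)\<close> and gives
  the sum of level \<open>i\<close>. If the fibres make up \<open>W\<close>, the summand depends
  only on \<open>W\<close> and is counted once for each admissible \<open>H\<close> in it.\<close>

lemma sum_over_pair:
  fixes g :: "'p::{ab_group_add, finite} \<Rightarrow> complex" and f :: "'w::{ab_group_add, finite} \<Rightarrow> complex"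
  assumes char2p: "a + a = 0" and char2: "\<And>x::'w. x + x = 0" and a: "a \<noteq> 0" and i: "i \<le> 3"
  shows "(\<Sum>V | V \<in> subgroups (Suc i) \<and> fst ` V = {0, a}. (\<Prod>x\<in>V. g (fst x) * f (snd x)) ^ 2 ^ (3 - i)) =
     (g 0 * g a) ^ 8 * (subgroup_sum f i + (\<Sum>W\<in>subgroups (Suc i). of_nat (card {H \<in> subgroups i. H \<subseteq> W}) * (\<Prod>w\<in>W. f w) ^ 2 ^ (3 - i)))"
proof -
  let ?P = "SIGMA W:subgroups (Suc i). {H \<in> subgroups i. H \<subseteq> W} :: ('w set \<times> 'w set) set"
  define F where "F V = (\<Prod>x\<in>V. g (fst x) * f (snd x)) ^ 2 ^ (3 - i)" for V
  have e: "(2::nat) ^ i * 2 ^ (3 - i) = 8" using i by (simp flip: power_add)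
  have F: "F (fibres 0 a H C) = (g 0 * g a) ^ 8 * ((\<Prod>w\<in>H. f w) * (\<Prod>w\<in>C. f w)) ^ 2 ^ (3 - i)"
    if "card H = 2 ^ i" "card C = 2 ^ i" for H C
  proof -
    have "F (fibres 0 a H C) = ((g 0 * g a) ^ 2 ^ i * ((\<Prod>w\<in>H. f w) * (\<Prod>w\<in>C. f w))) ^ 2 ^ (3 - i)"
      unfolding F_def prod_fibres[OF a] that by (simp only: power_mult_distrib mult_ac)
    thus ?thesis by (simp only: power_mult_distrib power_mult[symmetric] e)
  qed
  have F1: "F (fibres 0 a H H) = (g 0 * g a) ^ 8 * (\<Prod>w\<in>H. f w) ^ 2 ^ (4 - i)" if "H \<in> subgroups i" for H
  proof -
    have "(2::nat) ^ (4 - i) = 2 * 2 ^ (3 - i)" using i by (simp add: Suc_diff_le flip: power_Suc)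
    thus ?thesis using that F[of H H] by (simp add: subgroups_def power_mult power2_eq_square)
  qed
  have F2: "F (fibres 0 a H (W - H)) = (g 0 * g a) ^ 8 * (\<Prod>w\<in>W. f w) ^ 2 ^ (3 - i)"
    if "W \<in> subgroups (Suc i)" "H \<in> subgroups i" "H \<subseteq> W" for W H
  proof -
    have "card (W - H) = 2 ^ i" using that by (simp add: card_Diff_subset subgroups_def)
    moreover have "(\<Prod>w\<in>H. f w) * (\<Prod>w\<in>W - H. f w) = (\<Prod>w\<in>W. f w)"
      using prod.subset_diff[OF that(3), of f] by (simp add: mult.commute)
    ultimately show ?thesis using that(2) F[of H "W - H"] by (simp add: subgroups_def)
  qed
  have inj1: "inj_on (\<lambda>H. fibres 0 a H H) (subgroups i :: 'w set set)"
    using a by (auto simp: inj_on_def fibres_inject)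
  have inj2: "inj_on (\<lambda>(W, H). fibres 0 a H (W - H)) ?P"
    using a by (auto simp: inj_on_def fibres_inject)
  have disj: "(\<lambda>H. fibres 0 a H H) ` (subgroups i :: 'w set set) \<inter> (\<lambda>(W, H). fibres 0 a H (W - H)) ` ?P = {}"
    using a by (auto simp: fibres_inject subgroups_def)
  have "(\<Sum>V | V \<in> subgroups (Suc i) \<and> fst ` V = {0, a}. F V) =
     (\<Sum>H\<in>subgroups i. F (fibres 0 a H H)) + (\<Sum>(W, H)\<in>?P. F (fibres 0 a H (W - H)))"
    unfolding subgroups_over_pair[OF char2p char2 a]
    by (subst sum.union_disjoint[OF _ _ disj], simp, simp, unfold sum.reindex[OF inj1] sum.reindex[OF inj2])
       (simp add: o_def case_prod_unfold)
  also have "(\<Sum>H\<in>subgroups i. F (fibres 0 a H H)) = (g 0 * g a) ^ 8 * subgroup_sum f i"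
    unfolding subgroup_sum_def sum_distrib_left by (intro sum.cong refl F1)
  also have "(\<Sum>(W, H)\<in>?P. F (fibres 0 a H (W - H))) = (\<Sum>W\<in>subgroups (Suc i). \<Sum>H | H \<in> subgroups i \<and> H \<subseteq> W. F (fibres 0 a H (W - H)))"
    by (rule sum.Sigma[symmetric]) auto
  also have "\<dots> = (\<Sum>W\<in>subgroups (Suc i). \<Sum>H | H \<in> subgroups i \<and> H \<subseteq> W. (g 0 * g a) ^ 8 * (\<Prod>w\<in>W. f w) ^ 2 ^ (3 - i))"
    by (intro sum.cong refl F2) auto
  also have "\<dots> = (g 0 * g a) ^ 8 * (\<Sum>W\<in>subgroups (Suc i). of_nat (card {H \<in> subgroups i. H \<subseteq> W}) * (\<Prod>w\<in>W. f w) ^ 2 ^ (3 - i))"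
    by (simp add: sum_distrib_left mult_ac)
  finally show ?thesis unfolding F_def by (simp only: distrib_left)
qed

lemma subgroup_sum_product:
  fixes g :: "'p::{ab_group_add, finite} \<Rightarrow> complex" and f :: "'w::{ab_group_add, finite} \<Rightarrow> complex"
  assumes char2p: "\<And>x::'p. x + x = 0" and char2: "\<And>x::'w. x + x = 0"
    and U: "(UNIV :: 'p set) = {0, a, b, a + b}" and ab: "a \<noteq> 0" "b \<noteq> 0" "a \<noteq> b" and g: "g (a + b) = 0"
    and i: "i \<le> 3"
  shows "subgroup_sum (\<lambda>x. g (fst x) * f (snd x)) (Suc i) = g 0 ^ 16 * subgroup_sum f (Suc i) +
     ((g 0 * g a) ^ 8 + (g 0 * g b) ^ 8) * (subgroup_sum f i + (\<Sum>W\<in>subgroups (Suc i). of_nat (card {H \<in> subgroups i. H \<subseteq> W}) * (\<Prod>w\<in>W. f w) ^ 2 ^ (3 - i)))"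
proof -
  define F where "F V = (\<Prod>x\<in>V. g (fst x) * f (snd x)) ^ 2 ^ (3 - i)" for V
  define S :: "'p set \<Rightarrow> ('p \<times> 'w) set set" where "S P = {V \<in> subgroups (Suc i). fst ` V = P}" for P
  have F0: "F V = 0" if V: "V \<in> subgroups (Suc i) - (S {0} \<union> S {0, a} \<union> S {0, b})" for V
  proof -
    have "a + b \<in> fst ` V"
    proof (rule ccontr)
      assume n: "a + b \<notin> fst ` V"
      have V': "0 \<in> V" "\<And>x y. x \<in> V \<Longrightarrow> y \<in> V \<Longrightarrow> x + y \<in> V" using V by (auto simp: subgroups_def)
      have "0 \<in> fst ` V" using V'(1) by force
      moreover have "\<not> (a \<in> fst ` V \<and> b \<in> fst ` V)"
      proof
        assume "a \<in> fst ` V \<and> b \<in> fst ` V"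
        then obtain u v where "(a, u) \<in> V" "(b, v) \<in> V" by auto
        from V'(2)[OF this] have "(a + b, u + v) \<in> V" by simp
        thus False using n by force
      qed
      moreover have "fst ` V \<subseteq> {0, a, b}"
      proof
        fix x assume x: "x \<in> fst ` V"
        have "x \<in> {0, a, b, a + b}" unfolding U[symmetric] by (rule UNIV_I)
        moreover have "x \<noteq> a + b" using x n by metis
        ultimately show "x \<in> {0, a, b}" by blast
      qed
      moreover have "P = {0} \<or> P = {0, a} \<or> P = {0, b}"
        if "0 \<in> P" "\<not> (a \<in> P \<and> b \<in> P)" "P \<subseteq> {0, a, b}" for P using that by blast
      ultimately have "fst ` V = {0} \<or> fst ` V = {0, a} \<or> fst ` V = {0, b}" by metis
      thus False using V by (auto simp: S_def)
    qed
    then obtain x where x: "x \<in> V" "fst x = a + b" by auto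
    hence "g (fst x) * f (snd x) = 0" using g by simp
    hence "(\<Prod>x\<in>V. g (fst x) * f (snd x)) = 0" using x(1) by (intro prod_zero) auto
    thus ?thesis by (simp add: F_def)
  qed
  have "subgroup_sum (\<lambda>x. g (fst x) * f (snd x)) (Suc i) = sum F (subgroups (Suc i))"
    by (simp add: subgroup_sum_def F_def[abs_def])
  also have "\<dots> = sum F (S {0} \<union> S {0, a} \<union> S {0, b})"
    by (rule sum.mono_neutral_right) (use F0 in \<open>auto simp: S_def\<close>)
  also have "\<dots> = sum F (S {0}) + sum F (S {0, a}) + sum F (S {0, b})"
  proof -
    have "S {0} \<inter> S {0, a} = {}" "(S {0} \<union> S {0, a}) \<inter> S {0, b} = {}"
      using ab by (auto simp: S_def doubleton_eq_iff)
    thus ?thesis by (simp add: sum.union_disjoint)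
  qed
  also have "sum F (S {0}) = g 0 ^ 16 * subgroup_sum f (Suc i)"
    unfolding S_def F_def using sum_over_0[of "Suc i" g f] i by simp
  also have "sum F (S {0, a}) = (g 0 * g a) ^ 8 * (subgroup_sum f i + (\<Sum>W\<in>subgroups (Suc i). of_nat (card {H \<in> subgroups i. H \<subseteq> W}) * (\<Prod>w\<in>W. f w) ^ 2 ^ (3 - i)))"
    unfolding S_def F_def by (rule sum_over_pair[OF char2p char2 ab(1) i])
  also have "sum F (S {0, b}) = (g 0 * g b) ^ 8 * (subgroup_sum f i + (\<Sum>W\<in>subgroups (Suc i). of_nat (card {H \<in> subgroups i. H \<subseteq> W}) * (\<Prod>w\<in>W. f w) ^ 2 ^ (3 - i)))"
    unfolding S_def F_def by (rule sum_over_pair[OF char2p char2 ab(2) i])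
  finally show ?thesis by (simp only: distrib_right[of "(g 0 * g a) ^ 8" "(g 0 * g b) ^ 8"] add.assoc)
qed

text \<open>A 3-dimensional subspace of \<open>\<int>\<^sub>2\<^sup>4\<close> contains an odd characteristic, because totally singular
  subspaces of \<open>quad\<close> have dimension at most 2.\<close>

lemma isotropic_genus2:
  fixes x y z :: "bit^(2 + 2)"
  assumes q: "quad x = 0" "quad y = 0" "quad z = 0" "quad (x + y) = 0" "quad (x + z) = 0" "quad (y + z) = 0"
    and ne: "x \<noteq> 0" "y \<noteq> 0" "z \<noteq> 0" "x \<noteq> y" "x \<noteq> z" "y \<noteq> z" "z \<noteq> x + y"
  shows False
proof -
  \<comment> \<open>All conditions are rewritten as propositional statements about which of the
    twelve coordinates of \<open>x\<close>, \<open>y\<close>, \<open>z\<close> equal 1, and this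
    finite problem is then decided.\<close>
  have add1: "(p + q = 1) = ((p = 1) \<noteq> (q = 1))" and mult1: "(p * q = 1) = (p = 1 \<and> q = 1)" for p q :: bit
    by (cases p; cases q; simp)+
  have eq: "(p = q) = ((p = 1) = (q = 1))" for p q :: bit
    by (cases p; cases q; simp)
  have quad0: "(quad w = 0) = ((w $ Inl 1 = 1 \<and> w $ Inr 1 = 1) = (w $ Inl 2 = 1 \<and> w $ Inr 2 = 1))" for w :: "bit^(2 + 2)"
    unfolding quad_def sum_2 by (subst eq) (simp only: add1 mult1 zero_neq_one, blast)
  have ext: "(u \<noteq> w) = ((u $ Inl 1 = 1) \<noteq> (w $ Inl 1 = 1) \<or> (u $ Inl 2 = 1) \<noteq> (w $ Inl 2 = 1) \<or>
      (u $ Inr 1 = 1) \<noteq> (w $ Inr 1 = 1) \<or> (u $ Inr 2 = 1) \<noteq> (w $ Inr 2 = 1))" for u w :: "bit^(2 + 2)"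
    unfolding vec_eq_iff all_sum forall_2 eq[of "u $ Inl 1" "w $ Inl 1"] eq[of "u $ Inl 2" "w $ Inl 2"]
      eq[of "u $ Inr 1" "w $ Inr 1"] eq[of "u $ Inr 2" "w $ Inr 2"] by blast
  have z01: "((0::bit) = 1) = False" by simp
  show False
    using q ne unfolding quad0 ext vector_add_component add1 zero_index z01 by (smt (verit))
qed

lemma odd_char_in_subgroup_3:
  assumes W: "W \<in> subgroups 3"
  obtains w :: "bit^(2 + 2)" where "w \<in> W" "quad w = 1"
proof -
  have W': "card W = 8" "\<And>x y. x \<in> W \<Longrightarrow> y \<in> W \<Longrightarrow> x + y \<in> W" using W by (auto simp: subgroups_def)
  \<comment> \<open>A list shorter than 8 cannot exhaust \<open>W\<close>. Applied three times, this
    picks vectors outside the span of the previous ones.\<close>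
  have ex: "\<exists>z\<in>W. z \<notin> set xs" if "length xs < 8" for xs
  proof (rule ccontr)
    assume "\<not> (\<exists>z\<in>W. z \<notin> set xs)"
    hence "W \<subseteq> set xs" by blast
    hence "card W \<le> card (set xs)" by (intro card_mono) auto
    also have "\<dots> \<le> length xs" by (rule card_length)
    finally show False using that W'(1) by simp
  qed
  obtain x where x: "x \<in> W" "x \<noteq> 0" using ex[of "[0]"] by auto
  obtain y where y: "y \<in> W" "y \<noteq> 0" "x \<noteq> y" using ex[of "[0, x]"] by auto
  obtain z where z: "z \<in> W" "z \<noteq> 0" "x \<noteq> z" "y \<noteq> z" "z \<noteq> x + y" using ex[of "[0, x, y, x + y]"] by auto
  have "\<exists>w\<in>W. quad w \<noteq> 0"
  proof (rule ccontr)
    assume "\<not> (\<exists>w\<in>W. quad w \<noteq> 0)"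
    hence "quad w = 0" if "w \<in> W" for w using that by blast
    thus False using isotropic_genus2[of x y z] x y z W'(2) by blast
  qed
  thus ?thesis using that by auto
qed

lemma subgroup_prod_theta_eq_0:
  fixes W :: "(bit^(2 + 2)) set"
  assumes "W \<in> subgroups 3" shows "(\<Prod>w\<in>W. theta w \<tau>) = 0"
proof -
  obtain w where "w \<in> W" "quad w = 1" using odd_char_in_subgroup_3[OF assms] by blast
  thus ?thesis using theta_odd_eq_0[of w \<tau>] by (auto simp: prod_zero_iff)
qed

section \<open>Combination of the genus 1 and genus 2 sums\<close>

lemma G_eq_subgroup_sum: "G i \<tau> = subgroup_sum (\<lambda>v. theta v \<tau>) i"
  unfolding G_eq subgroup_sum_def ..

lemma G_diag12:
  assumes "\<tau>\<^sub>1 \<in> siegel" "\<tau>\<^sub>2 \<in> siegel"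
  shows "G i (diag12 \<tau>\<^sub>1 \<tau>\<^sub>2) = subgroup_sum (\<lambda>x. theta (fst x) \<tau>\<^sub>1 * theta (snd x) \<tau>\<^sub>2) i"
proof -
  define s :: "bit^(3 + 3) \<Rightarrow> (bit^(1 + 1)) \<times> (bit^(2 + 2))" where
    "s v = (\<chi> k. case k of Inl i \<Rightarrow> v $ Inl 1 | Inr i \<Rightarrow> v $ Inr 1,
      \<chi> k. case k of Inl i \<Rightarrow> (if i = 1 then v $ Inl 2 else v $ Inl 3) | Inr i \<Rightarrow> (if i = 1 then v $ Inr 2 else v $ Inr 3))" for v
  have sj: "s (join_char x) = x" for x
    unfolding s_def join_char_def
    by (cases x) (simp add: vec_eq_iff all_sum forall_1 forall_2 upper_def lower_def)
  have js: "join_char (s v) = v" for v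
    unfolding s_def join_char_def by (simp add: vec_eq_iff all_sum forall_3 upper_def lower_def)
  have add: "join_char (x + y) = join_char x + join_char y" for x y
    unfolding join_char_def
    by (cases x; cases y) (simp add: vec_eq_iff all_sum forall_3 upper_def lower_def)
  have inj: "inj_on join_char V" for V using sj by (metis inj_on_inverseI)
  have "G i (diag12 \<tau>\<^sub>1 \<tau>\<^sub>2) = (\<Sum>V\<in>subgroups i. (\<Prod>v\<in>join_char ` V. theta v (diag12 \<tau>\<^sub>1 \<tau>\<^sub>2)) ^ 2 ^ (4 - i))"
    unfolding G_eq by (rule sum_subgroups_reindex[of s join_char, OF sj js add])
  moreover have "theta (join_char x) (diag12 \<tau>\<^sub>1 \<tau>\<^sub>2) = theta (fst x) \<tau>\<^sub>1 * theta (snd x) \<tau>\<^sub>2" for x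
    using theta_diag12[OF assms, of "fst x" "snd x"] by simp
  ultimately show ?thesis unfolding subgroup_sum_def by (simp add: prod.reindex[OF inj])
qed

lemma theta_genus1:
  fixes \<tau> :: "complex^1^1"
  shows "theta (characteristic 0 0) \<tau> = theta1 0 (\<tau> $ 1 $ 1)"
    and "theta (characteristic 0 1) \<tau> = theta1_alt (\<tau> $ 1 $ 1)"
    and "theta (characteristic 1 0) \<tau> = theta1 1 (\<tau> $ 1 $ 1)"
proof -
  let ?t = "\<tau> $ 1 $ 1"
  have v1: "(\<chi> i. n $ 1) = n" for n :: "int^1" by (simp add: vec_eq_iff forall_1)
  have red: "infsum f UNIV = (\<Sum>\<^sub>\<infinity>m::int. f (\<chi> i. m))" for f :: "int^1 \<Rightarrow> complex"
    by (rule infsum_reindex_bij_witness[of _ "\<lambda>m. \<chi> i. m" "\<lambda>n. n $ 1"]) (simp_all add: v1)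
  show "theta (characteristic 0 0) \<tau> = theta1 0 ?t"
    unfolding theta_def red theta1_def characteristic_def
    by (intro infsum_cong arg_cong[where f = exp]) (simp add: Let_def sum_1 power2_eq_square mult_ac)
  show "theta (characteristic 1 0) \<tau> = theta1 1 ?t"
    unfolding theta_def red theta1_def characteristic_def
    by (intro infsum_cong arg_cong[where f = exp]) (simp add: Let_def sum_1 power2_eq_square mult_ac)
  have alt: "(if even m then 1 else - 1) = exp (pi * \<i> * of_int m)" for m :: int
  proof (cases "even m")
    case True
    then obtain k where "m = 2 * k" by (elim evenE)
    thus ?thesis using exp_2pi_i_int[of k] by (simp add: mult_ac)
  next
    case False
    then obtain k where k: "m = 2 * k + 1" by (elim oddE)
    have "exp (pi * \<i> * of_int m) = exp (2 * (pi * \<i> * of_int k)) * exp (pi * \<i>)"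
      unfolding k mult_exp_exp by (rule arg_cong[where f = exp]) (simp add: algebra_simps)
    thus ?thesis using False unfolding exp_2pi_i_int by simp
  qed
  show "theta (characteristic 0 1) \<tau> = theta1_alt ?t"
    unfolding theta_def red theta1_alt_def characteristic_def alt mult_exp_exp
    by (intro infsum_cong arg_cong[where f = exp]) (simp add: Let_def sum_1 power2_eq_square algebra_simps)
qed

theorem Xi3_factorization:
  assumes \<tau>: "\<tau>\<^sub>1 \<in> siegel" "\<tau>\<^sub>2 \<in> siegel"
  shows "Xi3 (diag12 \<tau>\<^sub>1 \<tau>\<^sub>2) = Xi1 \<tau>\<^sub>1 * Xi2 \<tau>\<^sub>2"
proof -
  define g where "g p = theta p \<tau>\<^sub>1" for p
  define f where "f w = theta w \<tau>\<^sub>2" for w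
  define a b :: "bit^(1 + 1)" where "a = characteristic 0 1" and "b = characteristic 1 0"
  have c0: "characteristic 0 0 = (0 :: bit^(1 + 1))"
    by (simp add: characteristic_def vec_eq_iff all_sum)
  have cg2: "(\<Sum>W\<in>subgroups (Suc 2). of_nat (card {H \<in> subgroups 2. H \<subseteq> W}) * (\<Prod>w\<in>W. f w) ^ 2 ^ (3 - 2)) = 0"
    by (rule sum.neutral) (simp add: f_def subgroup_prod_theta_eq_0 numeral_3_eq_3[symmetric])
  have ab: "a \<noteq> 0" "b \<noteq> 0" "a \<noteq> b"
    by (simp_all add: a_def b_def characteristic_def vec_eq_iff all_sum forall_1)
  have U: "(UNIV :: (bit^(1 + 1)) set) = {0, a, b, a + b}"
  proof -
    have "p = 0 \<or> p = a \<or> p = b \<or> p = a + b" for p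
      unfolding a_def b_def characteristic_def vec_eq_iff all_sum forall_1
      by (cases "p $ Inl 1"; cases "p $ Inr 1"; simp)
    thus ?thesis by blast
  qed
  have "quad (a + b) = 1"
    by (simp add: quad_def sum_1 a_def b_def characteristic_def)
  hence gab: "g (a + b) = 0" unfolding g_def by (rule theta_odd_eq_0)
  define X where "X = g 0 ^ 16"
  define Y where "Y = (g 0 * g a) ^ 8 + (g 0 * g b) ^ 8"
  define s where "s i = subgroup_sum f i" for i
  note prod = subgroup_sum_product[of a b g _ f, OF bit_vec_add_self bit_vec_add_self U ab gab]
  have G: "G i (diag12 \<tau>\<^sub>1 \<tau>\<^sub>2) = subgroup_sum (\<lambda>x. g (fst x) * f (snd x)) i" for i
    unfolding G_diag12[OF \<tau>] g_def f_def ..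
  have G0: "G 0 (diag12 \<tau>\<^sub>1 \<tau>\<^sub>2) = X * s 0"
    unfolding G by (simp add: subgroup_sum_def subgroups_0 X_def s_def power_mult_distrib)
  have G1: "G 1 (diag12 \<tau>\<^sub>1 \<tau>\<^sub>2) = X * s 1 + Y * (s 0 + s 1)"
  proof -
    have "(\<Sum>W\<in>subgroups (Suc 0). of_nat (card {H \<in> subgroups 0. H \<subseteq> W}) * (\<Prod>w\<in>W. f w) ^ 2 ^ (3 - 0)) = s 1"
      unfolding s_def subgroup_sum_def by (intro sum.cong) (simp_all add: card_subgroups_0_below)
    thus ?thesis using prod[of 0] unfolding G X_def Y_def s_def by simp
  qed
  have G2: "G 2 (diag12 \<tau>\<^sub>1 \<tau>\<^sub>2) = X * s 2 + Y * (s 1 + 3 * s 2)"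
  proof -
    \<comment> \<open>The factor 3 counts the subgroups of order 2 in a group of order 4 and
      exponent 2.\<close>
    have "(\<Sum>W\<in>subgroups (Suc 1). of_nat (card {H \<in> subgroups 1. H \<subseteq> W}) * (\<Prod>w\<in>W. f w) ^ 2 ^ (3 - 1)) = 3 * s 2"
      unfolding s_def subgroup_sum_def sum_distrib_left
      by (intro sum.cong) (simp_all add: card_subgroups_1_below[unfolded One_nat_def] numeral_2_eq_2[symmetric])
    thus ?thesis using prod[of 1] unfolding G X_def Y_def s_def by (simp add: numeral_2_eq_2[symmetric])
  qed
  have s3: "s 3 = 0"
    unfolding s_def subgroup_sum_def by (rule sum.neutral) (simp add: f_def subgroup_prod_theta_eq_0)
  have G3: "G 3 (diag12 \<tau>\<^sub>1 \<tau>\<^sub>2) = Y * s 2"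
    using prod[of 2] s3 unfolding cg2 unfolding G X_def Y_def s_def by (simp add: numeral_3_eq_3[symmetric])
  \<comment> \<open>The coefficient of \<open>Y\<close> is
    \<open>- (s 0 + s 1) + 2 * (s 1 + 3 * s 2) - 8 * s 2\<close>, the negative of the coefficient of
    \<open>X\<close>. The coefficient -8 of \<open>G 3\<close> is what reduces
    \<open>6 * s 2\<close> to \<open>- 2 * s 2\<close>.\<close>
  have "Xi3 (diag12 \<tau>\<^sub>1 \<tau>\<^sub>2) = 1/8 * ((X - Y) * (s 0 - s 1 + 2 * s 2))"
    unfolding Xi3_def G0 G1 G2 G3 by (simp add: algebra_simps)
  moreover have "Xi2 \<tau>\<^sub>2 = 1/4 * (s 0 - s 1 + 2 * s 2)"
    by (simp add: Xi2_def G_eq_subgroup_sum s_def f_def[abs_def])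
  \<comment> \<open>Factoring out \<open>g 0 ^ 8\<close> leaves
    \<open>g 0 ^ 8 - g a ^ 8 - g b ^ 8\<close>, which by Jacobi's identity is the cross term
    \<open>2 * g a ^ 4 * g b ^ 4\<close> of a square.\<close>
  moreover have "X - Y = 2 * Xi1 \<tau>\<^sub>1"
  proof -
    have J: "g 0 ^ 4 = g a ^ 4 + g b ^ 4"
      unfolding g_def a_def b_def c0[symmetric] theta_genus1
      by (rule Jacobi_identity[OF Im_siegel_diag_pos[OF \<tau>(1)]])
    have p: "u ^ 8 = (u ^ 4) ^ 2" "u ^ 16 = (u ^ 4) ^ 4" for u :: complex by (simp_all flip: power_mult)
    have "Xi1 \<tau>\<^sub>1 = g 0 ^ 8 * g a ^ 4 * g b ^ 4"
      by (simp add: Xi1_def g_def a_def b_def c0)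
    thus ?thesis unfolding X_def Y_def power_mult_distrib p J
      by (simp add: power2_eq_square power4_eq_xxxx algebra_simps)
  qed
  ultimately show ?thesis by (simp only:) simp
qed

theorem proposition20:
  shows "modular_form 8 Gamma12 Xi3 \<and>
    (\<forall>\<tau>\<^sub>1\<in>siegel. \<forall>\<tau>\<^sub>2\<in>siegel. Xi3 (diag12 \<tau>\<^sub>1 \<tau>\<^sub>2) = Xi1 \<tau>\<^sub>1 * Xi2 \<tau>\<^sub>2)"
  using Xi3_modular Xi3_factorization by blast

end
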